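(* Let $\mathfrak g_{\mathbb C}$ be a finite-dimensional complex contragredient Lie superalgebra with real form $\mathfrak g$ and Cartan decomposition $\mathfrak g=\mathfrak k\oplus\mathfrak p$. Assume the equal rank condition, i.e. that there is a Cartan subalgebra $\mathfrak h_{\mathbb C}$ of $\mathfrak g_{\mathbb C}$ with $\mathfrak h_{\mathbb C}\subset\mathfrak k_{\mathbb C}$, which we fix; assume also that $\mathfrak k_{\mathbb C}$ has a non-trivial center, and fix an admissible positive system $P$ of roots. Let $\lambda\in\mathfrak h_{\mathbb C}^*$ and let $\pi_\lambda$ be the irreducible highest weight representation of $\mathfrak g_{\mathbb C}$ of highest weight $\lambda$ (with respect to $P$). Then $\pi_\lambda$ is unitary if and only if $$(-i)^{|a|}\,\beta(a^\star a)(\lambda)\ \geq\ 0\qquad\text{for all (homogeneous) } a\in\mathcal U(\mathfrak g_{\mathbb C}).$$ In particular, for $\pi_\lambda$ to be unitary it is necessary that $\lambda(H_\alpha)\ge 0$ for every compact root $\alpha\in P$ and $\lambda(H_\alpha)\le 0$ for every non-compact even root $\alpha\in P$.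
   Context: Here $\mathfrak k$ is a maximal compact subalgebra of $\mathfrak g_0$, $\mathfrak g_0=\mathfrak k\oplus\mathfrak p_0$ is a Cartan decomposition, and $\mathfrak p=\mathfrak p_0\oplus\mathfrak g_1$; $\mathfrak k_{\mathbb C},\mathfrak p_{\mathbb C}$ are the complexifications. Let $\Delta$ be the root system of $(\mathfrak g_{\mathbb C},\mathfrak h_{\mathbb C})$ and $\mathfrak g_{\mathbb C}=\mathfrak h_{\mathbb C}\oplus\sum_{\alpha\in\Delta}\mathfrak g_\alpha$. By the equal rank condition each root space lies in $\mathfrak k_{\mathbb C}$ or in $\mathfrak p_{\mathbb C}$ (for even roots; odd root spaces lie in $\mathfrak p_{\mathbb C}$); $\alpha$ is compact if $\mathfrak g_\alpha\subset\mathfrak k_{\mathbb C}$ and non-compact if $\mathfrak g_\alpha\subset\mathfrak p_{\mathbb C}$. A positive system $P$ is admissible if $\mathfrak p^+=\sum_{\alpha\in P\text{ non-compact}}\mathfrak g_\alpha$ satisfies $[\mathfrak k_{\mathbb C},\mathfrak p^+]\subset\mathfrak p^+$ and $[\mathfrak p^+,\mathfrak p^+]\subset\mathfrak p^+$. For an even root $\alpha$, $H_\alpha\in[\mathfrak g_\alpha,\mathfrak g_{-\alpha}]$ is the coroot, $\alpha(H_\alpha)=2$. $\pi_\lambda$ is the unique irreducible quotient of the Verma module of highest weight $\lambda$. The map $\beta$: for $\mu\in\mathfrak h_{\mathbb C}^*$ let $\mathcal U[\mu]=\{a\in\mathcal U(\mathfrak g_{\mathbb C}) : [H,a]=\mu(H)a\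 \ \forall H\in\mathfrak h_{\mathbb C}\}$, so $\mathcal U(\mathfrak g_{\mathbb C})=\bigoplus_\mu\mathcal U[\mu]$. For $u\in\mathcal U[0]$, $\beta(u)$ is the unique element of $\mathcal U(\mathfrak h_{\mathbb C})$ with $u\equiv\beta(u)$ modulo $\sum_{\gamma\in P}\mathcal U(\mathfrak g_{\mathbb C})\mathfrak g_\gamma$. Extend $\beta$ to a linear map $\mathcal U(\mathfrak g_{\mathbb C})\to\mathcal U(\mathfrak h_{\mathbb C})$ by setting it to $0$ on $\mathcal U[\mu]$ for $\mu\ne0$. Elements of $\mathcal U(\mathfrak h_{\mathbb C})=S(\mathfrak h_{\mathbb C})$ are regarded as polynomial functions on $\mathfrak h_{\mathbb C}^*$, so $\beta(u)(\lambda)\in\mathbb C$. The adjoint $a\mapsto a^\star$ is the unique conjugate-linear map $\mathcal U(\mathfrak g_{\mathbb C})\to\mathcal U(\mathfrak g_{\mathbb C})$ with $1^\star=1$, $(ab)^\star=(-1)^{|a||b|}b^\star a^\star$ for homogeneous $a,b$, and $X^\star=-(-1)^{|X|}X$ for homogeneous $X\in\mathfrak g$ (that is, $X^\star=-X$ for $X\in\mathfrak g_0$, $X^\star=X$ for $X\in\mathfrak g_1$). $|a|\in\{0,1\}$ is the parity. Unitary: a representation $\gamma$ of $\mathfrak g_{\mathbb C}$ on a complex superspace $V=V_0\oplus V_1$ is unitary if $V$ admits a positive definite hermitian product $\langle\cdot,\cdot\rangle$ with $V_0\perp V_1$ such that $i\gamma(Z)$ is symmetric on $V$ for all $Z\in\mathfrak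 g_0$ and $e^{-i\pi/4}\gamma(X)$ is symmetric on $V$ for all $X\in\mathfrak g_1$ (symmetric: $\langle Au,v\rangle=\langle u,Av\rangle$ for all $u,v\in V$). *)

theory Defs
  imports Complex_Main "HOL-Library.Z2" "HOL-Library.Poly_Mapping" "HOL-Library.Nonpos_Ints"
begin

section \<open>Complex vector spaces and superspaces\<close>

class complex_vector = ab_group_add +
  fixes scaleC :: "complex \<Rightarrow> 'a \<Rightarrow> 'a"  (infixr \<open>*\<^sub>C\<close> 75)
  assumes scaleC_add_right: "c *\<^sub>C (x + y) = c *\<^sub>C x + c *\<^sub>C y"
    and scaleC_add_left: "(c + d) *\<^sub>C x = c *\<^sub>C x + d *\<^sub>C x"
    and scaleC_scaleC: "c *\<^sub>C d *\<^sub>C x = (c * d) *\<^sub>C x"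
    and scaleC_one: "1 *\<^sub>C x = x"

global_interpretation cvs: vector_space "scaleC :: complex \<Rightarrow> 'a \<Rightarrow> 'a::complex_vector"
  by unfold_locales
    (auto simp: scaleC_add_right scaleC_add_left scaleC_scaleC scaleC_one)

abbreviation clinear :: "('a::complex_vector \<Rightarrow> 'b::complex_vector) \<Rightarrow> bool" where
  "clinear \<equiv> Vector_Spaces.linear scaleC scaleC"

definition scaleRC :: "real \<Rightarrow> 'a \<Rightarrow> 'a::complex_vector" where
  "scaleRC r x = complex_of_real r *\<^sub>C x"

global_interpretation rvs: vector_space "scaleRC :: real \<Rightarrow> 'a \<Rightarrow> 'a::complex_vector"
  by unfold_locales
    (auto simp: scaleRC_def scaleC_add_right scaleC_add_left scaleC_scaleC scaleC_one)

text \<open>Parities are elements of the field \<^typ>\<open>bit\<close> of two elements. A superspace is a whole type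
  \<^typ>\<open>'a::complex_vector\<close> together with its even part \<^term>\<open>V (0::bit)\<close> and its odd part
  \<^term>\<open>V (1::bit)\<close>.\<close>

definition superspace :: "(bit \<Rightarrow> 'a::complex_vector set) \<Rightarrow> bool" where
  "superspace V \<longleftrightarrow>
     (\<forall>p. cvs.subspace (V p)) \<and> V 0 \<inter> V 1 = {0} \<and> (\<forall>x. \<exists>y\<in>V 0. \<exists>z\<in>V 1. x = y + z)"

definition is_graded :: "(bit \<Rightarrow> 'a::complex_vector set) \<Rightarrow> 'a set \<Rightarrow> bool" where
  "is_graded V S \<longleftrightarrow> (\<forall>x\<in>S. \<exists>y\<in>S \<inter> V 0. \<exists>z\<in>S \<inter> V 1. x = y + z)"

text \<open>The sign \<open>(-1)\<^bsup>pq\<^esup>\<close> of the rule of signs.\<close>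

definition koszul :: "bit \<Rightarrow> bit \<Rightarrow> complex" where
  "koszul p q = (if p = 1 \<and> q = 1 then - 1 else 1)"

section \<open>Lie superalgebras\<close>

text \<open>The whole type is the complex Lie superalgebra \<open>g\<^sub>C\<close>; \<open>hpart 0\<close> and \<open>hpart 1\<close> are its even and
  odd parts.\<close>

class lie_superalgebra = complex_vector +
  fixes brk :: "'a \<Rightarrow> 'a \<Rightarrow> 'a"
    and hpart :: "bit \<Rightarrow> 'a set"
  assumes hpart_zero: "0 \<in> hpart p"
    and hpart_add: "x \<in> hpart p \<Longrightarrow> y \<in> hpart p \<Longrightarrow> x + y \<in> hpart p"
    and hpart_scale: "x \<in> hpart p \<Longrightarrow> c *\<^sub>C x \<in> hpart p"
    and hpart_inter: "hpart 0 \<inter> hpart 1 = {0}"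
    and hpart_decomp: "\<exists>y\<in>hpart 0. \<exists>z\<in>hpart 1. x = y + z"
    and brk_add_left: "brk (x + y) z = brk x z + brk y z"
    and brk_add_right: "brk x (y + z) = brk x y + brk x z"
    and brk_scale_left: "brk (c *\<^sub>C x) y = c *\<^sub>C brk x y"
    and brk_scale_right: "brk x (c *\<^sub>C y) = c *\<^sub>C brk x y"
    and brk_hpart: "x \<in> hpart p \<Longrightarrow> y \<in> hpart q \<Longrightarrow> brk x y \<in> hpart (p + q)"
    and brk_skew: "x \<in> hpart p \<Longrightarrow> y \<in> hpart q \<Longrightarrow> brk x y = - (koszul p q *\<^sub>C brk y x)"
    and brk_jacobi: "x \<in> hpart p \<Longrightarrow> y \<in> hpart q \<Longrightarrow>
       brk x (brk y z) = brk (brk x y) z + koszul p q *\<^sub>C brk y (brk x z)"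

lemma superspace_hpart: "superspace hpart"
  unfolding superspace_def cvs.subspace_def
  using hpart_zero hpart_add hpart_scale hpart_inter hpart_decomp by blast

definition finite_dim :: "'a::complex_vector itself \<Rightarrow> bool" where
  "finite_dim _ \<longleftrightarrow> (\<exists>B::'a set. finite B \<and> cvs.span B = UNIV)"

subsection \<open>Contragredient Lie superalgebras\<close>

definition int_grading :: "(int \<Rightarrow> 'g::lie_superalgebra set) \<Rightarrow> bool" where
  "int_grading G \<longleftrightarrow>
     (\<forall>i. cvs.subspace (G i) \<and> is_graded hpart (G i)) \<and>
     cvs.span (\<Union>i. G i) = UNIV \<and>
     (\<forall>I c. finite I \<longrightarrow> (\<forall>i\<in>I. c i \<in> G i) \<longrightarrow> (\<Sum>i\<in>I. c i) = 0 \<longrightarrow> (\<forall>i\<in>I. c i = 0)) \<and>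
     (\<forall>i j. \<forall>x\<in>G i. \<forall>y\<in>G j. brk x y \<in> G (i + j))"

definition is_ideal :: "'g::lie_superalgebra set \<Rightarrow> bool" where
  "is_ideal J \<longleftrightarrow>
     cvs.subspace J \<and> is_graded hpart J \<and> (\<forall>x. \<forall>y\<in>J. brk x y \<in> J)"

definition basis_of :: "nat \<Rightarrow> (nat \<Rightarrow> 'a::complex_vector) \<Rightarrow> 'a set \<Rightarrow> bool" where
  "basis_of n b S \<longleftrightarrow>
     inj_on b {..<n} \<and> cvs.independent (b ` {..<n}) \<and> cvs.span (b ` {..<n}) = S"

text \<open>Kac's \<open>G(A, \<tau>)\<close>: the minimal \<open>\<int>\<close>-graded Lie superalgebra with local part
  \<open>G\<^sub>-\<^sub>1 \<oplus> G\<^sub>0 \<oplus> G\<^sub>1\<close>, where \<open>f i\<close>, \<open>h i\<close>, \<open>e i\<close> are bases of \<open>G\<^sub>-\<^sub>1\<close>, \<open>G\<^sub>0\<close>, \<open>G\<^sub>1\<close> subject to the relations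
  below. The last two clauses say that the algebra is this minimal one: it is generated by its local
  part (so it is a quotient of the maximal graded Lie superalgebra with that local part), and it has
  no nonzero graded ideal meeting the local part trivially.\<close>

definition is_contragredient_of ::
  "nat \<Rightarrow> (nat \<Rightarrow> nat \<Rightarrow> complex) \<Rightarrow> nat set \<Rightarrow> (int \<Rightarrow> 'g::lie_superalgebra set) \<Rightarrow>
   (nat \<Rightarrow> 'g) \<Rightarrow> (nat \<Rightarrow> 'g) \<Rightarrow> (nat \<Rightarrow> 'g) \<Rightarrow> bool" where
  "is_contragredient_of n A \<tau> G e f h \<longleftrightarrow>
     int_grading G \<and>
     basis_of n f (G (- 1)) \<and> basis_of n h (G 0) \<and> basis_of n e (G 1) \<and>
     (\<forall>i<n. h i \<in> hpart 0 \<and>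
        e i \<in> hpart (if i \<in> \<tau> then 1 else 0) \<and> f i \<in> hpart (if i \<in> \<tau> then 1 else 0)) \<and>
     (\<forall>i<n. \<forall>j<n.
        brk (e i) (f j) = (if i = j then h i else 0) \<and>
        brk (h i) (h j) = 0 \<and>
        brk (h i) (e j) = A i j *\<^sub>C e j \<and>
        brk (h i) (f j) = - (A i j *\<^sub>C f j)) \<and>
     (\<forall>S. cvs.subspace S \<longrightarrow> (\<forall>x\<in>S. \<forall>y\<in>S. brk x y \<in> S) \<longrightarrow>
        G (- 1) \<union> G 0 \<union> G 1 \<subseteq> S \<longrightarrow> S = UNIV) \<and>
     (\<forall>J. is_ideal J \<longrightarrow> J \<subseteq> cvs.span (\<Union>i. J \<inter> G i) \<longrightarrow>
        J \<inter> cvs.span (G (- 1) \<union> G 0 \<union> G 1) = {0} \<longrightarrow> J = {0})"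

definition contragredient :: "'g::lie_superalgebra itself \<Rightarrow> bool" where
  "contragredient _ \<longleftrightarrow>
     (\<exists>n A \<tau> G e f h. is_contragredient_of n A \<tau> (G :: int \<Rightarrow> 'g set) e f h)"

subsection \<open>Real forms and Cartan decompositions\<close>

definition real_subalgebra :: "'g::lie_superalgebra set \<Rightarrow> bool" where
  "real_subalgebra S \<longleftrightarrow> rvs.subspace S \<and> (\<forall>x\<in>S. \<forall>y\<in>S. brk x y \<in> S)"

definition real_form :: "'g::lie_superalgebra set \<Rightarrow> bool" where
  "real_form g \<longleftrightarrow>
     real_subalgebra g \<and> is_graded hpart g \<and>
     (\<forall>x. \<exists>y\<in>g. \<exists>z\<in>g. x = y + \<i> *\<^sub>C z) \<and> (\<forall>y\<in>g. \<i> *\<^sub>C y \<in> g \<longrightarrow> y = 0)"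

definition symm_bilinear_on :: "'g::complex_vector set \<Rightarrow> ('g \<Rightarrow> 'g \<Rightarrow> real) \<Rightarrow> bool" where
  "symm_bilinear_on S B \<longleftrightarrow>
     (\<forall>x\<in>S. \<forall>y\<in>S. B x y = B y x) \<and>
     (\<forall>x\<in>S. \<forall>y\<in>S. \<forall>z\<in>S. B (x + y) z = B x z + B y z) \<and>
     (\<forall>r. \<forall>x\<in>S. \<forall>y\<in>S. B (scaleRC r x) y = r * B x y)"

text \<open>Compactness is taken in the adjoint representation on the whole real superalgebra \<open>g\<close>: \<open>ad k\<close>
  acts on \<open>g\<close> by skew operators for some inner product. (The adjoint representation on \<open>g\<^sub>0\<close> alone
  would not see whether the centre of \<open>g\<^sub>0\<close> is compact.)\<close>

definition compact_subalgebra :: "'g::lie_superalgebra set \<Rightarrow> 'g set \<Rightarrow> bool" where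
  "compact_subalgebra g k \<longleftrightarrow>
     real_subalgebra k \<and> k \<subseteq> g \<inter> hpart 0 \<and>
     (\<exists>Q. symm_bilinear_on g Q \<and> (\<forall>x\<in>g. x \<noteq> 0 \<longrightarrow> Q x x > 0) \<and>
          (\<forall>z\<in>k. \<forall>x\<in>g. \<forall>y\<in>g. Q (brk z x) y = - Q x (brk z y)))"

definition maximal_compact_subalgebra :: "'g::lie_superalgebra set \<Rightarrow> 'g set \<Rightarrow> bool" where
  "maximal_compact_subalgebra g k \<longleftrightarrow>
     compact_subalgebra g k \<and> (\<forall>k'. compact_subalgebra g k' \<longrightarrow> k \<subseteq> k' \<longrightarrow> k' = k)"

text \<open>The even part \<open>g\<^sub>0\<close> is only reductive, so an invariant form \<open>B\<close> replaces its Killing form.\<close>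

definition cartan_decomposition :: "'g::lie_superalgebra set \<Rightarrow> 'g set \<Rightarrow> 'g set \<Rightarrow> bool" where
  "cartan_decomposition g k p0 \<longleftrightarrow>
     rvs.subspace k \<and> rvs.subspace p0 \<and> k \<subseteq> g \<inter> hpart 0 \<and> p0 \<subseteq> g \<inter> hpart 0 \<and>
     k \<inter> p0 = {0} \<and> (\<forall>x\<in>g \<inter> hpart 0. \<exists>y\<in>k. \<exists>z\<in>p0. x = y + z) \<and>
     (\<forall>x\<in>k. \<forall>y\<in>k. brk x y \<in> k) \<and> (\<forall>x\<in>k. \<forall>y\<in>p0. brk x y \<in> p0) \<and>
     (\<forall>x\<in>p0. \<forall>y\<in>p0. brk x y \<in> k) \<and>
     (\<exists>B. symm_bilinear_on (g \<inter> hpart 0) B \<and>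
          (\<forall>x\<in>g \<inter> hpart 0. \<forall>y\<in>g \<inter> hpart 0. \<forall>z\<in>g \<inter> hpart 0. B (brk x y) z = B x (brk y z)) \<and>
          (\<forall>x\<in>k. x \<noteq> 0 \<longrightarrow> B x x < 0) \<and> (\<forall>x\<in>p0. x \<noteq> 0 \<longrightarrow> B x x > 0) \<and>
          (\<forall>x\<in>k. \<forall>y\<in>p0. B x y = 0))"

text \<open>For a real subspace \<open>S\<close> of \<open>g\<close>, \<^term>\<open>cvs.span S\<close> is its complexification inside \<open>g\<^sub>C\<close>.\<close>

definition p_complex :: "'g::lie_superalgebra set \<Rightarrow> 'g set \<Rightarrow> 'g set" where
  "p_complex g p0 = cvs.span (p0 \<union> (g \<inter> hpart 1))"

definition center_of :: "'g::lie_superalgebra set \<Rightarrow> 'g set" where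
  "center_of S = {z \<in> S. \<forall>x\<in>S. brk z x = 0}"

subsection \<open>Cartan subalgebras and roots\<close>

primrec lower_central :: "'g::lie_superalgebra set \<Rightarrow> nat \<Rightarrow> 'g set" where
  "lower_central S 0 = S"
| "lower_central S (Suc n) = cvs.span {brk x y | x y. x \<in> S \<and> y \<in> lower_central S n}"

definition cartan_subalgebra :: "'g::lie_superalgebra set \<Rightarrow> bool" where
  "cartan_subalgebra hC \<longleftrightarrow>
     cvs.subspace hC \<and> is_graded hpart hC \<and> (\<forall>x\<in>hC. \<forall>y\<in>hC. brk x y \<in> hC) \<and>
     (\<exists>n. lower_central hC n = {0}) \<and>
     {x. \<forall>y\<in>hC. brk x y \<in> hC} = hC"

text \<open>Linear forms on \<open>hC\<close> are represented by functions on \<open>g\<^sub>C\<close> that vanish outside \<open>hC\<close>, so that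
  equal forms are equal functions.\<close>

definition dual_of :: "'g::complex_vector set \<Rightarrow> ('g \<Rightarrow> complex) set" where
  "dual_of hC = {\<mu>. (\<forall>x\<in>hC. \<forall>y\<in>hC. \<mu> (x + y) = \<mu> x + \<mu> y) \<and>
                     (\<forall>c. \<forall>x\<in>hC. \<mu> (c *\<^sub>C x) = c * \<mu> x) \<and> (\<forall>x. x \<notin> hC \<longrightarrow> \<mu> x = 0)}"

definition root_space :: "'g::lie_superalgebra set \<Rightarrow> ('g \<Rightarrow> complex) \<Rightarrow> 'g set" where
  "root_space hC \<alpha> = {x. \<forall>H\<in>hC. brk H x = \<alpha> H *\<^sub>C x}"

definition roots :: "'g::lie_superalgebra set \<Rightarrow> ('g \<Rightarrow> complex) set" where
  "roots hC = {\<alpha> \<in> dual_of hC. \<alpha> \<noteq> (\<lambda>_. 0) \<and> root_space hC \<alpha> \<noteq> {0}}"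

text \<open>Positive systems are the sets of roots on the positive side of a real hyperplane of \<open>hC\<^sup>*\<close> that
  contains no root; every real linear functional on \<open>hC\<^sup>*\<close> has the form \<open>\<mu> \<mapsto> Re (\<mu> H)\<close>.\<close>

definition positive_system :: "'g::lie_superalgebra set \<Rightarrow> ('g \<Rightarrow> complex) set \<Rightarrow> bool" where
  "positive_system hC P \<longleftrightarrow>
     (\<exists>H\<in>hC. (\<forall>\<alpha>\<in>roots hC. Re (\<alpha> H) \<noteq> 0) \<and> P = {\<alpha> \<in> roots hC. Re (\<alpha> H) > 0})"

definition compact_root :: "'g::lie_superalgebra set \<Rightarrow> 'g set \<Rightarrow> ('g \<Rightarrow> complex) \<Rightarrow> bool" where
  "compact_root hC k \<alpha> \<longleftrightarrow> \<alpha> \<in> roots hC \<and> root_space hC \<alpha> \<subseteq> cvs.span k"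

definition noncompact_root ::
  "'g::lie_superalgebra set \<Rightarrow> 'g set \<Rightarrow> 'g set \<Rightarrow> ('g \<Rightarrow> complex) \<Rightarrow> bool" where
  "noncompact_root hC g p0 \<alpha> \<longleftrightarrow> \<alpha> \<in> roots hC \<and> root_space hC \<alpha> \<subseteq> p_complex g p0"

definition even_root :: "'g::lie_superalgebra set \<Rightarrow> ('g \<Rightarrow> complex) \<Rightarrow> bool" where
  "even_root hC \<alpha> \<longleftrightarrow> \<alpha> \<in> roots hC \<and> root_space hC \<alpha> \<subseteq> hpart 0"

definition p_plus ::
  "'g::lie_superalgebra set \<Rightarrow> 'g set \<Rightarrow> 'g set \<Rightarrow> ('g \<Rightarrow> complex) set \<Rightarrow> 'g set" where
  "p_plus hC g p0 P = cvs.span (\<Union>\<alpha>\<in>{\<alpha> \<in> P. noncompact_root hC g p0 \<alpha>}. root_space hC \<alpha>)"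

definition admissible ::
  "'g::lie_superalgebra set \<Rightarrow> 'g set \<Rightarrow> 'g set \<Rightarrow> 'g set \<Rightarrow> ('g \<Rightarrow> complex) set \<Rightarrow> bool" where
  "admissible hC g k p0 P \<longleftrightarrow>
     (\<forall>x\<in>cvs.span k. \<forall>y\<in>p_plus hC g p0 P. brk x y \<in> p_plus hC g p0 P) \<and>
     (\<forall>x\<in>p_plus hC g p0 P. \<forall>y\<in>p_plus hC g p0 P. brk x y \<in> p_plus hC g p0 P)"

definition coroot :: "'g::lie_superalgebra set \<Rightarrow> ('g \<Rightarrow> complex) \<Rightarrow> 'g" where
  "coroot hC \<alpha> = (THE H.
     H \<in> cvs.span {brk x y | x y. x \<in> root_space hC \<alpha> \<and> y \<in> root_space hC (\<lambda>H. - \<alpha> H)} \<and>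
     \<alpha> H = 2)"

section \<open>The universal enveloping superalgebra\<close>

text \<open>The free complex associative algebra on the set of all elements of \<open>g\<^sub>C\<close>, realised as the
  monoid algebra of the free monoid, is divided by the two-sided ideal generated by the linear
  relations of \<open>g\<^sub>C\<close> and by \<open>x y - (-1)\<^bsup>|x||y|\<^esup> y x - [x, y]\<close>.\<close>

datatype 'a word = Word "'a list"

instantiation word :: (type) monoid_add
begin

definition zero_word :: "'a word" where "0 = Word []"

fun plus_word :: "'a word \<Rightarrow> 'a word \<Rightarrow> 'a word" where
  "Word xs + Word ys = Word (xs @ ys)"

instance
proof
  fix a b c :: "'a word"
  show "a + b + c = a + (b + c)" by (cases a; cases b; cases c) simp
  show "0 + a = a" by (cases a) (simp add: zero_word_def)
  show "a + 0 = a" by (cases a) (simp add: zero_word_def)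
qed

end

type_synonym 'a free_alg = "'a word \<Rightarrow>\<^sub>0 complex"

definition free_gen :: "'a \<Rightarrow> 'a free_alg" where
  "free_gen x = Poly_Mapping.single (Word [x]) 1"

definition free_const :: "complex \<Rightarrow> 'a free_alg" where
  "free_const c = Poly_Mapping.single 0 c"

inductive_set uea_ideal :: "'g::lie_superalgebra free_alg set" where
  rel_add: "a * (free_gen (x + y) - free_gen x - free_gen y) * b \<in> uea_ideal"
| rel_scale: "a * (free_gen (c *\<^sub>C x) - free_const c * free_gen x) * b \<in> uea_ideal"
| rel_brk: "x \<in> hpart p \<Longrightarrow> y \<in> hpart q \<Longrightarrow>
    a * (free_gen x * free_gen y - free_const (koszul p q) * free_gen y * free_gen x
         - free_gen (brk x y)) * b \<in> uea_ideal"
| ideal_add: "u \<in> uea_ideal \<Longrightarrow> v \<in> uea_ideal \<Longrightarrow> u + v \<in> uea_ideal"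

lemma uea_ideal_mult: "u \<in> uea_ideal \<Longrightarrow> c * u * d \<in> uea_ideal"
proof (induction rule: uea_ideal.induct)
  case (rel_add a x y b)
  then show ?case using uea_ideal.rel_add[of "c * a" x y "b * d"] by (simp add: mult.assoc)
next
  case (rel_scale a c' x b)
  then show ?case using uea_ideal.rel_scale[of "c * a" c' x "b * d"] by (simp add: mult.assoc)
next
  case (rel_brk x p y q a b)
  then show ?case using uea_ideal.rel_brk[of x p y q "c * a" "b * d"] by (simp add: mult.assoc)
next
  case (ideal_add u v)
  then show ?case
    using uea_ideal.ideal_add[of "c * u * d" "c * v * d"] by (simp add: distrib_left distrib_right)
qed

lemma uea_ideal_left: "u \<in> uea_ideal \<Longrightarrow> c * u \<in> uea_ideal"
  using uea_ideal_mult[of u c 1] by simp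

lemma uea_ideal_right: "u \<in> uea_ideal \<Longrightarrow> u * d \<in> uea_ideal"
  using uea_ideal_mult[of u 1 d] by simp

lemma uea_ideal_uminus: "u \<in> uea_ideal \<Longrightarrow> - u \<in> uea_ideal"
  using uea_ideal_left[of u "- 1"] by simp

lemma uea_ideal_zero: "0 \<in> uea_ideal"
  using uea_ideal.rel_add[of 0] by simp

lemma word_add_eq_zero_iff: "(0 = u + v) \<longleftrightarrow> u = 0 \<and> v = (0 :: 'a word)"
  by (cases u; cases v) (auto simp: zero_word_def)

lemma lookup_mult_zero:
  fixes a b :: "'a free_alg"
  shows "Poly_Mapping.lookup (a * b) 0 = Poly_Mapping.lookup a 0 * Poly_Mapping.lookup b 0"
proof -
  have "Poly_Mapping.lookup (a * b) 0 =
      (\<Sum>l. Poly_Mapping.lookup a l * (\<Sum>q. Poly_Mapping.lookup b q when 0 = l + q))"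
    by (simp add: lookup_mult)
  also have "\<dots> = (\<Sum>l. (Poly_Mapping.lookup a l * Poly_Mapping.lookup b 0) when l = 0)"
  proof (rule arg_cong[where f = Sum_any], rule ext)
    fix l :: "'a word"
    have "(\<Sum>q. Poly_Mapping.lookup b q when 0 = l + q) =
        (\<Sum>q. (Poly_Mapping.lookup b q when l = 0) when q = 0)"
      by (rule arg_cong[where f = Sum_any]) (auto simp: fun_eq_iff when_def word_add_eq_zero_iff)
    then show "Poly_Mapping.lookup a l * (\<Sum>q. Poly_Mapping.lookup b q when 0 = l + q) =
        (Poly_Mapping.lookup a l * Poly_Mapping.lookup b 0 when l = 0)"
      by (simp add: when_def)
  qed
  also have "\<dots> = Poly_Mapping.lookup a 0 * Poly_Mapping.lookup b 0" by simp
  finally show ?thesis .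
qed

lemma lookup_free_gen_zero: "Poly_Mapping.lookup (free_gen x) 0 = 0"
  by (simp add: free_gen_def lookup_single zero_word_def when_def)

lemma lookup_uea_ideal_zero: "u \<in> uea_ideal \<Longrightarrow> Poly_Mapping.lookup u 0 = 0"
  by (induction rule: uea_ideal.induct)
    (auto simp: lookup_mult_zero lookup_add lookup_minus lookup_free_gen_zero)

definition uea_rel :: "'g::lie_superalgebra free_alg \<Rightarrow> 'g free_alg \<Rightarrow> bool" where
  "uea_rel u v \<longleftrightarrow> u - v \<in> uea_ideal"

lemma equivp_uea_rel: "equivp uea_rel"
proof (rule equivpI)
  show "reflp uea_rel" by (simp add: reflp_def uea_rel_def uea_ideal_zero)
  show "symp uea_rel"
    unfolding symp_def uea_rel_def using uea_ideal_uminus by (metis minus_diff_eq)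
  show "transp uea_rel"
  proof (rule transpI)
    fix u v w :: "'g::lie_superalgebra free_alg"
    assume "uea_rel u v" "uea_rel v w"
    then show "uea_rel u w"
      using uea_ideal.ideal_add[of "u - v" "v - w"] by (simp add: uea_rel_def)
  qed
qed

quotient_type (overloaded) 'g uea = "'g::lie_superalgebra free_alg" / uea_rel
  by (rule equivp_uea_rel)

instantiation uea :: (lie_superalgebra) "{ring_1, complex_vector}"
begin

lift_definition zero_uea :: "'a uea" is 0 .

lift_definition one_uea :: "'a uea" is 1 .

lift_definition plus_uea :: "'a uea \<Rightarrow> 'a uea \<Rightarrow> 'a uea" is "(+)"
  unfolding uea_rel_def using uea_ideal.ideal_add by (metis add_diff_add)

lift_definition uminus_uea :: "'a uea \<Rightarrow> 'a uea" is "uminus"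
  unfolding uea_rel_def using uea_ideal_uminus by (metis minus_diff_minus)

lift_definition minus_uea :: "'a uea \<Rightarrow> 'a uea \<Rightarrow> 'a uea" is "(-)"
proof -
  fix u v u' v' :: "'a free_alg"
  assume "uea_rel u v" "uea_rel u' v'"
  then have "(u - v) + - (u' - v') \<in> uea_ideal"
    unfolding uea_rel_def by (intro uea_ideal.ideal_add uea_ideal_uminus)
  then show "uea_rel (u - u') (v - v')"
    unfolding uea_rel_def by (simp add: algebra_simps)
qed

lift_definition times_uea :: "'a uea \<Rightarrow> 'a uea \<Rightarrow> 'a uea" is "(*)"
proof -
  fix u v u' v' :: "'a free_alg"
  assume "uea_rel u v" "uea_rel u' v'"
  then have "(u - v) * u' + v * (u' - v') \<in> uea_ideal"
    unfolding uea_rel_def by (intro uea_ideal.ideal_add uea_ideal_left uea_ideal_right)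
  then show "uea_rel (u * u') (v * v')"
    unfolding uea_rel_def by (simp add: algebra_simps)
qed

lift_definition scaleC_uea :: "complex \<Rightarrow> 'a uea \<Rightarrow> 'a uea" is "\<lambda>c u. free_const c * u"
  unfolding uea_rel_def using uea_ideal_left by (metis right_diff_distrib)

instance
proof
  fix a b c :: "'a uea" and x y :: complex
  show "a + b + c = a + (b + c)"
    by transfer (simp add: uea_rel_def uea_ideal_zero add.assoc)
  show "a + b = b + a"
    by transfer (simp add: uea_rel_def uea_ideal_zero add.commute)
  show "0 + a = a" by transfer (simp add: uea_rel_def uea_ideal_zero)
  show "- a + a = 0" by transfer (simp add: uea_rel_def uea_ideal_zero)
  show "a - b = a + - b" by transfer (simp add: uea_rel_def uea_ideal_zero)
  show "a * b * c = a * (b * c)"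
    by transfer (simp add: uea_rel_def uea_ideal_zero mult.assoc)
  show "1 * a = a" by transfer (simp add: uea_rel_def uea_ideal_zero)
  show "a * 1 = a" by transfer (simp add: uea_rel_def uea_ideal_zero)
  show "(a + b) * c = a * c + b * c"
    by transfer (simp add: uea_rel_def uea_ideal_zero distrib_right)
  show "a * (b + c) = a * b + a * c"
    by transfer (simp add: uea_rel_def uea_ideal_zero distrib_left)
  show "x *\<^sub>C (a + b) = x *\<^sub>C a + x *\<^sub>C b"
    by transfer (simp add: uea_rel_def uea_ideal_zero distrib_left)
  show "(x + y) *\<^sub>C a = x *\<^sub>C a + y *\<^sub>C a"
    by transfer (simp add: uea_rel_def uea_ideal_zero free_const_def single_add distrib_right)
  show "x *\<^sub>C y *\<^sub>C a = (x * y) *\<^sub>C a"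
    by transfer (simp add: uea_rel_def uea_ideal_zero free_const_def mult_single mult.assoc[symmetric])
  show "1 *\<^sub>C a = a"
    by transfer (simp add: uea_rel_def uea_ideal_zero free_const_def)
  show "(0::'a uea) \<noteq> 1"
    by transfer (use lookup_uea_ideal_zero[of "- 1"] in \<open>auto simp: uea_rel_def\<close>)
qed

end

lift_definition uea_gen :: "'g::lie_superalgebra \<Rightarrow> 'g uea" is free_gen .

lemma uea_gen_add: "uea_gen (x + y) = uea_gen x + uea_gen y"
  by transfer (use uea_ideal.rel_add[of 1 _ _ 1] in \<open>simp add: uea_rel_def algebra_simps\<close>)

lemma uea_gen_scale: "uea_gen (c *\<^sub>C x) = c *\<^sub>C uea_gen x"
  by transfer (use uea_ideal.rel_scale[of 1 _ _ 1] in \<open>simp add: uea_rel_def\<close>)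

lemma uea_gen_brk:
  assumes "x \<in> hpart p" "y \<in> hpart q"
  shows "uea_gen (brk x y) =
    uea_gen x * uea_gen y - koszul p q *\<^sub>C (uea_gen y * uea_gen x)"
  using assms
proof transfer
  fix x y :: 'a and p q
  assume "x \<in> hpart p" "y \<in> hpart q"
  from uea_ideal_uminus[OF uea_ideal.rel_brk[OF this, of 1 1]]
  show "uea_rel (free_gen (brk x y))
      (free_gen x * free_gen y - free_const (koszul p q) * (free_gen y * free_gen x))"
    by (simp add: uea_rel_def mult.assoc)
qed

text \<open>\<open>uea_part p\<close> is the set of elements of \<open>U(g\<^sub>C)\<close> that are homogeneous of parity \<open>p\<close>.\<close>

definition uea_part :: "bit \<Rightarrow> 'g::lie_superalgebra uea set" where
  "uea_part p = cvs.span {prod_list (map uea_gen xs) | xs ps.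
     list_all2 (\<lambda>x q. x \<in> hpart q) xs ps \<and> sum_list ps = p}"

subsection \<open>The adjoint\<close>

definition is_uea_adjoint :: "'g::lie_superalgebra set \<Rightarrow> ('g uea \<Rightarrow> 'g uea) \<Rightarrow> bool" where
  "is_uea_adjoint g s \<longleftrightarrow>
     (\<forall>a b. s (a + b) = s a + s b) \<and> (\<forall>c a. s (c *\<^sub>C a) = cnj c *\<^sub>C s a) \<and>
     s 1 = 1 \<and>
     (\<forall>p q. \<forall>a\<in>uea_part p. \<forall>b\<in>uea_part q. s (a * b) = koszul p q *\<^sub>C (s b * s a)) \<and>
     (\<forall>p. \<forall>x\<in>g \<inter> hpart p. s (uea_gen x) = - (koszul p p *\<^sub>C uea_gen x))"

definition uea_adjoint :: "'g::lie_superalgebra set \<Rightarrow> 'g uea \<Rightarrow> 'g uea" where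
  "uea_adjoint g = (THE s. is_uea_adjoint g s)"

subsection \<open>The projection \<open>\<beta>\<close> and evaluation at a weight\<close>

definition uea_weight :: "'g::lie_superalgebra set \<Rightarrow> ('g \<Rightarrow> complex) \<Rightarrow> 'g uea set" where
  "uea_weight hC \<mu> = {a. \<forall>H\<in>hC. uea_gen H * a - a * uea_gen H = \<mu> H *\<^sub>C a}"

text \<open>\<open>U(h\<^sub>C)\<close>, as the subalgebra of \<open>U(g\<^sub>C)\<close> generated by \<open>h\<^sub>C\<close>.\<close>

definition uea_cartan :: "'g::lie_superalgebra set \<Rightarrow> 'g uea set" where
  "uea_cartan hC = cvs.span {prod_list (map uea_gen xs) | xs. set xs \<subseteq> hC}"

text \<open>The left ideal \<open>\<Sum>\<^bsub>\<gamma>\<in>P\<^esub> U(g\<^sub>C) g\<^sub>\<gamma>\<close>.\<close>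

definition uea_nplus ::
  "'g::lie_superalgebra set \<Rightarrow> ('g \<Rightarrow> complex) set \<Rightarrow> 'g uea set" where
  "uea_nplus hC P = cvs.span {a * uea_gen x | a x. \<exists>\<gamma>\<in>P. x \<in> root_space hC \<gamma>}"

definition is_beta ::
  "'g::lie_superalgebra set \<Rightarrow> ('g \<Rightarrow> complex) set \<Rightarrow> ('g uea \<Rightarrow> 'g uea) \<Rightarrow> bool" where
  "is_beta hC P b \<longleftrightarrow>
     clinear b \<and>
     (\<forall>u\<in>uea_weight hC (\<lambda>_. 0). b u \<in> uea_cartan hC \<and> u - b u \<in> uea_nplus hC P) \<and>
     (\<forall>\<mu>\<in>dual_of hC. \<mu> \<noteq> (\<lambda>_. 0) \<longrightarrow> (\<forall>u\<in>uea_weight hC \<mu>. b u = 0))"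

text \<open>By the Poincare-Birkhoff-Witt theorem there is exactly one such map.\<close>

definition beta ::
  "'g::lie_superalgebra set \<Rightarrow> ('g \<Rightarrow> complex) set \<Rightarrow> 'g uea \<Rightarrow> 'g uea" where
  "beta hC P = (SOME b. is_beta hC P b)"

text \<open>An element of \<open>U(h\<^sub>C) = S(h\<^sub>C)\<close> is a polynomial function on \<open>h\<^sub>C\<^sup>*\<close>. Its value at \<open>\<lambda>\<close> is its image
  under the unital algebra homomorphism \<open>U(h\<^sub>C) \<rightarrow> \<complex>\<close> that extends \<open>\<lambda>\<close>.\<close>

definition is_eval ::
  "'g::lie_superalgebra set \<Rightarrow> ('g \<Rightarrow> complex) \<Rightarrow> ('g uea \<Rightarrow> complex) \<Rightarrow> bool" where
  "is_eval hC lam \<chi> \<longleftrightarrow>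
     \<chi> 1 = 1 \<and>
     (\<forall>a\<in>uea_cartan hC. \<forall>b\<in>uea_cartan hC. \<chi> (a + b) = \<chi> a + \<chi> b \<and> \<chi> (a * b) = \<chi> a * \<chi> b) \<and>
     (\<forall>c. \<forall>a\<in>uea_cartan hC. \<chi> (c *\<^sub>C a) = c * \<chi> a) \<and>
     (\<forall>H\<in>hC. \<chi> (uea_gen H) = lam H)"

definition eval_at ::
  "'g::lie_superalgebra set \<Rightarrow> ('g \<Rightarrow> complex) \<Rightarrow> 'g uea \<Rightarrow> complex" where
  "eval_at hC lam = (SOME \<chi>. is_eval hC lam \<chi>)"

section \<open>Representations\<close>

text \<open>\<open>\<rho>\<close> is a representation of \<open>g\<^sub>C\<close> on the superspace \<open>V 0 \<oplus> V 1\<close>, which is a whole type.\<close>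

definition representation ::
  "(bit \<Rightarrow> 'v::complex_vector set) \<Rightarrow> ('g::lie_superalgebra \<Rightarrow> 'v \<Rightarrow> 'v) \<Rightarrow> bool" where
  "representation V \<rho> \<longleftrightarrow>
     superspace V \<and> (\<forall>x. clinear (\<rho> x)) \<and> (\<forall>v. clinear (\<lambda>x. \<rho> x v)) \<and>
     (\<forall>p q. \<forall>x\<in>hpart p. \<forall>v\<in>V q. \<rho> x v \<in> V (p + q)) \<and>
     (\<forall>p q. \<forall>x\<in>hpart p. \<forall>y\<in>hpart q. \<forall>v.
        \<rho> (brk x y) v = \<rho> x (\<rho> y v) - koszul p q *\<^sub>C \<rho> y (\<rho> x v))"

definition irreducible_rep ::
  "(bit \<Rightarrow> 'v::complex_vector set) \<Rightarrow> ('g::lie_superalgebra \<Rightarrow> 'v \<Rightarrow> 'v) \<Rightarrow> bool" where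
  "irreducible_rep V \<rho> \<longleftrightarrow>
     (UNIV :: 'v set) \<noteq> {0} \<and>
     (\<forall>W. cvs.subspace W \<longrightarrow> is_graded V W \<longrightarrow> (\<forall>x. \<forall>w\<in>W. \<rho> x w \<in> W) \<longrightarrow> W = {0} \<or> W = UNIV)"

text \<open>The Verma module of highest weight \<open>\<lambda>\<close> is \<open>U(g\<^sub>C)\<close> modulo the following left ideal.\<close>

definition verma_ideal ::
  "'g::lie_superalgebra set \<Rightarrow> ('g \<Rightarrow> complex) set \<Rightarrow> ('g \<Rightarrow> complex) \<Rightarrow> 'g uea set" where
  "verma_ideal hC P lam = cvs.span
     ({a * uea_gen x | a x. \<exists>\<gamma>\<in>P. x \<in> root_space hC \<gamma>} \<union>
      {a * (uea_gen H - lam H *\<^sub>C 1) | a H. H \<in> hC})"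

text \<open>A surjective homomorphism from the Verma module onto \<open>V\<close> is given as a homomorphism \<open>\<Phi>\<close> on
  \<open>U(g\<^sub>C)\<close> that vanishes on the ideal; \<open>\<Phi> 1\<close> is the highest weight vector. Its parity \<open>d\<close> may be even
  or odd, so that \<open>\<pi>\<^sub>\<lambda>\<close> is meant up to isomorphism and parity change.\<close>

definition quotient_of_verma ::
  "'g::lie_superalgebra set \<Rightarrow> ('g \<Rightarrow> complex) set \<Rightarrow> ('g \<Rightarrow> complex) \<Rightarrow>
   (bit \<Rightarrow> 'v::complex_vector set) \<Rightarrow> ('g \<Rightarrow> 'v \<Rightarrow> 'v) \<Rightarrow> bool" where
  "quotient_of_verma hC P lam V \<rho> \<longleftrightarrow>
     (\<exists>\<Phi> :: 'g uea \<Rightarrow> 'v. \<exists>d.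
        clinear \<Phi> \<and> surj \<Phi> \<and> (\<forall>x a. \<Phi> (uea_gen x * a) = \<rho> x (\<Phi> a)) \<and>
        (\<forall>a\<in>verma_ideal hC P lam. \<Phi> a = 0) \<and> (\<forall>p. \<forall>a\<in>uea_part p. \<Phi> a \<in> V (p + d)))"

definition is_pi_lambda ::
  "'g::lie_superalgebra set \<Rightarrow> ('g \<Rightarrow> complex) set \<Rightarrow> ('g \<Rightarrow> complex) \<Rightarrow>
   (bit \<Rightarrow> 'v::complex_vector set) \<Rightarrow> ('g \<Rightarrow> 'v \<Rightarrow> 'v) \<Rightarrow> bool" where
  "is_pi_lambda hC P lam V \<rho> \<longleftrightarrow>
     representation V \<rho> \<and> irreducible_rep V \<rho> \<and> quotient_of_verma hC P lam V \<rho>"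

subsection \<open>Unitarity\<close>

definition hermitian_product :: "('v::complex_vector \<Rightarrow> 'v \<Rightarrow> complex) \<Rightarrow> bool" where
  "hermitian_product ip \<longleftrightarrow>
     (\<forall>u v w. ip (u + v) w = ip u w + ip v w) \<and> (\<forall>c u v. ip (c *\<^sub>C u) v = c * ip u v) \<and>
     (\<forall>u v. ip u v = cnj (ip v u)) \<and> (\<forall>v. v \<noteq> 0 \<longrightarrow> Re (ip v v) > 0)"

definition symmetric_op ::
  "('v::complex_vector \<Rightarrow> 'v \<Rightarrow> complex) \<Rightarrow> ('v \<Rightarrow> 'v) \<Rightarrow> bool" where
  "symmetric_op ip A \<longleftrightarrow> (\<forall>u v. ip (A u) v = ip u (A v))"

definition unitary_rep ::
  "'g::lie_superalgebra set \<Rightarrow> (bit \<Rightarrow> 'v::complex_vector set) \<Rightarrow> ('g \<Rightarrow> 'v \<Rightarrow> 'v) \<Rightarrow> bool" where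
  "unitary_rep g V \<rho> \<longleftrightarrow>
     (\<exists>ip. hermitian_product ip \<and> (\<forall>u\<in>V 0. \<forall>v\<in>V 1. ip u v = 0) \<and>
        (\<forall>z\<in>g \<inter> hpart 0. symmetric_op ip (\<lambda>v. \<i> *\<^sub>C \<rho> z v)) \<and>
        (\<forall>x\<in>g \<inter> hpart 1. symmetric_op ip (\<lambda>v. exp (- (\<i> * pi / 4)) *\<^sub>C \<rho> x v)))"

end

(* Write a^ for the conjugate-linear anti-automorphism of U(g_C) that a unitary representation turns
   into the Hilbert space adjoint; it is -x on even and -i x on odd elements x of g, and
   (-i)^|a| times the super adjoint of a is a^. Let v be a highest weight vector and N(u) the
   component of u v along v with respect to the weight decomposition; then beta(u)(lambda) = N(u).
   An invariant inner product satisfies <a v, a v> = N(a^ a) <v, v>, since distinct weight spaces are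
   orthogonal. Conversely, if N(a^ a) >= 0, then <a v, b v> = N(b^ a) is hermitian by polarisation,
   well defined, invariant and positive semidefinite, and its radical is a proper graded submodule,
   hence 0. The inequalities for the coroots come from
   0 <= <y v, y v> = - lambda([x, y]) <v, v> for an even positive root vector x and its conjugate y,
   because the sign of the invariant form on x decides whether [x, y] is a positive or a negative
   multiple of the coroot. *)

theory Submission
  imports Defs "HOL-Computational_Algebra.Fundamental_Theorem_Algebra"
begin

text \<open>\<open>beta\<close> and \<open>eval_at\<close> are picked by SOME and the super adjoint
  by THE, so each must first be shown to exist, and the adjoint to be unique. The adjoint comes from
  the universal property of the enveloping algebra. For \<open>beta\<close>, the weight-zero part
  U[0] has to lie in U(h) plus the left ideal generated by the positive root vectors, and this rests
  on a root decomposition of the whole superalgebra. A Cartan subalgebra is only defined as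
  nilpotent and self-normalising, so diagonalisability must be proved. It comes from compactness:
  for H in h, ad H is skew for an inner product on g, hence diagonalisable over the complex numbers
  with imaginary eigenvalues. The same reality makes conjugation exchange the root spaces of
  \<alpha> and -\<alpha>, which supplies the pairs x, y for the coroots. Whatever SOME picks, the
  value at lambda is pinned down by the module: u and beta(u) act alike on v for u in U[0], and U(h)
  acts on v through the evaluation.\<close>

declare add_bit_eq_xor [simp del]

lemma bit_add_self [simp]: "(p::bit) + p = 0" "p + (p + q) = q"
  by (cases p; cases q; simp)+

section \<open>Words, parity and the universal property of the enveloping superalgebra\<close>

lemma free_alg_induct [case_names single add]:
  assumes "\<And>k v. P (Poly_Mapping.single k v)" "\<And>f g. P f \<Longrightarrow> P g \<Longrightarrow> P (f + g)"
  shows "P (u :: 'a free_alg)"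
proof (induction u rule: update_induct)
  case const
  then show ?case using assms(1)[of 0 0] by simp
next
  case (update f a b)
  have "Poly_Mapping.update a b f = f + Poly_Mapping.single a b"
    using update by (intro poly_mapping_eqI)
      (auto simp: lookup_update lookup_add lookup_single when_def in_keys_iff)
  then show ?case using update assms by simp
qed

lemma free_const_commute: "free_const c * u = u * (free_const c :: 'a free_alg)"
proof (induction u rule: free_alg_induct)
  case (single k v)
  then show ?case by (simp add: free_const_def mult_single mult.commute)
next
  case (add f g)
  then show ?case by (simp add: distrib_left distrib_right)
qed

lemma uea_scale_mult_left: "(c *\<^sub>C a) * b = c *\<^sub>C (a * (b :: 'g::lie_superalgebra uea))"
  by transfer (simp add: uea_rel_def uea_ideal_zero mult.assoc)

lemma uea_scale_mult_right: "a * (c *\<^sub>C b) = c *\<^sub>C (a * (b :: 'g::lie_superalgebra uea))"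
  by transfer (metis diff_self free_const_commute mult.assoc uea_ideal_zero uea_rel_def)

lemma single_Word:
  "Poly_Mapping.single (Word xs) c = free_const c * prod_list (map free_gen xs)"
proof (induction xs)
  case Nil
  then show ?case by (simp add: free_const_def zero_word_def)
next
  case (Cons x xs)
  have "Poly_Mapping.single (Word (x # xs)) c = free_gen x * Poly_Mapping.single (Word xs) c"
    by (simp add: free_gen_def mult_single)
  also have "\<dots> = free_gen x * (free_const c * prod_list (map free_gen xs))"
    by (simp add: Cons)
  also have "\<dots> = free_const c * (free_gen x * prod_list (map free_gen xs))"
    by (metis mult.assoc free_const_commute)
  finally show ?case by simp
qed

lemma abs_uea_prod_list: "abs_uea (prod_list (map free_gen xs)) = prod_list (map uea_gen xs)"
  by (induction xs) (simp_all add: one_uea.abs_eq[symmetric] times_uea.abs_eq[symmetric] uea_gen.abs_eq)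

lemma uea_span_words: "(a :: 'g::lie_superalgebra uea) \<in> cvs.span {prod_list (map uea_gen xs) | xs. True}"
proof -
  obtain u where a: "a = abs_uea u" by (metis Quotient3_abs_rep Quotient3_uea)
  have "abs_uea u \<in> cvs.span {prod_list (map uea_gen xs) | xs. True}"
  proof (induction u rule: free_alg_induct)
    case (single k v)
    obtain xs where k: "k = Word xs" by (cases k)
    have "abs_uea (Poly_Mapping.single k v) = v *\<^sub>C prod_list (map uea_gen xs)"
      by (simp add: k single_Word abs_uea_prod_list[symmetric] scaleC_uea.abs_eq)
    then show ?case by (auto intro: cvs.span_scale cvs.span_base)
  next
    case (add f g)
    then show ?case by (auto simp: plus_uea.abs_eq[symmetric] intro: cvs.span_add)
  qed
  then show ?thesis by (simp add: a)
qed

lemma uea_gen_zero [simp]: "uea_gen 0 = 0"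
  using uea_gen_scale[of 0 0] by simp

lemma uea_gen_minus: "uea_gen (- x) = - uea_gen x"
  using uea_gen_scale[of "-1" x] by simp

lemma hpart_subspace: "cvs.subspace (hpart p)"
  using superspace_hpart by (auto simp: superspace_def)

definition hproj :: "bit \<Rightarrow> 'g::lie_superalgebra \<Rightarrow> 'g" where
  "hproj p x = (THE y. y \<in> hpart p \<and> x - y \<in> hpart (p + 1))"

lemma hpart_disjoint: "x \<in> hpart p \<Longrightarrow> x \<in> hpart (p + 1) \<Longrightarrow> x = 0"
  using hpart_inter by (cases p) auto

lemma hproj_eqI:
  assumes "y \<in> hpart p" "x - y \<in> hpart (p + 1)"
  shows "hproj p x = y"
  unfolding hproj_def
proof (rule the_equality)
  fix y' assume y': "y' \<in> hpart p \<and> x - y' \<in> hpart (p + 1)"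
  have "y' - y \<in> hpart p" "(x - y) - (x - y') \<in> hpart (p + 1)"
    using assms y' by (blast intro: cvs.subspace_diff[OF hpart_subspace])+
  then have "y' - y = 0" by (intro hpart_disjoint[of _ p]) (simp_all add: algebra_simps)
  then show "y' = y" by simp
qed (use assms in simp)

lemma hproj_props: "hproj p x \<in> hpart p \<and> x - hproj p x \<in> hpart (p + 1)"
proof -
  obtain y z where yz: "y \<in> hpart 0" "z \<in> hpart 1" "x = y + z" using hpart_decomp by blast
  show ?thesis
  proof (cases p)
    case zero
    then have "hproj p x = y" using yz by (intro hproj_eqI) simp_all
    then show ?thesis using yz zero by simp
  next
    case one
    then have "hproj p x = z" using yz by (intro hproj_eqI) simp_all
    then show ?thesis using yz one by simp
  qed
qed

lemmas hproj_in = hproj_props[THEN conjunct1]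

lemma hproj_add: "hproj p (x + y) = hproj p x + hproj p y"
proof (rule hproj_eqI)
  have "(x - hproj p x) + (y - hproj p y) \<in> hpart (p + 1)"
    using hproj_props by (blast intro: hpart_add)
  then show "x + y - (hproj p x + hproj p y) \<in> hpart (p + 1)" by (simp add: algebra_simps)
qed (simp add: hpart_add hproj_in)

lemma hproj_scale: "hproj p (c *\<^sub>C x) = c *\<^sub>C hproj p x"
proof (rule hproj_eqI)
  have "c *\<^sub>C (x - hproj p x) \<in> hpart (p + 1)"
    using hproj_props by (blast intro: hpart_scale)
  then show "c *\<^sub>C x - c *\<^sub>C hproj p x \<in> hpart (p + 1)" by (simp add: cvs.scale_right_diff_distrib)
qed (simp add: hpart_scale hproj_in)

lemma hproj_id: "x \<in> hpart p \<Longrightarrow> hproj p x = x"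
  by (rule hproj_eqI) (simp_all add: hpart_zero)

lemma hproj_other: "x \<in> hpart (p + 1) \<Longrightarrow> hproj p x = 0"
  by (rule hproj_eqI) (simp_all add: hpart_zero)

lemma hproj_sum: "x = hproj 0 x + hproj 1 x"
proof -
  have "hproj 1 x = x - hproj 0 x"
    using hproj_props[of 0 x] by (intro hproj_eqI) simp_all
  then show ?thesis by simp
qed

lemma uea_part_subspace: "cvs.subspace (uea_part p)"
  by (simp add: uea_part_def)

text \<open>Left multiplication is linear in the generator, so the induction step need only be
  checked on a spanning set \<open>S q\<close> of each \<open>hpart q\<close>. Later
  \<open>S\<close> is all of \<open>hpart\<close>, the real elements, or the weight vectors,
  whichever has the simplest formulas.\<close>

lemma uea_part_induct:
  assumes span: "\<And>q. hpart q \<subseteq> cvs.span (S q)"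
    and sub: "\<And>p. cvs.subspace (T p)"
    and one: "1 \<in> T 0"
    and step: "\<And>q p x a. x \<in> S q \<Longrightarrow> a \<in> T p \<Longrightarrow> uea_gen x * a \<in> T (q + p)"
  shows "uea_part p \<subseteq> (T p :: 'g::lie_superalgebra uea set)"
proof -
  have step': "uea_gen x * a \<in> T (q + p)" if "x \<in> hpart q" "a \<in> T p" for x q a p
  proof -
    have "x \<in> cvs.span (S q)" using span that by blast
    then show ?thesis
    proof (induction rule: cvs.span_induct_alt)
      case base
      then show ?case by (simp add: cvs.subspace_0[OF sub])
    next
      case (step c x y)
      then show ?case
        by (simp add: uea_gen_add uea_gen_scale distrib_right uea_scale_mult_left
            cvs.subspace_add[OF sub] cvs.subspace_scale[OF sub] assms(4) that)
    qed
  qed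
  have "prod_list (map uea_gen xs) \<in> T (sum_list ps)"
    if "list_all2 (\<lambda>x q. x \<in> hpart q) xs ps" for xs :: "'g list" and ps
    using that by (induction xs ps rule: list_all2_induct) (auto simp: one intro: step')
  then show ?thesis
    unfolding uea_part_def by (intro cvs.span_minimal sub) auto
qed

lemma uea_part_one: "1 \<in> uea_part 0"
proof -
  have "(1::'a uea) \<in> {prod_list (map uea_gen xs) | xs ps.
     list_all2 (\<lambda>x q. x \<in> hpart q) xs ps \<and> sum_list ps = (0::bit)}"
    by (intro CollectI exI[of _ "[]"]) simp
  then show ?thesis unfolding uea_part_def by (rule cvs.span_base)
qed

lemma uea_part_gen_mult:
  assumes "x \<in> hpart q" "a \<in> uea_part p"
  shows "uea_gen x * a \<in> uea_part (q + p)"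
  using assms(2) unfolding uea_part_def[of p]
proof (induction rule: cvs.span_induct_alt)
  case base
  then show ?case by (simp add: cvs.subspace_0[OF uea_part_subspace])
next
  case (step c a b)
  then obtain xs ps where a: "a = prod_list (map uea_gen xs)"
    "list_all2 (\<lambda>x q. x \<in> hpart q) xs ps" "sum_list ps = p" by blast
  have "uea_gen x * a \<in> uea_part (q + p)"
    unfolding uea_part_def using a assms(1)
    by (intro cvs.span_base CollectI exI[of _ "x # xs"] exI[of _ "q # ps"]) simp
  with step show ?case
    by (simp add: distrib_left uea_scale_mult_right cvs.subspace_add[OF uea_part_subspace]
        cvs.subspace_scale[OF uea_part_subspace])
qed

lemma uea_part_gen: "x \<in> hpart p \<Longrightarrow> uea_gen x \<in> uea_part p"
  using uea_part_gen_mult[OF _ uea_part_one] by fastforce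

lemma uea_part_mult:
  assumes "a \<in> uea_part p" "b \<in> uea_part q"
  shows "a * b \<in> uea_part (p + q)"
proof -
  have "uea_part p \<subseteq> {a. a * b \<in> uea_part (p + q)}"
  proof (rule uea_part_induct[where S = hpart])
    show "cvs.subspace {a. a * b \<in> uea_part (p + q)}" for p
      by (auto simp: cvs.subspace_def distrib_right uea_scale_mult_left
          cvs.subspace_0[OF uea_part_subspace] cvs.subspace_add[OF uea_part_subspace]
          cvs.subspace_scale[OF uea_part_subspace])
  qed (auto simp: assms mult.assoc add.assoc cvs.span_base intro: uea_part_gen_mult)
  then show ?thesis using assms by blast
qed

lemma uea_part_decomp: "\<exists>b\<in>uea_part 0. \<exists>c\<in>uea_part 1. (a :: 'g::lie_superalgebra uea) = b + c"
proof -
  let ?D = "{a. \<exists>b\<in>uea_part 0. \<exists>c\<in>uea_part 1. (a :: 'g uea) = b + c}"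
  have sub: "cvs.subspace ?D"
    using cvs.subspace_sums[OF uea_part_subspace uea_part_subspace, of 0 1]
    by (rule back_subst[of cvs.subspace]) blast
  have gen: "uea_gen x * a \<in> ?D" if a: "a \<in> ?D" for x :: 'g and a
  proof -
    obtain b c where bc: "b \<in> uea_part 0" "c \<in> uea_part 1" "a = b + c" using a by blast
    obtain y z where yz: "y \<in> hpart 0" "z \<in> hpart 1" "x = y + z" using hpart_decomp by blast
    have "uea_gen y * b + uea_gen z * c \<in> uea_part 0"
      using uea_part_gen_mult[OF yz(1) bc(1)] uea_part_gen_mult[OF yz(2) bc(2)]
      by (simp add: cvs.subspace_add[OF uea_part_subspace])
    moreover have "uea_gen y * c + uea_gen z * b \<in> uea_part 1"
      using uea_part_gen_mult[OF yz(1) bc(2)] uea_part_gen_mult[OF yz(2) bc(1)]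
      by (simp add: cvs.subspace_add[OF uea_part_subspace])
    moreover have "uea_gen x * a =
        (uea_gen y * b + uea_gen z * c) + (uea_gen y * c + uea_gen z * b)"
      by (simp add: bc yz uea_gen_add algebra_simps)
    ultimately show ?thesis by blast
  qed
  have "(1::'g uea) \<in> ?D"
    using uea_part_one cvs.subspace_0[OF uea_part_subspace] by force
  then have "prod_list (map uea_gen xs) \<in> ?D" for xs :: "'g list"
    by (induction xs) (use gen in auto)
  then have "cvs.span {prod_list (map uea_gen xs) | xs :: 'g list. True} \<subseteq> ?D"
    by (intro cvs.span_minimal sub) blast
  then show ?thesis using uea_span_words by blast
qed

lemma uea_induct_parts:
  assumes "\<And>p. uea_part p \<subseteq> T" "cvs.subspace T"
  shows "(a :: 'g::lie_superalgebra uea) \<in> T"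
  using uea_part_decomp[of a] assms cvs.subspace_add by blast

text \<open>\<open>\<kappa>\<close> and \<open>m\<close> cover at once the linear homomorphisms (identity and \<open>*\<close>) and the
  conjugate-linear anti-homomorphisms (\<open>cnj\<close> and flipped \<open>*\<close>).\<close>

locale uea_lift =
  fixes \<theta> :: "'g::lie_superalgebra \<Rightarrow> 'g uea"
    and \<kappa> :: "complex \<Rightarrow> complex"
    and m :: "'g uea \<Rightarrow> 'g uea \<Rightarrow> 'g uea"
  assumes \<kappa>_add: "\<kappa> (s + t) = \<kappa> s + \<kappa> t"
    and \<kappa>_mult: "\<kappa> (s * t) = \<kappa> s * \<kappa> t"
    and \<kappa>_one: "\<kappa> 1 = 1"
    and m_assoc: "m (m a b) c = m a (m b c)"
    and m_one: "m 1 a = a" "m a 1 = a"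
    and m_add: "m (a + b) c = m a c + m b c" "m a (b + c) = m a b + m a c"
    and m_scale: "m (s *\<^sub>C a) b = s *\<^sub>C m a b" "m a (s *\<^sub>C b) = s *\<^sub>C m a b"
    and \<theta>_add: "\<theta> (x + y) = \<theta> x + \<theta> y"
    and \<theta>_scale: "\<theta> (s *\<^sub>C x) = \<kappa> s *\<^sub>C \<theta> x"
    and \<theta>_brk: "x \<in> hpart p \<Longrightarrow> y \<in> hpart q \<Longrightarrow>
      \<theta> (brk x y) = m (\<theta> x) (\<theta> y) - \<kappa> (koszul p q) *\<^sub>C m (\<theta> y) (\<theta> x)"
begin

lemma \<kappa>_zero: "\<kappa> 0 = 0"
  using \<kappa>_add[of 0 0] by simp

text \<open>For the flipped product this fold multiplies the letters in reverse order, as an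
  anti-homomorphism must.\<close>

primrec wd :: "'g word \<Rightarrow> 'g uea" where
  "wd (Word xs) = foldr (\<lambda>x. m (\<theta> x)) xs 1"

lemma wd_add: "wd (k + l) = m (wd k) (wd l)"
proof -
  obtain xs ys where kl: "k = Word xs" "l = Word ys" by (metis word.exhaust)
  have "foldr (\<lambda>x. m (\<theta> x)) xs b = m (foldr (\<lambda>x. m (\<theta> x)) xs 1) b" for b
  proof (induction xs)
    case (Cons x xs)
    show ?case by (simp only: foldr_Cons o_apply Cons m_assoc)
  qed (simp add: m_one)
  from this[of "foldr (\<lambda>x. m (\<theta> x)) ys 1"] show ?thesis unfolding kl by simp
qed

definition free_ext :: "'g free_alg \<Rightarrow> 'g uea" where
  "free_ext u = (\<Sum>k\<in>Poly_Mapping.keys u. \<kappa> (Poly_Mapping.lookup u k) *\<^sub>C wd k)"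

text \<open>Coefficients can cancel in a sum, so additivity compares all three sums over one finite
  set; the extra terms vanish because \<open>\<kappa> 0 = 0\<close>.\<close>

lemma free_ext_superset:
  assumes "finite A" "Poly_Mapping.keys u \<subseteq> A"
  shows "free_ext u = (\<Sum>k\<in>A. \<kappa> (Poly_Mapping.lookup u k) *\<^sub>C wd k)"
  unfolding free_ext_def using assms
  by (intro sum.mono_neutral_left) (auto simp: in_keys_iff \<kappa>_zero)

lemma free_ext_add: "free_ext (u + v) = free_ext u + free_ext v"
proof -
  let ?A = "Poly_Mapping.keys u \<union> Poly_Mapping.keys v"
  have "free_ext w = (\<Sum>k\<in>?A. \<kappa> (Poly_Mapping.lookup w k) *\<^sub>C wd k)"
    if "w \<in> {u, v, u + v}" for w
    using that keys_add[of u v] by (intro free_ext_superset) auto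
  then show ?thesis
    by (simp add: lookup_add \<kappa>_add scaleC_add_left sum.distrib)
qed

lemma free_ext_single: "free_ext (Poly_Mapping.single k c) = \<kappa> c *\<^sub>C wd k"
  by (subst free_ext_superset[of "{k}"]) auto

lemma free_ext_mult: "free_ext (u * v) = m (free_ext u) (free_ext v)"
proof (induction u rule: free_alg_induct)
  case (single k c)
  show ?case
  proof (induction v rule: free_alg_induct)
    case (single l d)
    then show ?case
      by (simp add: mult_single free_ext_single \<kappa>_mult wd_add m_scale scaleC_scaleC mult.commute)
  next
    case (add f g)
    then show ?case by (simp add: distrib_left free_ext_add m_add)
  qed
next
  case (add f g)
  then show ?case by (simp add: distrib_right free_ext_add m_add)
qed

lemma free_ext_diff: "free_ext (u - v) = free_ext u - free_ext v"
  using free_ext_add[of "u - v" v] by (simp add: algebra_simps)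

lemma free_ext_const: "free_ext (free_const c) = \<kappa> c *\<^sub>C 1"
  by (simp add: free_const_def free_ext_single zero_word_def)

lemma free_ext_gen: "free_ext (free_gen x) = \<theta> x"
  by (simp add: free_gen_def free_ext_single \<kappa>_one m_one)

lemma m_zero: "m a 0 = 0" "m 0 a = 0"
  using m_add(1)[of 0 0 a] m_add(2)[of a 0 0] by simp_all

text \<open>The universal property: every defining relation goes to zero, the commutator relation by
  \<open>\<theta>_brk\<close>, and multiplicativity absorbs the outer factors. Hence
  \<open>free_ext\<close> descends to the quotient.\<close>

lemma free_ext_ideal: "u \<in> uea_ideal \<Longrightarrow> free_ext u = 0"
proof (induction rule: uea_ideal.induct)
  case (rel_add a x y b)
  then show ?case by (simp add: free_ext_mult free_ext_diff free_ext_gen \<theta>_add m_zero)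
next
  case (rel_scale a c x b)
  then show ?case
    by (simp add: free_ext_mult free_ext_diff free_ext_gen free_ext_const \<theta>_scale m_zero m_scale m_one)
next
  case (rel_brk x p y q a b)
  then show ?case
    by (simp add: free_ext_mult free_ext_diff free_ext_gen free_ext_const \<theta>_brk[OF rel_brk]
        m_zero m_scale m_one m_assoc)
next
  case (ideal_add u v)
  then show ?case by (simp add: free_ext_add)
qed

definition ext :: "'g uea \<Rightarrow> 'g uea" where
  "ext a = free_ext (rep_uea a)"

lemma ext_abs: "ext (abs_uea u) = free_ext u"
proof -
  have "uea_rel (rep_uea (abs_uea u)) u"
    by (metis Quotient3_uea Quotient3_rep_abs equivp_reflp equivp_uea_rel)
  then have "free_ext (rep_uea (abs_uea u) - u) = 0"
    unfolding uea_rel_def by (rule free_ext_ideal)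
  then show ?thesis by (simp add: ext_def free_ext_diff)
qed

lemma abs_uea_cases: obtains u where "a = abs_uea (u :: 'g free_alg)"
  by (metis Quotient3_abs_rep Quotient3_uea)

lemma ext_add: "ext (a + b) = ext a + ext b"
proof -
  obtain u v where "a = abs_uea u" "b = abs_uea v" by (metis abs_uea_cases)
  then show ?thesis by (simp add: plus_uea.abs_eq ext_abs free_ext_add)
qed

lemma ext_mult: "ext (a * b) = m (ext a) (ext b)"
proof -
  obtain u v where "a = abs_uea u" "b = abs_uea v" by (metis abs_uea_cases)
  then show ?thesis by (simp add: times_uea.abs_eq ext_abs free_ext_mult)
qed

lemma ext_scale: "ext (c *\<^sub>C a) = \<kappa> c *\<^sub>C ext a"
proof -
  obtain u where "a = abs_uea u" by (metis abs_uea_cases)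
  then show ?thesis
    by (simp add: scaleC_uea.abs_eq ext_abs free_ext_mult free_ext_const m_scale m_one)
qed

lemma ext_one: "ext 1 = 1"
  using free_ext_const[of 1]
  by (simp add: one_uea.abs_eq ext_abs free_const_def \<kappa>_one scaleC_one)

lemma ext_gen: "ext (uea_gen x) = \<theta> x"
  by (simp add: uea_gen.abs_eq ext_abs free_ext_gen)

end

section \<open>Conjugation with respect to the real form\<close>

lemma real_form_ri:
  assumes "real_form g"
  shows "\<exists>!yz. fst yz \<in> g \<and> snd yz \<in> g \<and> x = fst yz + \<i> *\<^sub>C snd yz"
proof -
  have g: "rvs.subspace g" "\<And>x. \<exists>y\<in>g. \<exists>z\<in>g. x = y + \<i> *\<^sub>C z" "\<And>y. y \<in> g \<Longrightarrow> \<i> *\<^sub>C y \<in> g \<Longrightarrow> y = 0"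
    using assms by (auto simp: real_form_def real_subalgebra_def)
  obtain y z where yz: "y \<in> g" "z \<in> g" "x = y + \<i> *\<^sub>C z" using g(2) by blast
  show ?thesis
  proof (rule ex1I[of _ "(y, z)"])
    fix w assume w: "fst w \<in> g \<and> snd w \<in> g \<and> x = fst w + \<i> *\<^sub>C snd w"
    then have "\<i> *\<^sub>C (snd w - z) = y - fst w"
      using yz by (simp add: cvs.scale_right_diff_distrib algebra_simps)
    moreover have "y - fst w \<in> g" "snd w - z \<in> g" using w yz g(1) by (auto intro: rvs.subspace_diff)
    ultimately have "snd w - z = 0" using g(3) by metis
    then show "w = (y, z)" using w yz by (auto simp: prod_eq_iff)
  qed (use yz in auto)
qed

locale real_form_algebra =
  fixes g :: "'g::lie_superalgebra set"
  assumes rform: "real_form g"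
begin

lemma g_subspace: "rvs.subspace g"
  using rform by (auto simp: real_form_def real_subalgebra_def)

lemma g_brk: "x \<in> g \<Longrightarrow> y \<in> g \<Longrightarrow> brk x y \<in> g"
  using rform by (auto simp: real_form_def real_subalgebra_def)

definition ri :: "'g \<Rightarrow> 'g \<times> 'g" where
  "ri x = (THE yz. fst yz \<in> g \<and> snd yz \<in> g \<and> x = fst yz + \<i> *\<^sub>C snd yz)"

definition rpart :: "'g \<Rightarrow> 'g" where "rpart x = fst (ri x)"
definition ipart :: "'g \<Rightarrow> 'g" where "ipart x = snd (ri x)"
definition cj :: "'g \<Rightarrow> 'g" where "cj x = rpart x - \<i> *\<^sub>C ipart x"

lemma ri_in: "rpart x \<in> g" "ipart x \<in> g" and ri_sum: "x = rpart x + \<i> *\<^sub>C ipart x"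
  using theI'[OF real_form_ri[OF rform], of x] by (auto simp: ri_def rpart_def ipart_def)

lemma ri_eqI:
  assumes "y \<in> g" "z \<in> g" "x = y + \<i> *\<^sub>C z"
  shows "rpart x = y" "ipart x = z"
proof -
  have "ri x = (y, z)"
    unfolding ri_def by (rule the1_equality[OF real_form_ri[OF rform]]) (use assms in auto)
  then show "rpart x = y" "ipart x = z" by (simp_all add: rpart_def ipart_def)
qed

lemma ri_add: "rpart (x + y) = rpart x + rpart y" "ipart (x + y) = ipart x + ipart y"
proof -
  have "x + y = (rpart x + rpart y) + \<i> *\<^sub>C (ipart x + ipart y)"
    using ri_sum[of x] ri_sum[of y] by (simp add: scaleC_add_right algebra_simps)
  from ri_eqI[OF _ _ this]
  show "rpart (x + y) = rpart x + rpart y" "ipart (x + y) = ipart x + ipart y"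
    using ri_in g_subspace by (simp_all add: rvs.subspace_add)
qed

lemma ri_scale:
  "rpart (c *\<^sub>C x) = scaleRC (Re c) (rpart x) - scaleRC (Im c) (ipart x)"
  "ipart (c *\<^sub>C x) = scaleRC (Im c) (rpart x) + scaleRC (Re c) (ipart x)"
proof -
  have "c *\<^sub>C x = c *\<^sub>C (rpart x + \<i> *\<^sub>C ipart x)" using ri_sum by metis
  also have "\<dots> = (complex_of_real (Re c) + \<i> * complex_of_real (Im c)) *\<^sub>C (rpart x + \<i> *\<^sub>C ipart x)"
    by (simp add: complex_eq[symmetric])
  also have "\<dots> = (scaleRC (Re c) (rpart x) - scaleRC (Im c) (ipart x)) +
      \<i> *\<^sub>C (scaleRC (Im c) (rpart x) + scaleRC (Re c) (ipart x))"
    by (simp add: scaleRC_def scaleC_add_right scaleC_add_left scaleC_scaleC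
        cvs.scale_minus_left algebra_simps)
  finally have *: "c *\<^sub>C x = (scaleRC (Re c) (rpart x) - scaleRC (Im c) (ipart x)) +
      \<i> *\<^sub>C (scaleRC (Im c) (rpart x) + scaleRC (Re c) (ipart x))" .
  have "scaleRC (Re c) (rpart x) - scaleRC (Im c) (ipart x) \<in> g"
    "scaleRC (Im c) (rpart x) + scaleRC (Re c) (ipart x) \<in> g"
    using ri_in g_subspace
    by (auto intro!: rvs.subspace_add rvs.subspace_diff rvs.subspace_scale)
  from ri_eqI[OF this *]
  show "rpart (c *\<^sub>C x) = scaleRC (Re c) (rpart x) - scaleRC (Im c) (ipart x)"
    "ipart (c *\<^sub>C x) = scaleRC (Im c) (rpart x) + scaleRC (Re c) (ipart x)" .
qed

lemma cj_add: "cj (x + y) = cj x + cj y"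
  by (simp add: cj_def ri_add scaleC_add_right)

lemma cj_scale: "cj (c *\<^sub>C x) = cnj c *\<^sub>C cj x"
proof -
  have "cnj c *\<^sub>C cj x = (complex_of_real (Re c) - \<i> * complex_of_real (Im c)) *\<^sub>C cj x"
    by (simp add: complex_eq_iff arg_cong[where f = "\<lambda>z. z *\<^sub>C cj x"])
  then show ?thesis
    by (simp add: cj_def ri_scale scaleRC_def scaleC_add_right cvs.scale_left_diff_distrib
        cvs.scale_right_diff_distrib scaleC_scaleC cvs.scale_minus_left algebra_simps)
qed

lemma cj_real: "x \<in> g \<Longrightarrow> cj x = x"
  using ri_eqI[of x 0 x] g_subspace by (simp add: cj_def rvs.subspace_0)

lemma cj_cj: "cj (cj x) = x"
proof -
  have "cj x = rpart x + \<i> *\<^sub>C (- ipart x)" by (simp add: cj_def)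
  from ri_eqI[OF _ _ this] have "rpart (cj x) = rpart x" "ipart (cj x) = - ipart x"
    using ri_in g_subspace by (simp_all add: rvs.subspace_neg)
  then show ?thesis using ri_sum[of x] by (simp add: cj_def[of "cj x"])
qed

text \<open>The real form is graded, so both parts split inside it. Comparing the parity-p component
  of x with x itself leaves only real and imaginary parts of parity p.\<close>

lemma ri_hpart:
  assumes "x \<in> hpart p"
  shows "rpart x \<in> hpart p" "ipart x \<in> hpart p"
proof -
  have gr: "\<exists>y\<in>g \<inter> hpart p. \<exists>z\<in>g \<inter> hpart (p + 1). x = y + z" if x: "x \<in> g" for x
  proof -
    obtain y z where yz: "y \<in> g \<inter> hpart 0" "z \<in> g \<inter> hpart 1" "x = y + z"
      using rform x by (auto simp: real_form_def is_graded_def)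
    show ?thesis
    proof (cases p)
      case zero
      with yz show ?thesis by (intro bexI[of _ y] bexI[of _ z]) simp_all
    next
      case one
      with yz show ?thesis by (intro bexI[of _ z] bexI[of _ y]) (simp_all add: add.commute)
    qed
  qed
  obtain a b c d where ab: "a \<in> g \<inter> hpart p" "b \<in> g \<inter> hpart (p + 1)" "rpart x = a + b"
    and cd: "c \<in> g \<inter> hpart p" "d \<in> g \<inter> hpart (p + 1)" "ipart x = c + d"
    using gr[OF ri_in(1)] gr[OF ri_in(2)] by metis
  have "x = (a + \<i> *\<^sub>C c) + (b + \<i> *\<^sub>C d)"
    using ri_sum[of x] ab cd by (simp add: scaleC_add_right algebra_simps)
  then have "hproj p x = a + \<i> *\<^sub>C c"
    using ab cd by (intro hproj_eqI) (auto intro: hpart_add hpart_scale)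
  then have "x = a + \<i> *\<^sub>C c" by (simp add: hproj_id assms)
  with ab cd show "rpart x \<in> hpart p" "ipart x \<in> hpart p"
    using ri_eqI[of a c x] by auto
qed

lemma cj_hpart: "x \<in> hpart p \<Longrightarrow> cj x \<in> hpart p"
  unfolding cj_def by (intro cvs.subspace_diff[OF hpart_subspace] hpart_scale ri_hpart)

lemma hpart_span_real: "hpart p \<subseteq> cvs.span (g \<inter> hpart p)"
proof
  fix x :: 'g
  assume x: "x \<in> hpart p"
  have "rpart x + \<i> *\<^sub>C ipart x \<in> cvs.span (g \<inter> hpart p)"
    using ri_hpart[OF x] ri_in by (intro cvs.span_add cvs.span_scale cvs.span_base) auto
  then show "x \<in> cvs.span (g \<inter> hpart p)" using ri_sum by metis
qed

lemma brk_diff: "brk (x - y) z = brk x z - brk y z" "brk x (y - z) = brk x y - brk x z"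
  using brk_add_left[of "x - y" y z] brk_add_right[of x "y - z" z] by simp_all

lemma ri_brk:
  "rpart (brk x y) = brk (rpart x) (rpart y) - brk (ipart x) (ipart y)"
  "ipart (brk x y) = brk (rpart x) (ipart y) + brk (ipart x) (rpart y)"
proof -
  have "brk x y = brk (rpart x + \<i> *\<^sub>C ipart x) (rpart y + \<i> *\<^sub>C ipart y)"
    using ri_sum by metis
  then have "brk x y = (brk (rpart x) (rpart y) - brk (ipart x) (ipart y)) +
      \<i> *\<^sub>C (brk (rpart x) (ipart y) + brk (ipart x) (rpart y))"
    by (simp add: brk_add_left brk_add_right
     brk_scale_left brk_scale_right scaleC_scaleC scaleC_add_right cvs.scale_minus_left)
  from ri_eqI[OF _ _ this]
  show "rpart (brk x y) = brk (rpart x) (rpart y) - brk (ipart x) (ipart y)"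
    "ipart (brk x y) = brk (rpart x) (ipart y) + brk (ipart x) (rpart y)"
    by (simp_all add: ri_in g_brk rvs.subspace_add[OF g_subspace] rvs.subspace_diff[OF g_subspace])
qed

lemma cj_brk: "cj (brk x y) = brk (cj x) (cj y)"
  by (simp add: cj_def ri_brk brk_diff brk_scale_left brk_scale_right scaleC_scaleC
      scaleC_add_right cvs.scale_minus_left cvs.scale_right_diff_distrib)

section \<open>The adjoint\<close>

text \<open>The signs \<open>-1\<close> on even and \<open>-i\<close> on odd elements make \<open>\<theta>\<close> the adjoint of a unitary
  representation, and they turn the rule of signs of the super adjoint into an ordinary
  anti-automorphism of the enveloping algebra.\<close>

definition \<theta> :: "'g \<Rightarrow> 'g" where
  "\<theta> x = - cj (hproj 0 x) - \<i> *\<^sub>C cj (hproj 1 x)"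

definition sg :: "bit \<Rightarrow> complex" where
  "sg p = (if p = 1 then - \<i> else - 1)"

lemma \<theta>_add: "\<theta> (x + y) = \<theta> x + \<theta> y"
  by (simp add: \<theta>_def hproj_add cj_add scaleC_add_right)

lemma \<theta>_scale: "\<theta> (c *\<^sub>C x) = cnj c *\<^sub>C \<theta> x"
  by (simp add: \<theta>_def hproj_scale cj_scale cvs.scale_right_diff_distrib scaleC_scaleC mult.commute)

lemma cj_zero: "cj 0 = 0"
  using cj_add[of 0 0] by simp

lemma \<theta>_hom: "x \<in> hpart p \<Longrightarrow> \<theta> x = sg p *\<^sub>C cj x"
  using hproj_other[of x 1] hproj_other[of x 0]
  by (cases p) (auto simp: \<theta>_def sg_def hproj_id cj_zero scaleC_one cvs.scale_minus_left)

lemma \<theta>_hpart: "x \<in> hpart p \<Longrightarrow> \<theta> x \<in> hpart p"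
  by (simp add: \<theta>_hom hpart_scale cj_hpart)

text \<open>Conjugation is an involution and the phases have modulus one: by conjugate-linearity
  applying the map twice gives the factor \<open>cnj (sg p) * sg p = 1\<close>.\<close>

lemma \<theta>_\<theta>: "\<theta> (\<theta> x) = x"
proof -
  have *: "\<theta> (\<theta> y) = y" if "y \<in> hpart p" for y p
  proof -
    have "\<theta> (\<theta> y) = (cnj (sg p) * sg p) *\<^sub>C y"
      unfolding \<theta>_hom[OF that] \<theta>_scale \<theta>_hom[OF cj_hpart[OF that]] cj_cj scaleC_scaleC ..
    then show ?thesis by (cases p) (simp_all add: sg_def scaleC_one)
  qed
  have "\<theta> (\<theta> (hproj 0 x + hproj 1 x)) = hproj 0 x + hproj 1 x"
    by (simp only: \<theta>_add *[OF hproj_in])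
  then show ?thesis by (simp add: hproj_sum[symmetric])
qed

text \<open>The phases satisfy \<open>- (sg q * sg p * koszul p q) = sg (p + q)\<close>; for two odd
  elements this reads (-i)^2 = -1. So the sign from exchanging x and y is absorbed, and brackets are
  reversed without any further sign.\<close>

lemma \<theta>_brk:
  assumes "x \<in> hpart p" "y \<in> hpart q"
  shows "uea_gen (\<theta> (brk x y)) =
    uea_gen (\<theta> y) * uea_gen (\<theta> x) - cnj (koszul p q) *\<^sub>C (uea_gen (\<theta> x) * uea_gen (\<theta> y))"
proof -
  have "uea_gen (\<theta> y) * uea_gen (\<theta> x) - cnj (koszul p q) *\<^sub>C (uea_gen (\<theta> x) * uea_gen (\<theta> y)) =
     uea_gen (brk (\<theta> y) (\<theta> x))"
    by (subst uea_gen_brk[of _ q _ p]) (auto simp: assms \<theta>_hpart koszul_def)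
  also have "brk (\<theta> y) (\<theta> x) = (sg q * sg p) *\<^sub>C cj (brk y x)"
    unfolding \<theta>_hom[OF assms(1)] \<theta>_hom[OF assms(2)] cj_brk
    by (simp add: brk_scale_left brk_scale_right scaleC_scaleC mult.commute)
  also have "cj (brk y x) = - koszul p q *\<^sub>C cj (brk x y)"
    by (subst brk_skew[OF assms(2,1)])
      (auto simp: koszul_def cj_scale cvs.scale_minus_left[symmetric] simp del: cvs.scale_minus_left)
  also have "(sg q * sg p) *\<^sub>C - koszul p q *\<^sub>C cj (brk x y) = sg (p + q) *\<^sub>C cj (brk x y)"
    by (cases p; cases q) (auto simp: sg_def koszul_def scaleC_scaleC)
  also have "\<dots> = \<theta> (brk x y)"
    by (simp add: \<theta>_hom[OF brk_hpart[OF assms]])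
  finally show ?thesis by simp
qed

sublocale dag: uea_lift "\<lambda>x. uea_gen (\<theta> x)" cnj "\<lambda>a b. b * a"
  by unfold_locales
   (auto simp: algebra_simps uea_scale_mult_left uea_scale_mult_right \<theta>_add \<theta>_scale uea_gen_add
     uea_gen_scale \<theta>_brk)

abbreviation D :: "'g uea \<Rightarrow> 'g uea" where "D \<equiv> dag.ext"

end

section \<open>The grading automorphism and the super adjoint\<close>

text \<open>Its extension to the enveloping algebra acts by 1 on even and by -1 on odd elements. It
  allows a parity-dependent scalar to be written as one linear formula on the whole algebra.\<close>

definition parity_map :: "'g::lie_superalgebra \<Rightarrow> 'g" where
  "parity_map x = hproj 0 x - hproj 1 x"

lemma parity_map_hom: "x \<in> hpart p \<Longrightarrow> parity_map x = (if p = 1 then - x else x)"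
  using hproj_other[of x 1] hproj_other[of x 0]
  by (cases p) (auto simp: parity_map_def hproj_id)

lemma parity_map_brk:
  assumes "x \<in> hpart p" "y \<in> hpart q"
  shows "uea_gen (parity_map (brk x y)) =
    uea_gen (parity_map x) * uea_gen (parity_map y) -
    koszul p q *\<^sub>C (uea_gen (parity_map y) * uea_gen (parity_map x))"
proof -
  define e where "e = (\<lambda>p::bit. if p = 1 then - 1 else 1 :: complex)"
  have hom: "parity_map z = e r *\<^sub>C z" if "z \<in> hpart r" for z :: 'a and r
    using parity_map_hom[OF that] by (auto simp: e_def scaleC_one)
  have e: "e (p + q) = e p * e q"
    by (cases p; cases q) (simp_all add: e_def)
  show ?thesis
    unfolding hom[OF brk_hpart[OF assms]] hom[OF assms(1)] hom[OF assms(2)] e uea_gen_scale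
      uea_gen_brk[OF assms]
    by (simp add: uea_scale_mult_left uea_scale_mult_right cvs.scale_right_diff_distrib
        scaleC_scaleC mult_ac)
qed

interpretation par: uea_lift "\<lambda>x. uea_gen (parity_map x)" "\<lambda>c. c" "(*)"
proof
  show "uea_gen (parity_map (x + y)) = uea_gen (parity_map x) + uea_gen (parity_map y)" for x y :: 'a
  proof -
    have "parity_map (x + y) = parity_map x + parity_map y"
      by (simp add: parity_map_def hproj_add)
    then show ?thesis by (simp add: uea_gen_add)
  qed
  show "uea_gen (parity_map (s *\<^sub>C x)) = s *\<^sub>C uea_gen (parity_map x)" for s and x :: 'a
    by (simp add: parity_map_def hproj_scale uea_gen_scale[symmetric] cvs.scale_right_diff_distrib)
qed (simp_all add: uea_scale_mult_left uea_scale_mult_right parity_map_brk distrib_left distrib_right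
    mult.assoc)

lemma par_part:
  assumes "a \<in> uea_part p"
  shows "par.ext a = (if p = 1 then - a else a)"
proof -
  let ?s = "\<lambda>p::bit. if p = 1 then - 1 else (1::complex)"
  have "uea_part p \<subseteq> {a. par.ext a = ?s p *\<^sub>C a}"
  proof (rule uea_part_induct[where S = hpart])
    show "cvs.subspace {a. par.ext a = ?s p *\<^sub>C a}" for p
      using par.ext_scale[of 0 0]
      by (auto simp: cvs.subspace_def par.ext_add par.ext_scale scaleC_add_right scaleC_scaleC mult.commute)
    show "uea_gen x * a \<in> {a. par.ext a = ?s (q + p) *\<^sub>C a}"
      if "x \<in> hpart q" "a \<in> {a. par.ext a = ?s p *\<^sub>C a}" for q p x a
      using that by (cases p; cases q)
       (auto simp: par.ext_mult par.ext_gen parity_map_hom uea_gen_minus scaleC_one)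
  qed (auto simp: par.ext_one scaleC_one cvs.span_base)
  then show ?thesis using assms by (auto simp: scaleC_one)
qed

context real_form_algebra
begin

lemma D_part:
  assumes "a \<in> uea_part p"
  shows "D a \<in> uea_part p"
proof -
  have "uea_part p \<subseteq> {a. D a \<in> uea_part p}"
  proof (rule uea_part_induct[where S = hpart])
    show "cvs.subspace {a. D a \<in> uea_part p}" for p
      using dag.ext_scale[of 0 0]
      by (auto simp: cvs.subspace_def dag.ext_add dag.ext_scale cvs.subspace_0[OF uea_part_subspace]
          cvs.subspace_add[OF uea_part_subspace] cvs.subspace_scale[OF uea_part_subspace])
    show "uea_gen x * a \<in> {a. D a \<in> uea_part (q + p)}"
      if "x \<in> hpart q" "a \<in> {a. D a \<in> uea_part p}" for q p x a
      using uea_part_mult[of "D a" p "uea_gen (\<theta> x)" q] that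
      by (auto simp: dag.ext_mult dag.ext_gen \<theta>_hpart uea_part_gen add.commute)
  qed (auto simp: dag.ext_one uea_part_one cvs.span_base)
  then show ?thesis using assms by auto
qed

text \<open>The combination of \<open>a\<close> and its image under the parity automorphism is \<open>a\<close> for even and
  \<open>-i a\<close> for odd \<open>a\<close>; the factor \<open>c(p)\<close> with \<open>c(0) = 1\<close>, \<open>c(1) = i\<close> satisfies
  \<open>c(p + q) = (-1)\<^sup>p\<^sup>q c(p) c(q)\<close>.\<close>

definition star :: "'g uea \<Rightarrow> 'g uea" where
  "star a = D (((1 - \<i>) / 2) *\<^sub>C a + ((1 + \<i>) / 2) *\<^sub>C par.ext a)"

text \<open>\<open>D\<close> is conjugate-linear, so the inner factor \<open>- \<i>\<close> on odd
  elements comes out as \<open>\<i>\<close>.\<close>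

lemma star_part:
  assumes "a \<in> uea_part p"
  shows "star a = (if p = 1 then \<i> else 1) *\<^sub>C D a"
proof -
  have "((1 - \<i>) / 2) *\<^sub>C a + ((1 + \<i>) / 2) *\<^sub>C par.ext a = (if p = 1 then - \<i> else 1) *\<^sub>C a"
  proof (cases "p = 1")
    case True
    then show ?thesis using par_part[OF assms]
      by (simp add: cvs.scale_left_diff_distrib[symmetric] diff_divide_distrib[symmetric]
        del: cvs.scale_minus_left)
  next
    case False
    then show ?thesis using par_part[OF assms]
      by (simp add: scaleC_add_left[symmetric] add_divide_distrib[symmetric])
  qed
  then show ?thesis by (simp add: star_def dag.ext_scale)
qed

lemma is_uea_adjoint_star: "is_uea_adjoint g star"
  unfolding is_uea_adjoint_def
proof (intro conjI allI ballI)
  show "star (a + b) = star a + star b" for a b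
    by (simp add: star_def par.ext_add dag.ext_add scaleC_add_right)
  show "star (c *\<^sub>C a) = cnj c *\<^sub>C star a" for c a
    by (simp add: star_def par.ext_scale dag.ext_add dag.ext_scale scaleC_add_right scaleC_scaleC mult.commute)
  show "star 1 = 1"
    by (simp add: star_part[OF uea_part_one] dag.ext_one scaleC_one)
  show "star (a * b) = koszul p q *\<^sub>C (star b * star a)" if "a \<in> uea_part p" "b \<in> uea_part q" for p q a b
    using that by (cases p; cases q)
     (auto simp: star_part[OF uea_part_mult[OF that]] star_part koszul_def dag.ext_mult
      uea_scale_mult_left uea_scale_mult_right scaleC_scaleC scaleC_one)
  show "star (uea_gen x) = - (koszul p p *\<^sub>C uea_gen x)" if "x \<in> g \<inter> hpart p" for p x
    using that by (cases p) (auto simp: star_part[OF uea_part_gen] dag.ext_gen \<theta>_hom sg_def cj_real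
     uea_gen_scale uea_gen_minus koszul_def scaleC_scaleC scaleC_one)
qed

text \<open>Real homogeneous elements span each parity, and the rules fix the value on every product
  of them. The set used in the induction also records membership in \<open>uea_part p\<close>,
  because the product rule speaks only about homogeneous factors.\<close>

lemma uea_adjoint_eq: "uea_adjoint g = star"
  unfolding uea_adjoint_def
proof (rule the_equality)
  show "is_uea_adjoint g star" by (rule is_uea_adjoint_star)
next
  fix s assume s: "is_uea_adjoint g s"
  have s': "s (a + b) = s a + s b" "s (c *\<^sub>C a) = cnj c *\<^sub>C s a" "s 1 = 1"
    "a \<in> uea_part p \<Longrightarrow> b \<in> uea_part q \<Longrightarrow> s (a * b) = koszul p q *\<^sub>C (s b * s a)"
    "x \<in> g \<Longrightarrow> x \<in> hpart p \<Longrightarrow> s (uea_gen x) = - (koszul p p *\<^sub>C uea_gen x)" for a b c p q x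
    using s by (auto simp: is_uea_adjoint_def)
  have t': "star (a + b) = star a + star b" "star (c *\<^sub>C a) = cnj c *\<^sub>C star a" "star 1 = 1"
    "a \<in> uea_part p \<Longrightarrow> b \<in> uea_part q \<Longrightarrow> star (a * b) = koszul p q *\<^sub>C (star b * star a)"
    "x \<in> g \<Longrightarrow> x \<in> hpart p \<Longrightarrow> star (uea_gen x) = - (koszul p p *\<^sub>C uea_gen x)" for a b c p q x
    using is_uea_adjoint_star by (auto simp: is_uea_adjoint_def)
  have z: "s 0 = star 0" using s'(2)[of 0 0] t'(2)[of 0 0] by simp
  have "uea_part p \<subseteq> {a \<in> uea_part p. s a = star a}" for p
  proof (rule uea_part_induct[where S = "\<lambda>p. g \<inter> hpart p"])
    show "cvs.subspace {a \<in> uea_part p. s a = star a}" for p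
      using z by (auto simp: cvs.subspace_def s' t' cvs.subspace_0[OF uea_part_subspace]
          cvs.subspace_add[OF uea_part_subspace] cvs.subspace_scale[OF uea_part_subspace])
  qed (auto simp: hpart_span_real[THEN subsetD] s' t' uea_part_one s'(4)[OF uea_part_gen]
      t'(4)[OF uea_part_gen] intro: uea_part_gen_mult)
  then have "a \<in> {a. s a = star a}" for a
    using z by (intro uea_induct_parts) (auto simp: cvs.subspace_def s' t')
  then show "s = star" by auto
qed

end

section \<open>Root decomposition\<close>

lemma clinear_simps:
  assumes "clinear f"
  shows "f (x + y) = f x + f y" "f (c *\<^sub>C x) = c *\<^sub>C f x" "f 0 = 0" "f (x - y) = f x - f y"
    "f (- x) = - f x"
proof -
  interpret Vector_Spaces.linear scaleC scaleC f by (rule assms)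
  show "f (x + y) = f x + f y" "f (c *\<^sub>C x) = c *\<^sub>C f x" "f 0 = 0" "f (x - y) = f x - f y"
    "f (- x) = - f x"
    by (simp_all add: add scale zero diff neg)
qed

lemma clinearI:
  assumes "\<And>x y. f (x + y) = f x + f y" "\<And>c x. f (c *\<^sub>C x) = c *\<^sub>C f x"
  shows "clinear f"
  by unfold_locales (auto simp: assms)

section \<open>Diagonalisation of skew operators\<close>

text \<open>The vector p(D) x in Horner form. The recursion on \<open>pCons\<close> passes from x to
  D x, so the inductions below keep x arbitrary.\<close>

definition poly_op :: "complex poly \<Rightarrow> ('v \<Rightarrow> 'v) \<Rightarrow> 'v \<Rightarrow> 'v::complex_vector" where
  "poly_op p D = fold_coeffs (\<lambda>a f x. a *\<^sub>C x + f (D x)) p (\<lambda>_. 0)"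

lemma poly_op_0 [simp]: "poly_op 0 D x = 0"
  by (simp add: poly_op_def)

lemma poly_op_pCons [simp]: "poly_op (pCons a p) D x = a *\<^sub>C x + poly_op p D (D x)"
proof (cases "p = 0")
  case True
  then show ?thesis
    by (cases "a = 0") (simp_all add: poly_op_def fold_coeffs_pCons_coeff_not_0_eq)
next
  case False
  then show ?thesis by (simp add: poly_op_def fold_coeffs_pCons_not_0_0_eq)
qed

lemma poly_op_add: "poly_op (p + q) D x = poly_op p D x + poly_op q D x"
  by (induction p q arbitrary: x rule: poly_induct2) (simp_all add: scaleC_add_left algebra_simps)

lemma poly_op_smult: "poly_op (smult c p) D x = c *\<^sub>C poly_op p D x"
  by (induction p arbitrary: x) (simp_all add: scaleC_add_right scaleC_scaleC)

lemma poly_op_diff: "poly_op (p - q) D x = poly_op p D x - poly_op q D x"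
  using poly_op_add[of "p - q" q D x] by simp

lemma poly_op_add_arg:
  assumes "clinear D"
  shows "poly_op p D (x + y) = poly_op p D x + poly_op p D y"
  by (induction p arbitrary: x y)
    (simp_all add: clinear_simps[OF assms] scaleC_add_right algebra_simps)

lemma poly_op_scale_arg:
  assumes "clinear D"
  shows "poly_op p D (c *\<^sub>C x) = c *\<^sub>C poly_op p D x"
  by (induction p arbitrary: x)
    (simp_all add: clinear_simps[OF assms] scaleC_add_right scaleC_scaleC mult.commute)

lemma poly_op_linear_factor:
  assumes "clinear D"
  shows "poly_op ([:- c, 1:] * q) D x = poly_op q D (D x - c *\<^sub>C x)"
  using poly_op_add_arg[OF assms, of q "D x" "(- c) *\<^sub>C x"] poly_op_scale_arg[OF assms, of q "- c" x]
  by (simp add: poly_op_diff poly_op_smult)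

lemma poly_op_monom: "poly_op (monom 1 n) D x = (D ^^ n) x"
  by (induction n arbitrary: x) (simp_all add: monom_0 monom_Suc scaleC_one funpow_swap1)

text \<open>If no iterate of x lay in the span of its predecessors, there would be independent sets
  of every size, against finite dimension.\<close>

lemma poly_op_annihilator:
  fixes x :: "'v::complex_vector"
  assumes "finite_dim TYPE('v)"
  shows "\<exists>p. p \<noteq> 0 \<and> poly_op p D x = 0"
proof -
  obtain B :: "'v set" where B: "finite B" "cvs.span B = UNIV"
    using assms by (auto simp: finite_dim_def)
  let ?f = "\<lambda>i. (D ^^ i) x"
  have "\<exists>n. ?f n \<in> cvs.span (?f ` {..<n})"
  proof (rule ccontr)
    assume "\<not> ?thesis"
    then have n: "?f n \<notin> cvs.span (?f ` {..<n})" for n by blast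
    have "cvs.independent (?f ` {..<n}) \<and> card (?f ` {..<n}) = n" for n
    proof (induction n)
      case (Suc m)
      have "?f m \<notin> ?f ` {..<m}" using n[of m] by (metis cvs.span_base)
      then show ?case
        using Suc n[of m] by (simp add: lessThan_Suc cvs.independent_insertI)
    qed (simp add: cvs.independent_empty)
    from this[of "Suc (card B)"] show False
      using cvs.independent_span_bound[of B "?f ` {..<Suc (card B)}"] B by simp
  qed
  then obtain n where n: "?f n \<in> cvs.span (?f ` {..<n})" by blast
  have "\<exists>p. (\<forall>i\<ge>n. coeff p i = 0) \<and> y = poly_op p D x" if "y \<in> cvs.span (?f ` {..<n})" for y
    using that
  proof (induction rule: cvs.span_induct_alt)
    case base
    show ?case by (rule exI[of _ 0]) simp
  next
    case (step c u y)
    then obtain i p where "i < n" "u = ?f i" "\<forall>i\<ge>n. coeff p i = 0" "y = poly_op p D x" by blast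
    then show ?case
      by (intro exI[of _ "smult c (monom 1 i) + p"])
        (simp add: poly_op_add poly_op_smult poly_op_monom)
  qed
  with n obtain p where p: "coeff p n = 0" "?f n = poly_op p D x" by blast
  \<comment> \<open>The relation involves only iterates below the n-th, so X^n - p has coefficient
    one in degree n and is not the zero polynomial.\<close>
  have "coeff (monom 1 n + smult (- 1) p) n \<noteq> 0" using p by simp
  then have "monom 1 n + smult (- 1) p \<noteq> 0" by (metis coeff_0)
  moreover have "poly_op (monom 1 n + smult (- 1) p) D x = 0"
    unfolding poly_op_add poly_op_smult poly_op_monom p(2) by (simp add: scaleC_one)
  ultimately show ?thesis by blast
qed

text \<open>\<open>R\<close> stands for the real part of a hermitian inner product: a real inner
  product for which multiplication by \<open>\<i>\<close> is skew. Working with the real part avoids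
  a complex form on the superalgebra.\<close>

locale skew_operator =
  fixes D :: "'v::complex_vector \<Rightarrow> 'v" and R :: "'v \<Rightarrow> 'v \<Rightarrow> real"
  assumes D_linear: "clinear D"
    and R_sym: "R x y = R y x"
    and R_add: "R (x + y) z = R x z + R y z"
    and R_scale: "R (scaleRC r x) y = r * R x y"
    and R_pos: "x \<noteq> 0 \<Longrightarrow> R x x > 0"
    and R_i: "R (\<i> *\<^sub>C x) y = - R x (\<i> *\<^sub>C y)"
    and R_skew: "R (D x) y = - R x (D y)"
begin

lemma R_diff: "R (x - y) z = R x z - R y z"
  using R_add[of "x - y" y z] by simp

lemma R_complex: "R (c *\<^sub>C x) y = Re c * R x y + Im c * R (\<i> *\<^sub>C x) y"
proof -
  have "c *\<^sub>C x = scaleRC (Re c) x + scaleRC (Im c) (\<i> *\<^sub>C x)"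
    by (simp add: scaleRC_def scaleC_scaleC scaleC_add_left[symmetric] mult.commute complex_eq[symmetric])
  then show ?thesis by (simp add: R_add R_scale)
qed

text \<open>Multiplication by \<open>\<i>\<close> and \<open>D\<close> are both skew, so
  \<open>R (\<i> *\<^sub>C e) e\<close> and \<open>R (D e) e\<close> vanish; expanding the second
  leaves Re c times the squared length of e.\<close>

lemma eigenvalue_imaginary:
  assumes "D e = c *\<^sub>C e" "e \<noteq> 0"
  shows "Re c = 0"
proof -
  have "R (\<i> *\<^sub>C e) e = 0" using R_i[of e e] R_sym[of e "\<i> *\<^sub>C e"] by simp
  moreover have "R (D e) e = 0" using R_skew[of e e] R_sym[of e "D e"] by simp
  ultimately show ?thesis using R_pos[OF assms(2)] R_complex[of c e e] by (simp add: assms(1))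
qed

text \<open>There are no Jordan blocks: if e is in the image and in the kernel of D - c, then moving
  D - c across \<open>R\<close> makes the squared length of e vanish. This uses that c is imaginary
  when e is nonzero.\<close>

lemma semisimple:
  assumes e: "e = D y - c *\<^sub>C y" and De: "D e = c *\<^sub>C e"
  shows "e = 0"
proof (rule ccontr)
  assume "e \<noteq> 0"
  then have pos: "R e e > 0" and c: "Re c = 0"
    using R_pos eigenvalue_imaginary[OF De] by auto
  have "R e e = R (D y) e - R (c *\<^sub>C y) e" by (metis e R_diff)
  also have "R (D y) e = - R (c *\<^sub>C e) y" by (simp add: R_skew De R_sym[of y])
  also have "\<dots> = R (c *\<^sub>C y) e"
    using R_i[of e y] by (simp add: R_complex[of c] c R_sym[of e])
  finally show False using pos by simp
qed

lemma nilpotent_zero: "(D ^^ n) y = 0 \<Longrightarrow> D y = 0"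
proof (induction n arbitrary: y)
  case 0
  then show ?case by (simp add: clinear_simps[OF D_linear])
next
  case (Suc n)
  from Suc.prems have "(D ^^ n) (D y) = 0" by (simp add: funpow_swap1)
  then have "D (D y) = 0" by (rule Suc.IH)
  then show ?case using semisimple[of "D y" y 0] by simp
qed

text \<open>On the span of eigenvectors D - c is onto up to c-eigenvectors: an eigenvector for d
  different from c is divided by d - c, and one for c is put into the remainder e.\<close>

lemma eigenvectors_shift:
  assumes "cvs.subspace W" "y \<in> cvs.span {u \<in> W. \<exists>d. D u = d *\<^sub>C u}"
  shows "\<exists>z\<in>cvs.span {u \<in> W. \<exists>d. D u = d *\<^sub>C u}. \<exists>e. D e = c *\<^sub>C e \<and> D z - c *\<^sub>C z + e = y"
  using assms(2)
proof (induction rule: cvs.span_induct_alt)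
  case base
  show ?case
    by (rule bexI[of _ 0], rule exI[of _ 0]) (simp_all add: clinear_simps[OF D_linear] cvs.span_zero)
next
  case (step a u y)
  then obtain z e where ze: "z \<in> cvs.span {u \<in> W. \<exists>d. D u = d *\<^sub>C u}" "D e = c *\<^sub>C e"
    "D z - c *\<^sub>C z + e = y" by blast
  obtain d where d: "u \<in> W" "D u = d *\<^sub>C u" using step by blast
  show ?case
  proof (cases "d = c")
    case True
    then show ?thesis using ze d
      by (intro bexI[of _ z] exI[of _ "a *\<^sub>C u + e"])
       (auto simp: clinear_simps[OF D_linear] scaleC_add_right scaleC_scaleC mult.commute)
  next
    case False
    have u: "u \<in> cvs.span {u \<in> W. \<exists>d. D u = d *\<^sub>C u}" using d by (blast intro: cvs.span_base)
    have "(a / (d - c) * d) *\<^sub>C u - (c * (a / (d - c))) *\<^sub>C u = a *\<^sub>C u"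
      unfolding cvs.scale_left_diff_distrib[symmetric] using False
    proof -
      have "a / (d - c) * d - c * (a / (d - c)) = a / (d - c) * (d - c)"
        by (simp only: left_diff_distrib mult.commute)
      then have "a / (d - c) * d - c * (a / (d - c)) = a" using False by simp
      then show "(a / (d - c) * d - c * (a / (d - c))) *\<^sub>C u = a *\<^sub>C u" by (rule arg_cong)
    qed
    then have "D ((a / (d - c)) *\<^sub>C u + z) - c *\<^sub>C ((a / (d - c)) *\<^sub>C u + z) + e = a *\<^sub>C u + y"
      using ze(3) d by (simp add: clinear_simps[OF D_linear] scaleC_add_right scaleC_scaleC algebra_simps)
    then show ?thesis using ze u
      by (intro bexI[of _ "(a / (d - c)) *\<^sub>C u + z"] exI[of _ e] conjI cvs.span_add cvs.span_scale) auto
  qed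
qed

text \<open>Induction on the degree of a polynomial that annihilates x. A root c is split off, the
  induction hypothesis applies to (D - c) x, and a preimage z in the span leaves (D - c)(x - z) = e
  with e in the kernel of D - c. By semisimplicity e = 0, so x - z is itself an eigenvector.\<close>

lemma span_eigenvectors:
  assumes "finite_dim TYPE('v)" "cvs.subspace W" "\<And>y. y \<in> W \<Longrightarrow> D y \<in> W" "x \<in> W"
  shows "x \<in> cvs.span {u \<in> W. \<exists>d. D u = d *\<^sub>C u}"
proof -
  have "x \<in> cvs.span {u \<in> W. \<exists>d. D u = d *\<^sub>C u}"
    if "p \<noteq> 0" "poly_op p D x = 0" "x \<in> W" for p x
    using that
  proof (induction "degree p" arbitrary: p x)
    case 0
    then obtain a where "p = [:a:]" by (metis degree_eq_zeroE)
    then have "x = 0" using 0 by simp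
    then show ?case by (simp add: cvs.span_zero)
  next
    case (Suc n)
    then have "\<not> constant (poly p)" by (simp add: constant_degree)
    then obtain c where "poly p c = 0" using fundamental_theorem_of_algebra by blast
    then obtain q where q: "p = [:- c, 1:] * q" by (metis dvdE poly_eq_0_iff_dvd)
    have "q \<noteq> 0" "degree q = n" using Suc.hyps(2) Suc.prems(1) unfolding q
      by (auto simp: degree_mult_eq simp del: mult_pCons_left)
    moreover have "D x - c *\<^sub>C x \<in> W"
      using Suc.prems assms by (blast intro: cvs.subspace_diff cvs.subspace_scale)
    ultimately have "D x - c *\<^sub>C x \<in> cvs.span {u \<in> W. \<exists>d. D u = d *\<^sub>C u}"
      using Suc.prems by (intro Suc.hyps(1)) (auto simp: q poly_op_linear_factor[OF D_linear] simp del: mult_pCons_left)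
    from eigenvectors_shift[OF assms(2) this, of c] obtain z e where
      ze: "z \<in> cvs.span {u \<in> W. \<exists>d. D u = d *\<^sub>C u}" "D e = c *\<^sub>C e"
      "D z - c *\<^sub>C z + e = D x - c *\<^sub>C x" by blast
    have e: "e = D (x - z) - c *\<^sub>C (x - z)"
      using ze(3) by (simp add: clinear_simps[OF D_linear] cvs.scale_right_diff_distrib algebra_simps)
    then have "e = 0" using ze(2) by (rule semisimple)
    have "cvs.span {u \<in> W. \<exists>d. D u = d *\<^sub>C u} \<subseteq> W"
      by (intro cvs.span_minimal assms(2)) auto
    then have "z \<in> W" using ze(1) by auto
    then have "x - z \<in> {u \<in> W. \<exists>d. D u = d *\<^sub>C u}"
      using e \<open>e = 0\<close> Suc.prems assms(2) by (auto intro: cvs.subspace_diff)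
    then have "z + (x - z) \<in> cvs.span {u \<in> W. \<exists>d. D u = d *\<^sub>C u}"
      by (intro cvs.span_add[OF ze(1) cvs.span_base])
    then show ?case by simp
  qed
  then show ?thesis using poly_op_annihilator[OF assms(1), of D x] assms(4) by blast
qed

end

section \<open>The weight decomposition under the torus\<close>

lemma brk_clinear: "clinear (brk x)"
  by (rule clinearI) (simp_all add: brk_add_right brk_scale_right)

lemmas brk_right = clinear_simps[OF brk_clinear]

lemma brk_clinear_left: "clinear (\<lambda>x. brk x y)"
  by (rule clinearI) (simp_all add: brk_add_left brk_scale_left)

lemmas brk_left = clinear_simps[OF brk_clinear_left]

lemma brk_even_skew:
  assumes "y \<in> hpart 0"
  shows "brk x y = - brk y x"
proof -
  have *: "brk z y = - brk y z" if "z \<in> hpart p" for z p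
    using brk_skew[OF that assms] by (simp add: koszul_def scaleC_one)
  have "brk (hproj 0 x + hproj 1 x) y = - brk y (hproj 0 x + hproj 1 x)"
    by (simp add: brk_add_left brk_add_right *[OF hproj_in])
  then show ?thesis by (simp flip: hproj_sum)
qed

lemma brk_even_jacobi:
  assumes "x \<in> hpart 0" "y \<in> hpart p"
  shows "brk x (brk y z) = brk (brk x y) z + brk y (brk x z)"
  using brk_jacobi[OF assms] by (simp add: koszul_def scaleC_one)

text \<open>\<open>skew\<close> retains the inner product that comes with a compact subalgebra
  containing h; the diagonalisability of ad h is derived from it.\<close>

locale torus = real_form_algebra g for g :: "'g::lie_superalgebra set" +
  fixes h :: "'g set"
  assumes fin: "finite_dim TYPE('g)"
    and h_subspace: "rvs.subspace h"
    and h_real: "h \<subseteq> g \<inter> hpart 0"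
    and cartan: "cartan_subalgebra (cvs.span h)"
    and skew: "\<exists>Q. symm_bilinear_on g Q \<and> (\<forall>x\<in>g. x \<noteq> 0 \<longrightarrow> Q x x > 0) \<and>
      (\<forall>z\<in>h. \<forall>x\<in>g. \<forall>y\<in>g. Q (brk z x) y = - Q x (brk z y))"
begin

abbreviation hC :: "'g set" where "hC \<equiv> cvs.span h"

lemma hC_even: "hC \<subseteq> hpart 0"
  using h_real by (intro cvs.span_minimal hpart_subspace) auto

text \<open>\<open>R\<close> is the real part of the hermitian extension of Q to the
  complexification. Since H is real, ad H acts separately on real and imaginary parts, so skewness
  carries over; one \<open>R\<close> serves all H.\<close>

lemma brk_skew_operator:
  obtains R where "\<And>H. H \<in> h \<Longrightarrow> skew_operator (brk H) R"
proof -
  obtain Q where "symm_bilinear_on g Q \<and> (\<forall>x\<in>g. x \<noteq> 0 \<longrightarrow> Q x x > 0) \<and>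
      (\<forall>z\<in>h. \<forall>x\<in>g. \<forall>y\<in>g. Q (brk z x) y = - Q x (brk z y))"
    using skew by (elim exE)
  then have Q: "symm_bilinear_on g Q" "\<And>x. x \<in> g \<Longrightarrow> x \<noteq> 0 \<Longrightarrow> Q x x > 0"
    "\<And>z x y. z \<in> h \<Longrightarrow> x \<in> g \<Longrightarrow> y \<in> g \<Longrightarrow> Q (brk z x) y = - Q x (brk z y)"
    by simp_all
  have sym: "Q x y = Q y x" if "x \<in> g" "y \<in> g" for x y
    using Q(1) that by (auto simp: symm_bilinear_on_def)
  have add: "Q (x + y) z = Q x z + Q y z" if "x \<in> g" "y \<in> g" "z \<in> g" for x y z
    using Q(1) that by (auto simp: symm_bilinear_on_def)
  have scale: "Q (scaleRC r x) y = r * Q x y" if "x \<in> g" "y \<in> g" for r x y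
    using Q(1) that by (auto simp: symm_bilinear_on_def)
  have neg: "Q (- x) y = - Q x y" if "x \<in> g" "y \<in> g" for x y
    using scale[OF that, of "- 1"] by (simp add: scaleRC_def scaleC_one)
  have neg': "Q y (- x) = - Q y x" if "x \<in> g" "y \<in> g" for x y
    using neg[OF that] sym that rvs.subspace_neg[OF g_subspace] by metis
  have zero: "Q 0 0 = 0"
    using scale[of 0 0 0] g_subspace by (simp add: rvs.subspace_0)
  define R where "R x y = Q (rpart x) (rpart y) + Q (ipart x) (ipart y)" for x y
  have "skew_operator (brk H) R" if H: "H \<in> h" for H
  proof
    have r: "rpart (brk H x) = brk H (rpart x)" "ipart (brk H x) = brk H (ipart x)" for x
    proof -
      have "brk H x = brk H (rpart x) + \<i> *\<^sub>C brk H (ipart x)"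
        by (metis ri_sum brk_add_right brk_scale_right)
      from ri_eqI[OF _ _ this]
      show "rpart (brk H x) = brk H (rpart x)" "ipart (brk H x) = brk H (ipart x)"
        using H h_real by (auto intro: g_brk ri_in)
    qed
    have i: "rpart (\<i> *\<^sub>C x) = - ipart x" "ipart (\<i> *\<^sub>C x) = rpart x" for x
      by (simp_all add: ri_scale scaleRC_def scaleC_one)
    have s: "rpart (scaleRC t x) = scaleRC t (rpart x)" "ipart (scaleRC t x) = scaleRC t (ipart x)"
      for t x by (simp_all add: scaleRC_def ri_scale)
    show "R x y = R y x" for x y by (simp add: R_def sym ri_in)
    show "R (x + y) z = R x z + R y z" for x y z by (simp add: R_def ri_add add ri_in)
    show "R (scaleRC t x) y = t * R x y" for t x y
      by (simp add: R_def s scale ri_in algebra_simps)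
    show "0 < R x x" if "x \<noteq> 0" for x
    proof -
      have nn: "Q y y \<ge> 0" if "y \<in> g" for y using Q(2)[OF that] zero by (cases "y = 0") auto
      have "rpart x \<noteq> 0 \<or> ipart x \<noteq> 0" using that ri_sum[of x] by auto
      then show ?thesis
        using Q(2)[OF ri_in(1), of x] Q(2)[OF ri_in(2), of x] nn[OF ri_in(1), of x] nn[OF ri_in(2), of x]
        by (auto simp: R_def)
    qed
    show "R (\<i> *\<^sub>C x) y = - R x (\<i> *\<^sub>C y)" for x y
      by (simp add: R_def i neg neg' ri_in)
    show "R (brk H x) y = - R x (brk H y)" for x y
      by (simp add: R_def r Q(3) H ri_in)
  qed (simp_all add: brk_add_right brk_scale_right)
  then show ?thesis using that by blast
qed

text \<open>Nilpotency of the Cartan subalgebra makes ad x nilpotent on it for x in h, and a skew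
  operator kills every vector that one of its powers kills.\<close>

lemma hC_abelian: "x \<in> hC \<Longrightarrow> y \<in> hC \<Longrightarrow> brk x y = 0"
proof -
  have *: "brk x y = 0" if x: "x \<in> h" and y: "y \<in> hC" for x y
  proof -
    obtain R where R: "skew_operator (brk x) R" using brk_skew_operator x by metis
    have "(brk x ^^ n) y \<in> lower_central hC n" for n
    proof (induction n)
      case (Suc n)
      have "x \<in> hC" using x by (rule cvs.span_base)
      with Suc show ?case by (auto intro!: cvs.span_base)
    qed (simp add: y)
    moreover obtain n where "lower_central hC n = {0}"
      using cartan by (auto simp: cartan_subalgebra_def)
    ultimately have "(brk x ^^ n) y = 0" by blast
    then show ?thesis by (rule skew_operator.nilpotent_zero[OF R])
  qed
  assume "x \<in> hC" "y \<in> hC"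
  then show "brk x y = 0"
    by (induction x rule: cvs.span_induct_alt) (simp_all add: brk_left *)
qed

text \<open>A vector that commutes with the Cartan subalgebra normalises it, and a Cartan subalgebra
  is its own normaliser.\<close>

lemma zero_weight:
  assumes "\<And>H. H \<in> hC \<Longrightarrow> brk H x = 0"
  shows "x \<in> hC"
proof -
  have "brk x y \<in> hC" if "y \<in> hC" for y
    using assms[OF that] brk_even_skew[of y x] that hC_even by (auto simp: cvs.span_zero)
  moreover have "{x. \<forall>y\<in>hC. brk x y \<in> hC} = hC" using cartan by (simp add: cartan_subalgebra_def)
  ultimately show ?thesis by blast
qed

text \<open>Elements of h commute, so ad of the new H preserves each joint eigenspace W of the
  earlier ones and can be diagonalised inside W.\<close>

lemma span_joint_eigenvectors:
  assumes "finite B" "B \<subseteq> h"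
  shows "hpart q \<subseteq> cvs.span {x \<in> hpart q. \<forall>H\<in>B. \<exists>c. brk H x = c *\<^sub>C x}"
  using assms
proof (induction B)
  case empty
  then show ?case by (simp add: cvs.span_superset)
next
  case (insert H B)
  let ?S = "\<lambda>B. {x \<in> hpart q. \<forall>H\<in>B. \<exists>c. brk H x = c *\<^sub>C x}"
  have "x \<in> cvs.span (?S (insert H B))" if x: "x \<in> ?S B" for x
  proof -
    from x have "\<forall>H'\<in>B. \<exists>c. brk H' x = c *\<^sub>C x" by simp
    then obtain c where c: "\<And>H'. H' \<in> B \<Longrightarrow> brk H' x = c H' *\<^sub>C x" by metis
    define W where "W = {y \<in> hpart q. \<forall>H'\<in>B. brk H' y = c H' *\<^sub>C y}"
    have W: "cvs.subspace W"
      by (auto simp: W_def cvs.subspace_def hpart_zero hpart_add hpart_scale brk_right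
          scaleC_add_right scaleC_scaleC mult.commute)
    have inv: "brk H y \<in> W" if y: "y \<in> W" for y
    proof -
      have H: "H \<in> hpart 0" using insert h_real by auto
      have "brk H' (brk H y) = brk H (brk H' y)" if "H' \<in> B" for H'
      proof -
        have H': "H' \<in> h" "H' \<in> hpart 0" using that insert h_real by auto
        have "brk H' H = 0" using H' insert by (auto intro: hC_abelian cvs.span_base)
        then show ?thesis using brk_even_jacobi[OF H'(2) H, of y] by (simp add: brk_left)
      qed
      then show ?thesis
        using y brk_hpart[OF H, of y q] by (auto simp: W_def brk_right)
    qed
    obtain R where "skew_operator (brk H) R" using brk_skew_operator insert by (metis insert_subset)
    then interpret skew_operator "brk H" R .
    have "x \<in> cvs.span {u \<in> W. \<exists>d. brk H u = d *\<^sub>C u}"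
      using x c by (intro span_eigenvectors fin W inv) (auto simp: W_def)
    also have "\<dots> \<subseteq> cvs.span (?S (insert H B))"
      by (intro cvs.span_mono) (auto simp: W_def)
    finally show ?thesis .
  qed
  then have "cvs.span (?S B) \<subseteq> cvs.span (?S (insert H B))"
    by (intro cvs.span_minimal cvs.subspace_span) blast
  with insert show ?case by auto
qed

text \<open>The weight may be zero, so vectors of the Cartan subalgebra are included, and so is the
  zero vector for every weight in the dual.\<close>

definition wvec :: "bit \<Rightarrow> ('g \<Rightarrow> complex) \<Rightarrow> 'g set" where
  "wvec q \<alpha> = {x \<in> hpart q. \<alpha> \<in> dual_of hC \<and> x \<in> root_space hC \<alpha>}"

lemma hpart_span_wvec: "hpart q \<subseteq> cvs.span (\<Union>\<alpha>. wvec q \<alpha>)"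
proof -
  obtain C where C: "C \<subseteq> h" "cvs.independent C" "h \<subseteq> cvs.span C"
    using cvs.maximal_independent_subset by blast
  obtain B :: "'g set" where B: "finite B" "cvs.span B = UNIV"
    using fin by (auto simp: finite_dim_def)
  have "finite C" using cvs.independent_span_bound[of B C] B C by simp
  have hC: "hC = cvs.span C"
    using C by (metis cvs.span_minimal cvs.span_mono cvs.subspace_span subset_antisym)
  have "x \<in> (\<Union>\<alpha>. wvec q \<alpha>)" if x: "x \<in> hpart q" "\<forall>H\<in>C. \<exists>c. brk H x = c *\<^sub>C x" for x
  proof (cases "x = 0")
    case True
    then show ?thesis
      by (auto simp: wvec_def hpart_zero dual_of_def root_space_def brk_right intro!: exI[of _ "\<lambda>_. 0"])
  next
    case False
    have ex: "\<exists>c. brk H x = c *\<^sub>C x" if "H \<in> hC" for H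
      using that unfolding hC
    proof (induction rule: cvs.span_induct_alt)
      case base
      show ?case by (rule exI[of _ 0]) (simp add: brk_left)
    next
      case (step c u y)
      then obtain a b where "brk u x = a *\<^sub>C x" "brk y x = b *\<^sub>C x" using x by blast
      then show ?case
        by (intro exI[of _ "c * a + b"]) (simp add: brk_left scaleC_add_left scaleC_scaleC)
    qed
    \<comment> \<open>As x is nonzero, its eigenvalue under H is unique, and this makes the chosen
      values linear in H. The value 0 off \<open>hC\<close> is the convention of
      \<open>dual_of\<close>.\<close>
    define \<alpha> where "\<alpha> H = (if H \<in> hC then SOME c. brk H x = c *\<^sub>C x else 0)" for H
    have \<alpha>: "brk H x = \<alpha> H *\<^sub>C x" if "H \<in> hC" for H
      using someI_ex[OF ex[OF that]] that by (simp add: \<alpha>_def)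
    have "\<alpha> \<in> dual_of hC"
      unfolding dual_of_def
    proof (intro CollectI conjI ballI allI impI)
      fix H K assume "H \<in> hC" "K \<in> hC"
      then have "\<alpha> (H + K) *\<^sub>C x = (\<alpha> H + \<alpha> K) *\<^sub>C x"
        by (simp add: \<alpha>[symmetric] cvs.span_add brk_left scaleC_add_left)
      then show "\<alpha> (H + K) = \<alpha> H + \<alpha> K" using False by simp
    next
      fix c H assume "H \<in> hC"
      then have "\<alpha> (c *\<^sub>C H) *\<^sub>C x = (c * \<alpha> H) *\<^sub>C x"
        by (simp add: \<alpha>[symmetric] cvs.span_scale brk_left scaleC_scaleC[symmetric])
      then show "\<alpha> (c *\<^sub>C H) = c * \<alpha> H" using False by simp
    qed (simp add: \<alpha>_def)
    then have "x \<in> wvec q \<alpha>" using x \<alpha> by (simp add: wvec_def root_space_def)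
    then show ?thesis by blast
  qed
  then have "cvs.span {x \<in> hpart q. \<forall>H\<in>C. \<exists>c. brk H x = c *\<^sub>C x} \<subseteq> cvs.span (\<Union>\<alpha>. wvec q \<alpha>)"
    by (intro cvs.span_mono) blast
  then show ?thesis using span_joint_eigenvectors[OF \<open>finite C\<close> C(1)] by blast
qed

end

section \<open>Triangular decomposition and the projection \<open>\<beta>\<close>\<close>

lemma koszul_add: "koszul q (r + p) = koszul q r * koszul q p"
  by (cases q; cases r; cases p) (simp_all add: koszul_def)

text \<open>Composing the operators \<open>(A\<^sub>i - \<mu>(i)) / (\<nu>(i) - \<mu>(i))\<close> gives an operator that fixes the
  \<open>\<nu>\<close>-eigenspace and kills any given sum of vectors from other eigenspaces.\<close>

lemma joint_eigenspaces_independent: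
  fixes A :: "'i \<Rightarrow> 'v::complex_vector \<Rightarrow> 'v"
  assumes lin: "\<And>i. clinear (A i)"
    and E: "\<And>\<mu>. E \<mu> = {v. \<forall>i\<in>S. A i v = \<mu> i *\<^sub>C v}"
    and M: "\<And>\<mu>. \<mu> \<in> M \<Longrightarrow> \<exists>i\<in>S. \<mu> i \<noteq> \<nu> i"
    and w: "w \<in> cvs.span (\<Union>\<mu>\<in>M. E \<mu>)" "w \<in> E \<nu>"
  shows "w = 0"
proof -
  \<comment> \<open>That L acts by a scalar on every eigenspace is carried along so that the next
    factor still kills its vector x: L x is a multiple of x, and A(i) - \<mu>(i) annihilates
    it.\<close>
  have "\<exists>L. clinear L \<and> L w = 0 \<and> (\<forall>v\<in>E \<nu>. L v = v) \<and> (\<forall>\<mu>. \<exists>s. \<forall>v\<in>E \<mu>. L v = s *\<^sub>C v)"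
    using w(1)
  proof (induction rule: cvs.span_induct_alt)
    case base
    show ?case
      by (rule exI[of _ "\<lambda>v. v"]) (auto intro!: clinearI exI[of _ 1] simp: scaleC_one)
  next
    case (step c x y)
    then obtain L where L: "clinear L" "L y = 0" "\<And>v. v \<in> E \<nu> \<Longrightarrow> L v = v"
      "\<And>\<mu>. \<exists>s. \<forall>v\<in>E \<mu>. L v = s *\<^sub>C v" by blast
    obtain \<mu> where \<mu>: "\<mu> \<in> M" "x \<in> E \<mu>" using step by blast
    obtain i where i: "i \<in> S" "\<mu> i \<noteq> \<nu> i" using M[OF \<mu>(1)] by blast
    define L' where "L' v = (1 / (\<nu> i - \<mu> i)) *\<^sub>C (A i (L v) - \<mu> i *\<^sub>C L v)" for v
    have 1: "clinear L'"
      unfolding L'_def by (rule clinearI)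
       (simp_all add: clinear_simps[OF L(1)] clinear_simps[OF lin] scaleC_add_right scaleC_scaleC
         cvs.scale_right_diff_distrib algebra_simps)
    have 2: "L' v = v" if "v \<in> E \<nu>" for v
    proof -
      have "A i v - \<mu> i *\<^sub>C v = (\<nu> i - \<mu> i) *\<^sub>C v"
        using that i by (simp add: E cvs.scale_left_diff_distrib)
      then show ?thesis using i that by (simp add: L'_def L(3) scaleC_scaleC scaleC_one)
    qed
    have 3: "\<exists>s. \<forall>v\<in>E \<mu>'. L' v = s *\<^sub>C v" for \<mu>'
    proof -
      obtain s where s: "\<And>v. v \<in> E \<mu>' \<Longrightarrow> L v = s *\<^sub>C v" using L(4) by blast
      have "L' v = ((1 / (\<nu> i - \<mu> i)) * (s * \<mu>' i - \<mu> i * s)) *\<^sub>C v" if "v \<in> E \<mu>'" for v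
        using that i(1) by (simp add: L'_def s clinear_simps[OF lin] E scaleC_scaleC
            cvs.scale_left_diff_distrib cvs.scale_right_diff_distrib right_diff_distrib)
      then show ?thesis by blast
    qed
    have "L' x = 0"
    proof -
      obtain s where s: "L x = s *\<^sub>C x" using L(4) \<mu> by blast
      have "A i x = \<mu> i *\<^sub>C x" using \<mu> i by (simp add: E)
      then show ?thesis by (simp add: L'_def s clinear_simps[OF lin] scaleC_scaleC mult.commute)
    qed
    moreover have "L' y = 0" by (simp add: L'_def L(2) clinear_simps[OF lin])
    ultimately have "L' (c *\<^sub>C x + y) = 0" by (simp add: clinear_simps[OF 1])
    with 1 2 3 show ?case by blast
  qed
  with w(2) show ?thesis by fastforce
qed

lemma uea_weight_subspace: "cvs.subspace (uea_weight hC \<mu>)"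
  by (auto simp: cvs.subspace_def uea_weight_def algebra_simps uea_scale_mult_left
      uea_scale_mult_right scaleC_add_right scaleC_scaleC simp flip: cvs.scale_right_diff_distrib)

lemma dual_zero: "(\<lambda>_. 0) \<in> dual_of S"
  by (simp add: dual_of_def)

lemma dual_add: "\<alpha> \<in> dual_of S \<Longrightarrow> \<beta> \<in> dual_of S \<Longrightarrow> (\<lambda>H. \<alpha> H + \<beta> H) \<in> dual_of S"
  by (auto simp: dual_of_def algebra_simps)

lemma dual_nonzero:
  assumes "\<mu> \<in> dual_of S" "\<mu> \<noteq> (\<lambda>_. 0)"
  shows "\<exists>H\<in>S. \<mu> H \<noteq> 0"
  using assms by (auto simp: dual_of_def fun_eq_iff)

lemma nplus_left:
  assumes "c \<in> uea_nplus hC P"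
  shows "a * c \<in> uea_nplus hC P"
  using assms unfolding uea_nplus_def
proof (induction rule: cvs.span_induct_alt)
  case (step r x y)
  then obtain b z where bz: "x = b * uea_gen z" "\<exists>\<gamma>\<in>P. z \<in> root_space hC \<gamma>" by blast
  then have "a * x \<in> {a * uea_gen x | a x. \<exists>\<gamma>\<in>P. x \<in> root_space hC \<gamma>}"
    by (intro CollectI exI[of _ "a * b"] exI[of _ z]) (simp add: mult.assoc)
  from cvs.span_base[OF this] step.IH show ?case
    by (simp add: distrib_left uea_scale_mult_right cvs.span_add cvs.span_scale)
qed (simp add: cvs.span_zero)

lemma cartan_gen_mult:
  assumes "H \<in> hC" "b \<in> uea_cartan hC"
  shows "uea_gen H * b \<in> uea_cartan hC"
  using assms(2) unfolding uea_cartan_def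
proof (induction rule: cvs.span_induct_alt)
  case (step r x y)
  then obtain xs where xs: "x = prod_list (map uea_gen xs)" "set xs \<subseteq> hC" by blast
  then have "uea_gen H * x \<in> {prod_list (map uea_gen xs) | xs. set xs \<subseteq> hC}"
    using assms(1) by (intro CollectI exI[of _ "H # xs"]) simp
  from cvs.span_base[OF this] step.IH show ?case
    by (simp add: distrib_left uea_scale_mult_right cvs.span_add cvs.span_scale)
qed (simp add: cvs.span_zero)

lemma cartan_one: "1 \<in> uea_cartan hC"
  unfolding uea_cartan_def by (rule cvs.span_base) (auto intro!: exI[of _ "[]"])

context torus
begin

lemma uea_gen_swap:
  assumes "x \<in> hpart q" "y \<in> hpart r"
  shows "uea_gen x * uea_gen y = uea_gen (brk x y) + koszul q r *\<^sub>C (uea_gen y * uea_gen x)"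
  using uea_gen_brk[OF assms] by simp

lemma wvec_brk:
  assumes "x \<in> wvec q \<alpha>" "y \<in> wvec r \<beta>"
  shows "brk x y \<in> wvec (q + r) (\<lambda>H. \<alpha> H + \<beta> H)"
proof -
  have xy: "x \<in> hpart q" "y \<in> hpart r" "\<alpha> \<in> dual_of hC" "\<beta> \<in> dual_of hC"
    "\<And>H. H \<in> hC \<Longrightarrow> brk H x = \<alpha> H *\<^sub>C x" "\<And>H. H \<in> hC \<Longrightarrow> brk H y = \<beta> H *\<^sub>C y"
    using assms by (auto simp: wvec_def root_space_def)
  have "brk H (brk x y) = (\<alpha> H + \<beta> H) *\<^sub>C brk x y" if "H \<in> hC" for H
    using brk_even_jacobi[of H x q y] hC_even that xy(1)
    by (simp add: subset_iff xy(5,6) brk_left brk_right scaleC_add_left)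
  then show ?thesis
    using xy by (simp add: wvec_def brk_hpart dual_add root_space_def)
qed

text \<open>\<open>mon n p \<mu> a\<close>: \<open>a\<close> is a product of \<open>n\<close> homogeneous weight vectors, of total parity \<open>p\<close> and
  total weight \<open>\<mu>\<close>.\<close>

inductive mon :: "nat \<Rightarrow> bit \<Rightarrow> ('g \<Rightarrow> complex) \<Rightarrow> 'g uea \<Rightarrow> bool" where
  mon_one: "mon 0 0 (\<lambda>_. 0) 1"
| mon_step: "x \<in> wvec q \<alpha> \<Longrightarrow> mon n p \<mu> a \<Longrightarrow>
    mon (Suc n) (q + p) (\<lambda>H. \<alpha> H + \<mu> H) (uea_gen x * a)"

lemma mon_weight: "mon n p \<mu> a \<Longrightarrow> \<mu> \<in> dual_of hC \<and> a \<in> uea_weight hC \<mu> \<and> a \<in> uea_part p"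
proof (induction rule: mon.induct)
  case mon_one
  then show ?case by (simp add: dual_zero uea_weight_def uea_part_one)
next
  case (mon_step x q \<alpha> n p \<mu> a)
  have x: "x \<in> hpart q" "\<alpha> \<in> dual_of hC" "\<And>H. H \<in> hC \<Longrightarrow> brk H x = \<alpha> H *\<^sub>C x"
    using mon_step by (auto simp: wvec_def root_space_def)
  have "uea_gen H * (uea_gen x * a) - uea_gen x * a * uea_gen H = (\<alpha> H + \<mu> H) *\<^sub>C (uea_gen x * a)"
    if H: "H \<in> hC" for H
  proof -
    have 1: "uea_gen H * uea_gen x = uea_gen (brk H x) + uea_gen x * uea_gen H"
      using uea_gen_swap[of H 0 x q] H hC_even x by (auto simp: koszul_def scaleC_one)
    have 2: "uea_gen H * a = \<mu> H *\<^sub>C a + a * uea_gen H"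
      using mon_step.IH H by (auto simp: uea_weight_def diff_eq_eq)
    have "uea_gen H * (uea_gen x * a) = uea_gen (brk H x) * a + uea_gen x * (uea_gen H * a)"
      by (simp only: mult.assoc[symmetric] 1 distrib_right)
    then show ?thesis
      unfolding 2 by (simp add: x(3) H uea_gen_scale uea_scale_mult_left uea_scale_mult_right
          distrib_left scaleC_add_left mult.assoc)
  qed
  then show ?case using mon_step x by (simp add: dual_add uea_weight_def uea_part_gen_mult)
qed

lemma mon_span_step:
  assumes "x \<in> wvec q \<alpha>" "a \<in> cvs.span {a. mon n p \<mu> a}"
  shows "uea_gen x * a \<in> cvs.span {a. mon (Suc n) (q + p) (\<lambda>H. \<alpha> H + \<mu> H) a}"
  using assms(2)
proof (induction rule: cvs.span_induct_alt)
  case (step c a b)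
  then show ?case using mon_step[OF assms(1)]
    by (auto simp: distrib_left uea_scale_mult_right intro!: cvs.span_add cvs.span_scale intro: cvs.span_base)
qed (simp add: cvs.span_zero)

text \<open>Passing x over a letter y costs the bracket of x and y, again a weight vector, which
  takes the place of y. The correction therefore has n letters, one fewer than the product, while
  its weight and parity are those of the product.\<close>

lemma mon_move:
  assumes "mon n p \<mu> a" "x \<in> wvec q \<alpha>"
  shows "uea_gen x * a - koszul q p *\<^sub>C (a * uea_gen x) \<in>
    cvs.span {b. mon n (q + p) (\<lambda>H. \<alpha> H + \<mu> H) b}"
  using assms(1)
proof (induction rule: mon.induct)
  case mon_one
  then show ?case by (simp add: koszul_def scaleC_one cvs.span_zero)
next
  case (mon_step y r \<beta> n p \<mu> a)
  let ?S = "cvs.span {b. mon (Suc n) (q + (r + p)) (\<lambda>H. \<alpha> H + (\<beta> H + \<mu> H)) b}"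
  have xy: "x \<in> hpart q" "y \<in> hpart r" using assms(2) mon_step by (auto simp: wvec_def)
  have "mon (Suc n) (q + r + p) (\<lambda>H. \<alpha> H + \<beta> H + \<mu> H) (uea_gen (brk x y) * a)"
    by (rule mon.mon_step[OF wvec_brk[OF assms(2) mon_step(1)] mon_step(2)])
  then have 1: "uea_gen (brk x y) * a \<in> ?S"
    by (intro cvs.span_base) (simp add: add.assoc)
  have "uea_gen y * (uea_gen x * a - koszul q p *\<^sub>C (a * uea_gen x)) \<in>
    cvs.span {b. mon (Suc n) (r + (q + p)) (\<lambda>H. \<beta> H + (\<alpha> H + \<mu> H)) b}"
    by (rule mon_span_step[OF mon_step(1) mon_step.IH])
  then have 2: "uea_gen y * (uea_gen x * a - koszul q p *\<^sub>C (a * uea_gen x)) \<in> ?S"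
    by (simp add: add.left_commute)
  have "uea_gen x * (uea_gen y * a) = (uea_gen x * uea_gen y) * a" by (simp add: mult.assoc)
  then have "uea_gen x * (uea_gen y * a) - koszul q (r + p) *\<^sub>C (uea_gen y * a * uea_gen x) =
     uea_gen (brk x y) * a +
     koszul q r *\<^sub>C (uea_gen y * (uea_gen x * a - koszul q p *\<^sub>C (a * uea_gen x)))"
    unfolding uea_gen_swap[OF xy] koszul_add
    by (simp add: distrib_right right_diff_distrib uea_scale_mult_left uea_scale_mult_right
        cvs.scale_right_diff_distrib scaleC_scaleC mult.assoc)
  with 1 2 show ?case by (simp add: cvs.span_add cvs.span_scale)
qed

lemma uea_part_mon: "uea_part p \<subseteq> cvs.span {a. \<exists>n \<mu>. mon n p \<mu> a}"
proof (rule uea_part_induct[where S = "\<lambda>q. \<Union>\<alpha>. wvec q \<alpha>"])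
  show "1 \<in> cvs.span {a. \<exists>n \<mu>. mon n 0 \<mu> a}"
    using mon_one by (blast intro: cvs.span_base)
next
  fix q p x a
  assume x: "x \<in> (\<Union>\<alpha>. wvec q \<alpha>)" and a: "a \<in> cvs.span {a. \<exists>n \<mu>. mon n p \<mu> a}"
  from a show "uea_gen x * a \<in> cvs.span {a. \<exists>n \<mu>. mon n (q + p) \<mu> a}"
  proof (induction rule: cvs.span_induct_alt)
    case (step c a b)
    then have "uea_gen x * a \<in> cvs.span {a. \<exists>n \<mu>. mon n (q + p) \<mu> a}"
      using x mon_step by (blast intro: cvs.span_base)
    with step show ?case
      by (auto simp: distrib_left uea_scale_mult_right intro!: cvs.span_add cvs.span_scale)
  qed (simp add: cvs.span_zero)
qed (simp_all add: hpart_span_wvec)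

end

locale pos_torus = torus +
  fixes P :: "('a \<Rightarrow> complex) set"
  assumes pos: "positive_system hC P"
begin

text \<open>A regular element that cuts out P. The real number \<open>Re (\<mu> H0)\<close> serves
  as the height of a weight.\<close>

definition H0 where "H0 = (SOME H. H \<in> hC \<and> (\<forall>\<alpha>\<in>roots hC. Re (\<alpha> H) \<noteq> 0) \<and> P = {\<alpha> \<in> roots hC. Re (\<alpha> H) > 0})"

lemma H0: "H0 \<in> hC" "\<alpha> \<in> roots hC \<Longrightarrow> Re (\<alpha> H0) \<noteq> 0" "P = {\<alpha> \<in> roots hC. Re (\<alpha> H0) > 0}"
proof -
  have "\<exists>H. H \<in> hC \<and> (\<forall>\<alpha>\<in>roots hC. Re (\<alpha> H) \<noteq> 0) \<and> P = {\<alpha> \<in> roots hC. Re (\<alpha> H) > 0}"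
    using pos by (auto simp: positive_system_def)
  from someI_ex[OF this, folded H0_def]
  show "H0 \<in> hC" "\<alpha> \<in> roots hC \<Longrightarrow> Re (\<alpha> H0) \<noteq> 0" "P = {\<alpha> \<in> roots hC. Re (\<alpha> H0) > 0}"
    by auto
qed

definition borel_sum where
  "borel_sum = {b + c | b c. b \<in> uea_cartan hC \<and> c \<in> uea_nplus hC P}"

lemma nplus_subspace: "cvs.subspace (uea_nplus hC P)"
  by (simp add: uea_nplus_def)

lemma cartan_subspace: "cvs.subspace (uea_cartan hC)"
  by (simp add: uea_cartan_def)

lemma borel_sum_subspace: "cvs.subspace borel_sum"
  unfolding borel_sum_def by (rule cvs.subspace_sums[OF cartan_subspace nplus_subspace])

lemma nplus_borel: "c \<in> uea_nplus hC P \<Longrightarrow> c \<in> borel_sum"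
  unfolding borel_sum_def using cvs.subspace_0[OF cartan_subspace] by force

text \<open>Induction on the length: if the first factor has positive weight, it is moved to the right end,
  at the cost of shorter monomials of the same weight; if it has negative weight, then the remaining
  factors have positive total weight.\<close>

lemma mon_triangular:
  "mon n p \<mu> a \<Longrightarrow> (Re (\<mu> H0) > 0 \<longrightarrow> a \<in> uea_nplus hC P) \<and> (Re (\<mu> H0) = 0 \<longrightarrow> a \<in> borel_sum)"
proof (induction n arbitrary: p \<mu> a)
  case 0
  then have "a = 1" "\<mu> = (\<lambda>_. 0)" by (auto elim: mon.cases)
  then show ?case
    using cartan_one cvs.subspace_0[OF nplus_subspace] by (force simp: borel_sum_def)
next
  case (Suc n)
  from Suc.prems obtain x q \<alpha> p' \<mu>' a' where x: "x \<in> wvec q \<alpha>" "mon n p' \<mu>' a'"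
    "p = q + p'" "\<mu> = (\<lambda>H. \<alpha> H + \<mu>' H)" "a = uea_gen x * a'"
    by (auto elim: mon.cases)
  note IH = Suc.IH[OF x(2)]
  consider "x = 0" | "x \<noteq> 0" "\<alpha> = (\<lambda>_. 0)" | "\<alpha> \<in> roots hC"
    using x(1) by (auto simp: wvec_def roots_def)
  then show ?case
  proof cases
    case 1
    then show ?thesis
      by (simp add: x cvs.subspace_0[OF nplus_subspace] cvs.subspace_0[OF borel_sum_subspace])
  next
    case 2
    \<comment> \<open>A first factor of weight zero lies in the Cartan subalgebra; multiplying by it
      from the left preserves U(h) and the left ideal, and does not change the height.\<close>
    then have "x \<in> hC" using x(1) by (intro zero_weight) (auto simp: wvec_def root_space_def)
    have "uea_gen x * b \<in> borel_sum" if b: "b \<in> borel_sum" for b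
    proof -
      from b obtain u c where "u \<in> uea_cartan hC" "c \<in> uea_nplus hC P" "b = u + c"
        by (auto simp: borel_sum_def)
      then have "uea_gen x * b = uea_gen x * u + uea_gen x * c \<and>
          uea_gen x * u \<in> uea_cartan hC \<and> uea_gen x * c \<in> uea_nplus hC P"
        using cartan_gen_mult[OF \<open>x \<in> hC\<close>] nplus_left by (simp add: distrib_left)
      then show ?thesis unfolding borel_sum_def by blast
    qed
    then show ?thesis using IH 2 by (simp add: x nplus_left)
  next
    case 3
    show ?thesis
    proof (cases "Re (\<alpha> H0) > 0")
      case True
      then have "\<alpha> \<in> P" using 3 H0(3) by auto
      then have "a' * uea_gen x \<in> uea_nplus hC P"
        unfolding uea_nplus_def using x(1) by (intro cvs.span_base) (auto simp: wvec_def)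
      then have 1: "koszul q p' *\<^sub>C (a' * uea_gen x) \<in> uea_nplus hC P"
        by (rule cvs.subspace_scale[OF nplus_subspace])
      have 2: "uea_gen x * a' - koszul q p' *\<^sub>C (a' * uea_gen x) \<in> cvs.span {b. mon n p \<mu> b}"
        unfolding x(3,4) by (rule mon_move[OF x(2,1)])
      have a: "a = (uea_gen x * a' - koszul q p' *\<^sub>C (a' * uea_gen x)) + koszul q p' *\<^sub>C (a' * uea_gen x)"
        by (simp add: x)
      have "a \<in> uea_nplus hC P" if "Re (\<mu> H0) > 0"
      proof -
        have "cvs.span {b. mon n p \<mu> b} \<subseteq> uea_nplus hC P"
          using Suc.IH that by (intro cvs.span_minimal nplus_subspace) auto
        with 1 2 show ?thesis by (subst a) (blast intro: cvs.subspace_add[OF nplus_subspace])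
      qed
      moreover have "a \<in> borel_sum" if "Re (\<mu> H0) = 0"
      proof -
        have "cvs.span {b. mon n p \<mu> b} \<subseteq> borel_sum"
          using Suc.IH that by (intro cvs.span_minimal borel_sum_subspace) auto
        with nplus_borel[OF 1] 2 show ?thesis
          by (subst a) (blast intro: cvs.subspace_add[OF borel_sum_subspace])
      qed
      ultimately show ?thesis by blast
    next
      case False
      then have "Re (\<alpha> H0) < 0" using H0(2)[OF 3] by simp
      then show ?thesis using IH by (auto simp: x intro: nplus_left nplus_borel)
    qed
  qed
qed

definition nonzero_part where
  "nonzero_part = cvs.span (\<Union>\<mu>\<in>{\<mu> \<in> dual_of hC. \<mu> \<noteq> (\<lambda>_. 0)}. uea_weight hC \<mu>)"

abbreviation U0 where "U0 \<equiv> uea_weight hC (\<lambda>_. 0)"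

lemma U0_nonzero: "u \<in> U0 \<Longrightarrow> u \<in> nonzero_part \<Longrightarrow> u = 0"
proof -
  assume u: "u \<in> U0" "u \<in> nonzero_part"
  show "u = 0"
  proof (rule joint_eigenspaces_independent)
    show "clinear (\<lambda>a. uea_gen H * a - a * uea_gen H)" for H :: 'a
      by (rule clinearI) (simp_all add: algebra_simps uea_scale_mult_left uea_scale_mult_right)
    show "uea_weight hC \<mu> = {v. \<forall>H\<in>hC. uea_gen H * v - v * uea_gen H = \<mu> H *\<^sub>C v}" for \<mu>
      by (simp add: uea_weight_def)
    show "u \<in> cvs.span (\<Union>\<mu>\<in>{\<mu> \<in> dual_of hC. \<mu> \<noteq> (\<lambda>_. 0)}. uea_weight hC \<mu>)"
      using u by (simp add: nonzero_part_def)
    show "u \<in> U0" by fact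
  qed (simp add: dual_nonzero)
qed

lemma mon_U0_or_nonzero:
  assumes "mon n p \<mu> a"
  shows "(\<mu> = (\<lambda>_. 0) \<and> a \<in> U0 \<and> a \<in> borel_sum) \<or> a \<in> nonzero_part"
proof (cases "\<mu> = (\<lambda>_. 0)")
  case True
  then show ?thesis using mon_weight[OF assms] mon_triangular[OF assms] by auto
next
  case False
  then show ?thesis
    using mon_weight[OF assms] by (auto simp: nonzero_part_def intro!: cvs.span_base)
qed

text \<open>The component is also required to lie in \<open>borel_sum\<close>. Once weight-zero
  components are known to be unique, an element of \<open>U0\<close> equals its own component and so
  lies in \<open>borel_sum\<close> itself.\<close>

lemma U0_decomp: "\<exists>u\<in>U0 \<inter> borel_sum. a - u \<in> nonzero_part"
proof -
  let ?T = "{a. \<exists>u\<in>U0 \<inter> borel_sum. a - u \<in> nonzero_part}"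
  have sub: "cvs.subspace ?T"
    unfolding cvs.subspace_def
  proof (intro conjI ballI allI)
    show "0 \<in> ?T"
      by (auto intro!: bexI[of _ 0] simp: cvs.subspace_0[OF uea_weight_subspace]
          cvs.subspace_0[OF borel_sum_subspace] nonzero_part_def cvs.span_zero)
  next
    fix a b assume "a \<in> ?T" "b \<in> ?T"
    then obtain u v where uv: "u \<in> U0 \<inter> borel_sum" "v \<in> U0 \<inter> borel_sum"
      "a - u \<in> nonzero_part" "b - v \<in> nonzero_part" by blast
    have "(a - u) + (b - v) \<in> nonzero_part"
      using uv unfolding nonzero_part_def by (blast intro: cvs.span_add)
    then show "a + b \<in> ?T" using uv
      by (intro CollectI bexI[of _ "u + v"])
       (auto simp: algebra_simps intro: cvs.subspace_add[OF uea_weight_subspace]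
         cvs.subspace_add[OF borel_sum_subspace])
  next
    fix c a assume "a \<in> ?T"
    then obtain u where u: "u \<in> U0 \<inter> borel_sum" "a - u \<in> nonzero_part" by blast
    have "c *\<^sub>C (a - u) \<in> nonzero_part"
      using u unfolding nonzero_part_def by (blast intro: cvs.span_scale)
    then show "c *\<^sub>C a \<in> ?T" using u
      by (intro CollectI bexI[of _ "c *\<^sub>C u"])
       (auto simp: cvs.scale_right_diff_distrib intro: cvs.subspace_scale[OF uea_weight_subspace]
         cvs.subspace_scale[OF borel_sum_subspace])
  qed
  have "a \<in> ?T" if "mon n p \<mu> a" for n p \<mu> a
    using mon_U0_or_nonzero[OF that]
  proof
    assume "\<mu> = (\<lambda>_. 0) \<and> a \<in> U0 \<and> a \<in> borel_sum"
    then show "a \<in> ?T" by (intro CollectI bexI[of _ a]) (simp_all add: nonzero_part_def cvs.span_zero)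
  next
    assume "a \<in> nonzero_part"
    then show "a \<in> ?T"
      by (intro CollectI bexI[of _ 0]) (simp_all add: cvs.subspace_0[OF uea_weight_subspace]
          cvs.subspace_0[OF borel_sum_subspace])
  qed
  then have "uea_part p \<subseteq> ?T" for p
    using uea_part_mon[of p] cvs.span_minimal[OF _ sub, of "{a. \<exists>n \<mu>. mon n p \<mu> a}"] by blast
  from uea_induct_parts[OF this sub, of a] show ?thesis by simp
qed

lemma U0_borel: "U0 \<subseteq> borel_sum"
proof
  fix u assume u: "u \<in> U0"
  obtain v where v: "v \<in> U0 \<inter> borel_sum" "u - v \<in> nonzero_part" using U0_decomp by blast
  then have "u - v \<in> U0" using u by (auto intro: cvs.subspace_diff[OF uea_weight_subspace])
  then have "u - v = 0" using v(2) by (rule U0_nonzero)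
  with v show "u \<in> borel_sum" by simp
qed

definition proj0 where "proj0 a = (THE u. u \<in> U0 \<and> a - u \<in> nonzero_part)"

lemma proj0_eqI:
  assumes "u \<in> U0" "a - u \<in> nonzero_part"
  shows "proj0 a = u"
  unfolding proj0_def
proof (rule the_equality)
  fix v assume v: "v \<in> U0 \<and> a - v \<in> nonzero_part"
  have "(a - u) - (a - v) \<in> nonzero_part"
    using assms v unfolding nonzero_part_def by (blast intro: cvs.span_diff)
  then have "v - u \<in> nonzero_part" by simp
  moreover have "v - u \<in> U0" using assms v by (blast intro: cvs.subspace_diff[OF uea_weight_subspace])
  ultimately have "v - u = 0" by (intro U0_nonzero)
  then show "v = u" by simp
qed (use assms in simp)

lemma proj0_in: "proj0 a \<in> U0" and proj0_diff: "a - proj0 a \<in> nonzero_part"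
proof -
  obtain u where "u \<in> U0" "a - u \<in> nonzero_part" using U0_decomp by blast
  then show "proj0 a \<in> U0" "a - proj0 a \<in> nonzero_part" using proj0_eqI by auto
qed

lemma proj0_linear: "clinear proj0"
proof (rule clinearI)
  fix a b c
  have "(a - proj0 a) + (b - proj0 b) \<in> nonzero_part"
    using proj0_diff unfolding nonzero_part_def by (blast intro: cvs.span_add)
  then show "proj0 (a + b) = proj0 a + proj0 b"
    by (intro proj0_eqI cvs.subspace_add[OF uea_weight_subspace] proj0_in) (simp add: algebra_simps)
  have "c *\<^sub>C (a - proj0 a) \<in> nonzero_part"
    using proj0_diff unfolding nonzero_part_def by (blast intro: cvs.span_scale)
  then show "proj0 (c *\<^sub>C a) = c *\<^sub>C proj0 a"
    by (intro proj0_eqI cvs.subspace_scale[OF uea_weight_subspace] proj0_in)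
      (simp add: cvs.scale_right_diff_distrib)
qed

text \<open>A value with the required congruence is chosen on a basis of \<open>U0\<close> and
  extended linearly, which makes linearity automatic; the congruence persists because both subspaces
  are closed under combinations. Composition with \<open>proj0\<close> gives zero on the other
  weights.\<close>

lemma is_beta_beta: "is_beta hC P (beta hC P)"
proof -
  obtain B where B: "B \<subseteq> U0" "cvs.independent B" "U0 \<subseteq> cvs.span B"
    using cvs.maximal_independent_subset by blast
  define f where "f u = (SOME b. b \<in> uea_cartan hC \<and> u - b \<in> uea_nplus hC P)" for u
  have f: "f u \<in> uea_cartan hC \<and> u - f u \<in> uea_nplus hC P" if "u \<in> B" for u
  proof -
    have "u \<in> borel_sum" using that B U0_borel by blast
    then have "\<exists>b. b \<in> uea_cartan hC \<and> u - b \<in> uea_nplus hC P" by (auto simp: borel_sum_def)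
    then show ?thesis unfolding f_def by (rule someI_ex)
  qed
  interpret vsp: vector_space_pair "scaleC :: complex \<Rightarrow> 'a uea \<Rightarrow> 'a uea"
    "scaleC :: complex \<Rightarrow> 'a uea \<Rightarrow> 'a uea" ..
  obtain F where F: "clinear F" "\<And>u. u \<in> B \<Longrightarrow> F u = f u"
    using vsp.linear_independent_extend[OF B(2), of f] by blast
  have F0: "F u \<in> uea_cartan hC \<and> u - F u \<in> uea_nplus hC P" if "u \<in> U0" for u
  proof -
    have "u \<in> cvs.span B" using that B by blast
    then show ?thesis
    proof (induction rule: cvs.span_induct_alt)
      case base
      show ?case by (simp add: clinear_simps[OF F(1)] cvs.subspace_0[OF cartan_subspace]
          cvs.subspace_0[OF nplus_subspace])
    next
      case (step c x y)
      then have x: "F x \<in> uea_cartan hC" "x - F x \<in> uea_nplus hC P" using f F(2) by auto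
      have "c *\<^sub>C (x - F x) + (y - F y) \<in> uea_nplus hC P"
        using x step by (blast intro: cvs.subspace_add[OF nplus_subspace] cvs.subspace_scale[OF nplus_subspace])
      then have "c *\<^sub>C x + y - F (c *\<^sub>C x + y) \<in> uea_nplus hC P"
        by (simp add: clinear_simps[OF F(1)] cvs.scale_right_diff_distrib algebra_simps)
      moreover have "F (c *\<^sub>C x + y) \<in> uea_cartan hC"
        using x step by (simp add: clinear_simps[OF F(1)] cvs.subspace_add[OF cartan_subspace]
            cvs.subspace_scale[OF cartan_subspace])
      ultimately show ?case by simp
    qed
  qed
  have "is_beta hC P (\<lambda>a. F (proj0 a))"
    unfolding is_beta_def
  proof (intro conjI ballI impI)
    show "clinear (\<lambda>a. F (proj0 a))"
      by (rule clinearI) (simp_all add: clinear_simps[OF F(1)] clinear_simps[OF proj0_linear])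
    fix u assume "u \<in> U0"
    moreover have "proj0 u = u" if "u \<in> U0" for u
      using that by (intro proj0_eqI) (simp_all add: nonzero_part_def cvs.span_zero)
    ultimately show "F (proj0 u) \<in> uea_cartan hC" "u - F (proj0 u) \<in> uea_nplus hC P"
      using F0 by simp_all
  next
    fix \<mu> u assume "\<mu> \<in> dual_of hC" "\<mu> \<noteq> (\<lambda>_. 0)" "u \<in> uea_weight hC \<mu>"
    then have "u \<in> nonzero_part" by (auto simp: nonzero_part_def intro!: cvs.span_base)
    then have "proj0 u = 0"
      by (intro proj0_eqI) (simp_all add: cvs.subspace_0[OF uea_weight_subspace])
    then show "F (proj0 u) = 0" by (simp add: clinear_simps[OF F(1)])
  qed
  then show ?thesis unfolding beta_def by (rule someI[of "is_beta hC P"])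
qed

lemma beta_linear: "clinear (beta hC P)"
  using is_beta_beta by (simp add: is_beta_def)

lemma beta_U0: "u \<in> U0 \<Longrightarrow> beta hC P u \<in> uea_cartan hC \<and> u - beta hC P u \<in> uea_nplus hC P"
  using is_beta_beta by (simp add: is_beta_def)

lemma beta_nonzero:
  assumes "t \<in> nonzero_part"
  shows "beta hC P t = 0"
  using assms unfolding nonzero_part_def
proof (induction rule: cvs.span_induct_alt)
  case (step c x y)
  then have "beta hC P x = 0" using is_beta_beta by (auto simp: is_beta_def)
  with step show ?case by (simp add: clinear_simps[OF beta_linear])
qed (simp add: clinear_simps[OF beta_linear])

lemma beta_proj0: "beta hC P a = beta hC P (proj0 a)"
  using beta_nonzero[OF proj0_diff[of a]] by (simp add: clinear_simps[OF beta_linear])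

lemma beta_cartan: "beta hC P a \<in> uea_cartan hC"
  using beta_U0[OF proj0_in] beta_proj0 by metis

end

section \<open>Highest weight modules and unitarity\<close>

lemma uea_gen_induct:
  assumes sub: "cvs.subspace T" and one: "1 \<in> T" and step: "\<And>x a. a \<in> T \<Longrightarrow> uea_gen x * a \<in> T"
  shows "(a :: 'g::lie_superalgebra uea) \<in> T"
proof (rule uea_induct_parts[OF _ sub])
  show "uea_part p \<subseteq> T" for p
    by (rule uea_part_induct[where S = hpart]) (auto simp: sub one step cvs.span_base)
qed

lemma cartan_mult:
  assumes "a \<in> uea_cartan hC" "b \<in> uea_cartan hC"
  shows "a * b \<in> uea_cartan hC"
  using assms(1) unfolding uea_cartan_def[of hC]
proof (induction rule: cvs.span_induct_alt)
  case (step c x y)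
  then obtain xs where xs: "x = prod_list (map uea_gen xs)" "set xs \<subseteq> hC" by blast
  from xs(2) have "prod_list (map uea_gen xs) * b \<in> uea_cartan hC"
    by (induction xs) (simp_all add: assms(2) mult.assoc cartan_gen_mult)
  with step.IH show ?case
    by (simp add: xs(1) distrib_right uea_scale_mult_left uea_cartan_def cvs.span_add cvs.span_scale)
qed (simp add: cvs.span_zero)

locale highest_weight_module = pos_torus g h P
  for g h and P :: "('g::lie_superalgebra \<Rightarrow> complex) set" +
  fixes V :: "bit \<Rightarrow> 'v::complex_vector set" and \<rho> :: "'g \<Rightarrow> 'v \<Rightarrow> 'v"
    and lam :: "'g \<Rightarrow> complex" and \<Phi> :: "'g uea \<Rightarrow> 'v" and d :: bit
  assumes lam: "lam \<in> dual_of hC"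
    and rep: "representation V \<rho>"
    and irred: "irreducible_rep V \<rho>"
    and \<Phi>_linear: "clinear \<Phi>"
    and \<Phi>_surj: "surj \<Phi>"
    and \<Phi>_gen: "\<Phi> (uea_gen x * a) = \<rho> x (\<Phi> a)"
    and \<Phi>_verma: "a \<in> verma_ideal hC P lam \<Longrightarrow> \<Phi> a = 0"
    and \<Phi>_part: "a \<in> uea_part p \<Longrightarrow> \<Phi> a \<in> V (p + d)"
begin

lemmas \<Phi>_simps = clinear_simps[OF \<Phi>_linear]

lemma \<rho>_linear: "clinear (\<rho> x)" and \<rho>_linear_left: "clinear (\<lambda>x. \<rho> x w)"
  using rep by (auto simp: representation_def)

lemmas \<rho>_simps = clinear_simps[OF \<rho>_linear]
lemmas \<rho>_left = clinear_simps[OF \<rho>_linear_left]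

lemma V_subspace: "cvs.subspace (V p)" and V_disjoint: "V 0 \<inter> V 1 = {0}"
  using rep by (auto simp: representation_def superspace_def)

lemma \<Phi>_left_zero:
  assumes "\<Phi> b = 0"
  shows "\<Phi> (a * b) = 0"
proof -
  have "a \<in> {a. \<Phi> (a * b) = 0}"
    by (rule uea_gen_induct)
      (auto simp: assms cvs.subspace_def distrib_right uea_scale_mult_left \<Phi>_simps mult.assoc \<Phi>_gen \<rho>_simps)
  then show ?thesis by simp
qed

definition hv where "hv = \<Phi> 1"

lemma hv_nonzero: "hv \<noteq> 0"
proof
  assume "hv = 0"
  then have "\<Phi> a = 0" for a using \<Phi>_left_zero[of 1 a] by (simp add: hv_def)
  then have "(UNIV :: 'v set) = {0}" using \<Phi>_surj by auto
  then show False using irred by (simp add: irreducible_rep_def)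
qed

lemma \<Phi>_nplus:
  assumes "u \<in> uea_nplus hC P"
  shows "\<Phi> u = 0"
proof (rule \<Phi>_verma)
  show "u \<in> verma_ideal hC P lam"
    using assms cvs.span_mono[OF Un_upper1] unfolding uea_nplus_def verma_ideal_def by blast
qed

lemma \<Phi>_cartan_gen:
  assumes "H \<in> hC"
  shows "\<Phi> (a * uea_gen H) = lam H *\<^sub>C \<Phi> a"
proof -
  have "a * (uea_gen H - lam H *\<^sub>C 1) \<in> verma_ideal hC P lam"
    unfolding verma_ideal_def using assms by (blast intro: cvs.span_base)
  then have "\<Phi> (a * (uea_gen H - lam H *\<^sub>C 1)) = 0" by (rule \<Phi>_verma)
  then show ?thesis by (simp add: right_diff_distrib uea_scale_mult_right \<Phi>_simps)
qed

text \<open>Any choice of the evaluation at \<open>\<lambda>\<close> is determined by the action on the highest weight vector,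
  so the Poincare-Birkhoff-Witt theorem is not needed.\<close>

lemma is_eval_unique:
  assumes \<chi>: "is_eval hC lam \<chi>" and a: "a \<in> uea_cartan hC"
  shows "\<Phi> a = \<chi> a *\<^sub>C hv"
proof -
  have \<chi>': "\<chi> 1 = 1" "\<And>a b. a \<in> uea_cartan hC \<Longrightarrow> b \<in> uea_cartan hC \<Longrightarrow> \<chi> (a + b) = \<chi> a + \<chi> b"
    "\<And>a b. a \<in> uea_cartan hC \<Longrightarrow> b \<in> uea_cartan hC \<Longrightarrow> \<chi> (a * b) = \<chi> a * \<chi> b"
    "\<And>c a. a \<in> uea_cartan hC \<Longrightarrow> \<chi> (c *\<^sub>C a) = c * \<chi> a"
    "\<And>H. H \<in> hC \<Longrightarrow> \<chi> (uea_gen H) = lam H"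
    using \<chi> by (auto simp: is_eval_def)
  have gen: "uea_gen H \<in> uea_cartan hC" if "H \<in> hC" for H
    using cartan_gen_mult[OF that cartan_one] by simp
  have "a \<in> cvs.span {prod_list (map uea_gen xs) | xs. set xs \<subseteq> hC}"
    using a by (simp add: uea_cartan_def)
  then have "a \<in> uea_cartan hC \<and> \<Phi> a = \<chi> a *\<^sub>C hv"
  proof (induction rule: cvs.span_induct_alt)
    case base
    have "\<chi> 0 = 0" using \<chi>'(4)[OF cvs.subspace_0[OF cartan_subspace], of 0] by simp
    then show ?case by (simp add: \<Phi>_simps cvs.subspace_0[OF cartan_subspace])
  next
    case (step c x y)
    then obtain xs where xs: "x = prod_list (map uea_gen xs)" "set xs \<subseteq> hC" by blast
    from xs(2) have "prod_list (map uea_gen xs) \<in> uea_cartan hC \<and>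
        \<Phi> (prod_list (map uea_gen xs)) = \<chi> (prod_list (map uea_gen xs)) *\<^sub>C hv"
    proof (induction xs)
      case Nil
      then show ?case by (simp add: cartan_one \<chi>' hv_def scaleC_one)
    next
      case (Cons H xs)
      have "\<rho> H hv = lam H *\<^sub>C hv"
        using \<Phi>_cartan_gen[of H 1] \<Phi>_gen[of H 1] Cons by (simp add: hv_def)
      with Cons show ?case
        by (simp add: cartan_gen_mult \<chi>' gen \<Phi>_gen \<rho>_simps scaleC_scaleC mult.commute)
    qed
    then have x: "x \<in> uea_cartan hC" "\<Phi> x = \<chi> x *\<^sub>C hv" by (simp_all add: xs)
    with step show ?case
      by (simp add: \<Phi>_simps \<chi>' cvs.subspace_add[OF cartan_subspace]
          cvs.subspace_scale[OF cartan_subspace] scaleC_add_left scaleC_scaleC)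
  qed
  then show ?thesis by simp
qed

text \<open>U(h) acts on the highest weight vector by scalars. Since that vector is nonzero the
  scalar is unique, and it is a character that extends lam.\<close>

lemma is_eval_eval_at: "is_eval hC lam (eval_at hC lam)"
proof -
  have ex: "\<exists>c. \<Phi> a = c *\<^sub>C hv" if "a \<in> uea_cartan hC" for a
    using that unfolding uea_cartan_def
  proof (induction rule: cvs.span_induct_alt)
    case base
    show ?case by (rule exI[of _ 0]) (simp add: \<Phi>_simps)
  next
    case (step c x y)
    then obtain xs where xs: "x = prod_list (map uea_gen xs)" "set xs \<subseteq> hC" by blast
    from xs(2) have "\<exists>c. \<Phi> (prod_list (map uea_gen xs)) = c *\<^sub>C hv"
    proof (induction xs)
      case Nil
      then show ?case by (intro exI[of _ 1]) (simp add: hv_def scaleC_one)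
    next
      case (Cons H xs)
      then obtain c where "\<Phi> (prod_list (map uea_gen xs)) = c *\<^sub>C hv" by auto
      moreover have "\<rho> H hv = lam H *\<^sub>C hv"
        using \<Phi>_cartan_gen[of H 1] \<Phi>_gen[of H 1] Cons by (simp add: hv_def)
      ultimately show ?case
        by (intro exI[of _ "c * lam H"]) (simp add: \<Phi>_gen \<rho>_simps scaleC_scaleC)
    qed
    then obtain b where "\<Phi> x = b *\<^sub>C hv" using xs by blast
    moreover obtain e where "\<Phi> y = e *\<^sub>C hv" using step by blast
    ultimately show ?case
      by (intro exI[of _ "c * b + e"]) (simp add: \<Phi>_simps scaleC_add_left scaleC_scaleC)
  qed
  define \<chi> where "\<chi> a = (SOME c. \<Phi> a = c *\<^sub>C hv)" for a
  have \<chi>: "\<Phi> a = \<chi> a *\<^sub>C hv" if "a \<in> uea_cartan hC" for a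
    unfolding \<chi>_def by (rule someI_ex[OF ex[OF that]])
  have eq: "c = c'" if "c *\<^sub>C hv = c' *\<^sub>C hv" for c c' :: complex
    using that hv_nonzero by simp
  have "is_eval hC lam \<chi>"
    unfolding is_eval_def
  proof (intro conjI ballI allI)
    show "\<chi> 1 = 1" using \<chi>[OF cartan_one] by (intro eq) (simp add: hv_def[symmetric] scaleC_one)
  next
    fix a b assume ab: "a \<in> uea_cartan hC" "b \<in> uea_cartan hC"
    have "\<chi> (a + b) *\<^sub>C hv = (\<chi> a + \<chi> b) *\<^sub>C hv"
      using \<chi>[OF cvs.subspace_add[OF cartan_subspace ab]] by (simp add: \<Phi>_simps \<chi> ab scaleC_add_left)
    then show "\<chi> (a + b) = \<chi> a + \<chi> b" by (rule eq)
    \<comment> \<open>Multiplicativity: b minus its scalar lies in the kernel of \<Phi>, which is a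
      left ideal, so a times this difference is killed as well.\<close>
    have "\<Phi> (b - \<chi> b *\<^sub>C 1) = 0" by (simp add: \<Phi>_simps \<chi> ab flip: hv_def)
    then have "\<Phi> (a * (b - \<chi> b *\<^sub>C 1)) = 0" by (rule \<Phi>_left_zero)
    then have "\<Phi> (a * b) = \<chi> b *\<^sub>C \<Phi> a" by (simp add: right_diff_distrib uea_scale_mult_right \<Phi>_simps)
    then have "\<chi> (a * b) *\<^sub>C hv = (\<chi> a * \<chi> b) *\<^sub>C hv"
      using \<chi>[OF cartan_mult[OF ab]] by (simp add: \<chi> ab scaleC_scaleC mult.commute)
    then show "\<chi> (a * b) = \<chi> a * \<chi> b" by (rule eq)
  next
    fix c a assume a: "a \<in> uea_cartan hC"
    have "\<chi> (c *\<^sub>C a) *\<^sub>C hv = (c * \<chi> a) *\<^sub>C hv"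
      using \<chi>[OF cvs.subspace_scale[OF cartan_subspace a], of c, symmetric]
      by (simp add: \<Phi>_simps \<chi> a scaleC_scaleC)
    then show "\<chi> (c *\<^sub>C a) = c * \<chi> a" by (rule eq)
  next
    fix H assume H: "H \<in> hC"
    have "uea_gen H \<in> uea_cartan hC" using cartan_gen_mult[OF H cartan_one] by simp
    from \<chi>[OF this] have "\<chi> (uea_gen H) *\<^sub>C hv = lam H *\<^sub>C hv"
      using \<Phi>_cartan_gen[OF H, of 1] by (simp add: hv_def)
    then show "\<chi> (uea_gen H) = lam H" by (rule eq)
  qed
  then show ?thesis unfolding eval_at_def by (rule someI[of "is_eval hC lam"])
qed

definition N :: "'g uea \<Rightarrow> complex" where "N a = eval_at hC lam (beta hC P a)"

lemma N_linear: "N (a + b) = N a + N b" "N (c *\<^sub>C a) = c * N a"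
  using is_eval_eval_at beta_cartan
  by (auto simp: N_def clinear_simps[OF beta_linear] is_eval_def)

definition wspace :: "('g \<Rightarrow> complex) \<Rightarrow> 'v set" where
  "wspace \<nu> = {w. \<forall>H\<in>hC. \<rho> H w = \<nu> H *\<^sub>C w}"

definition lower_part :: "'v set" where
  "lower_part = cvs.span (\<Union>\<mu>\<in>{\<mu> \<in> dual_of hC. \<mu> \<noteq> (\<lambda>_. 0)}. wspace (\<lambda>H. lam H + \<mu> H))"

lemma \<Phi>_weight:
  assumes "u \<in> uea_weight hC \<mu>"
  shows "\<Phi> u \<in> wspace (\<lambda>H. lam H + \<mu> H)"
proof -
  have "\<rho> H (\<Phi> u) = (lam H + \<mu> H) *\<^sub>C \<Phi> u" if "H \<in> hC" for H
  proof -
    have "uea_gen H * u = u * uea_gen H + \<mu> H *\<^sub>C u"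
      using assms that by (simp add: uea_weight_def diff_eq_eq add.commute)
    then have "\<rho> H (\<Phi> u) = \<Phi> (u * uea_gen H + \<mu> H *\<^sub>C u)" by (metis \<Phi>_gen)
    then show ?thesis by (simp add: \<Phi>_simps \<Phi>_cartan_gen[OF that] scaleC_add_left)
  qed
  then show ?thesis by (simp add: wspace_def)
qed

lemma hv_weight: "hv \<in> wspace lam"
  using \<Phi>_weight[of 1 "\<lambda>_. 0"] by (simp add: hv_def uea_weight_def)

text \<open>The weight-zero component of a differs from its \<open>beta\<close> by an element of the
  left ideal that \<Phi> kills, and \<open>beta\<close> acts on \<open>hv\<close> by its evaluation.
  The other components map to weights different from lam.\<close>

lemma \<Phi>_N: "\<Phi> a - N a *\<^sub>C hv \<in> lower_part"
proof -
  have "\<Phi> (proj0 a - beta hC P (proj0 a)) = 0" using beta_U0[OF proj0_in] \<Phi>_nplus by blast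
  then have "\<Phi> (proj0 a) = \<Phi> (beta hC P a)" by (simp add: \<Phi>_simps beta_proj0[of a])
  also have "\<dots> = N a *\<^sub>C hv" unfolding N_def by (rule is_eval_unique[OF is_eval_eval_at beta_cartan])
  finally have "\<Phi> a - N a *\<^sub>C hv = \<Phi> (a - proj0 a)" by (simp add: \<Phi>_simps)
  moreover have "\<Phi> t \<in> lower_part" if "t \<in> nonzero_part" for t
    using that unfolding nonzero_part_def
  proof (induction rule: cvs.span_induct_alt)
    case base
    show ?case by (simp add: \<Phi>_simps lower_part_def cvs.span_zero)
  next
    case (step c x y)
    then have "\<Phi> x \<in> lower_part"
      using \<Phi>_weight unfolding lower_part_def by (blast intro: cvs.span_base)
    with step show ?case
      by (simp add: \<Phi>_simps lower_part_def cvs.span_add cvs.span_scale)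
  qed
  ultimately show ?thesis using proj0_diff by simp
qed

lemma hv_lower_part:
  assumes "c *\<^sub>C hv \<in> lower_part"
  shows "c = 0"
proof -
  have "c *\<^sub>C hv = 0"
  proof (rule joint_eigenspaces_independent[where A = \<rho> and E = wspace and S = hC])
    show "c *\<^sub>C hv \<in> cvs.span (\<Union>\<nu>\<in>{\<lambda>H. lam H + \<mu> H | \<mu>. \<mu> \<in> dual_of hC \<and> \<mu> \<noteq> (\<lambda>_. 0)}. wspace \<nu>)"
    proof -
      have "(\<Union>\<mu>\<in>{\<mu> \<in> dual_of hC. \<mu> \<noteq> (\<lambda>_. 0)}. wspace (\<lambda>H. lam H + \<mu> H)) =
        (\<Union>\<nu>\<in>{\<lambda>H. lam H + \<mu> H | \<mu>. \<mu> \<in> dual_of hC \<and> \<mu> \<noteq> (\<lambda>_. 0)}. wspace \<nu>)" by blast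
      with assms show ?thesis by (simp add: lower_part_def)
    qed
    show "c *\<^sub>C hv \<in> wspace lam"
      using hv_weight by (simp add: wspace_def \<rho>_simps scaleC_scaleC mult.commute)
  qed (use \<rho>_linear dual_nonzero in \<open>auto simp: wspace_def\<close>)
  then show ?thesis using hv_nonzero by simp
qed

text \<open>N is thus a functional on the module, since it depends only on the vector \<Phi> a; the
  form constructed from N is well defined for this reason.\<close>

lemma N_kernel: "\<Phi> a = 0 \<Longrightarrow> N a = 0"
  using \<Phi>_N[of a] hv_lower_part[of "- N a"] by simp

lemma N_one: "N 1 = 1"
proof -
  have "(1 - N 1) *\<^sub>C hv \<in> lower_part"
    using \<Phi>_N[of 1] by (simp add: cvs.scale_left_diff_distrib scaleC_one flip: hv_def)
  then show ?thesis using hv_lower_part by fastforce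
qed

text \<open>The parity of a chosen \<open>beta\<close> value is unknown, so the argument goes
  through the module: for an odd monomial b of weight zero, \<Phi> b is a multiple of
  \<open>hv\<close> and also has the opposite parity.\<close>

lemma N_odd:
  assumes "a \<in> uea_part 1"
  shows "N a = 0"
proof -
  have "N b = 0" if b: "mon n 1 \<mu> b" for n \<mu> b
    using mon_U0_or_nonzero[OF b]
  proof
    assume "\<mu> = (\<lambda>_. 0) \<and> b \<in> U0 \<and> b \<in> borel_sum"
    then have "b \<in> U0" by simp
    then have "\<Phi> (b - beta hC P b) = 0" using beta_U0 \<Phi>_nplus by blast
    then have "\<Phi> b = \<Phi> (beta hC P b)" by (simp add: \<Phi>_simps)
    also have "\<dots> = N b *\<^sub>C hv" unfolding N_def by (rule is_eval_unique[OF is_eval_eval_at beta_cartan])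
    finally have Nb: "\<Phi> b = N b *\<^sub>C hv" .
    have "hv \<in> V d" using \<Phi>_part[OF uea_part_one] by (simp add: hv_def)
    then have "\<Phi> b \<in> V d" unfolding Nb by (rule cvs.subspace_scale[OF V_subspace])
    moreover have "\<Phi> b \<in> V (1 + d)" using mon_weight[OF b] \<Phi>_part by blast
    ultimately have "\<Phi> b = 0" using V_disjoint by (cases d) auto
    then show "N b = 0" by (rule N_kernel)
  next
    assume "b \<in> nonzero_part"
    then have "beta hC P b = beta hC P 0" by (simp add: beta_nonzero clinear_simps[OF beta_linear])
    then show "N b = 0" using N_linear(2)[of 0 0] by (simp add: N_def)
  qed
  moreover have "cvs.subspace {b. N b = 0}"
    using N_linear(2)[of 0 0] by (auto simp: cvs.subspace_def N_linear)
  ultimately have "cvs.span {b. \<exists>n \<mu>. mon n 1 \<mu> b} \<subseteq> {b. N b = 0}"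
    by (intro cvs.span_minimal) blast+
  then show ?thesis using uea_part_mon assms by blast
qed

lemma star_N:
  assumes "a \<in> uea_part p"
  shows "(- \<i>) ^ of_bool (p = 1) * eval_at hC lam (beta hC P (uea_adjoint g a * a)) = N (D a * a)"
proof -
  have "eval_at hC lam (beta hC P (uea_adjoint g a * a)) = (if p = 1 then \<i> else 1) * N (D a * a)"
    unfolding N_def[symmetric] uea_adjoint_eq star_part[OF assms] uea_scale_mult_left N_linear ..
  then show ?thesis by auto
qed

end

section \<open>From an invariant inner product to positivity of N\<close>

text \<open>The inner products of \<^const>\<open>unitary_rep\<close>, without the clause on orthogonality of the even
  and odd part.\<close>

locale unitary_highest_weight = highest_weight_module g h P V \<rho> lam \<Phi> d
  for g h and P :: "('g::lie_superalgebra \<Rightarrow> complex) set" and V :: "bit \<Rightarrow> 'v::complex_vector set"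
    and \<rho> lam \<Phi> d +
  fixes ip :: "'v \<Rightarrow> 'v \<Rightarrow> complex"
  assumes ip: "hermitian_product ip"
    and sym_even: "z \<in> g \<inter> hpart 0 \<Longrightarrow> symmetric_op ip (\<lambda>v. \<i> *\<^sub>C \<rho> z v)"
    and sym_odd: "x \<in> g \<inter> hpart 1 \<Longrightarrow> symmetric_op ip (\<lambda>v. exp (- (\<i> * pi / 4)) *\<^sub>C \<rho> x v)"
begin

lemma ip_left: "ip (u + v) w = ip u w + ip v w" "ip (c *\<^sub>C u) v = c * ip u v"
  using ip unfolding hermitian_product_def by blast+

lemma ip_herm: "ip u v = cnj (ip v u)"
  using ip unfolding hermitian_product_def by blast

lemma ip_right: "ip u (v + w) = ip u v + ip u w" "ip u (c *\<^sub>C v) = cnj c * ip u v"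
  unfolding ip_herm[of u "v + w"] ip_herm[of u "c *\<^sub>C v"] ip_herm[of u v] ip_herm[of u w] ip_left
  by simp_all

lemma ip_pos: "v \<noteq> 0 \<Longrightarrow> Re (ip v v) > 0"
  using ip unfolding hermitian_product_def by blast

lemma ip_zero: "ip 0 v = 0" "ip v 0 = 0"
  using ip_left(2)[of 0 0 v] ip_right(2)[of v 0 0] by simp_all

lemma ip_nonneg: "ip v v \<in> \<real>\<^sub>\<ge>\<^sub>0"
proof (cases "v = 0")
  case False
  have "Im (ip v v) = 0" using arg_cong[OF ip_herm[of v v], of Im] by simp
  then show ?thesis using ip_pos[OF False] by (simp add: complex_nonneg_Reals_iff)
qed (simp add: ip_zero)

lemma ip_adjoint: "ip (\<rho> x u) w = ip u (\<rho> (\<theta> x) w)"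
proof -
  have real: "ip (\<rho> x u) w = ip u (\<rho> (\<theta> x) w)" if x: "x \<in> g \<inter> hpart p" for x p
  proof (cases p)
    case zero
    then have "\<i> * ip (\<rho> x u) w = - \<i> * ip u (\<rho> x w)"
      using sym_even[of x] x by (auto simp: symmetric_op_def ip_left ip_right)
    then have "\<i> * ip (\<rho> x u) w = \<i> * - ip u (\<rho> x w)" by simp
    then have "ip (\<rho> x u) w = - ip u (\<rho> x w)" by (simp only: mult_cancel_left) simp
    moreover have "\<theta> x = (- 1) *\<^sub>C x" using x zero by (auto simp: \<theta>_hom[of x 0] sg_def cj_real)
    ultimately show ?thesis by (simp only: \<rho>_left ip_right) simp
  next
    case one
    let ?w = "exp (- (\<i> * complex_of_real pi / 4))"
    \<comment> \<open>The phase satisfies \<open>cnj ?w = ?w * \<i>\<close>, so symmetry of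
      \<open>?w\<close> times the action of x says that the adjoint of that action is -i times it.
      This is the origin of the factor \<open>- \<i>\<close> in \<open>sg\<close>.\<close>
    have "?w = cis (- (pi / 4))" by (simp add: cis_conv_exp)
    moreover have "cis (- (pi / 4)) * \<i> = cis (pi / 4)"
      by (simp add: cis_mult flip: cis_pi_half)
    ultimately have w: "cnj ?w = ?w * \<i>" by (simp add: cis_cnj)
    have "?w * ip (\<rho> x u) w = cnj ?w * ip u (\<rho> x w)"
      using sym_odd[of x] x one by (auto simp: symmetric_op_def ip_left ip_right)
    then have "?w * ip (\<rho> x u) w = ?w * (\<i> * ip u (\<rho> x w))" unfolding w by (simp only: mult.assoc)
    then have "ip (\<rho> x u) w = \<i> * ip u (\<rho> x w)" by (simp only: mult_cancel_left) simp
    moreover have "\<theta> x = (- \<i>) *\<^sub>C x" using x one by (auto simp: \<theta>_hom[of x 1] sg_def cj_real)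
    ultimately show ?thesis by (simp only: \<rho>_left ip_right) simp
  qed
  have hom: "ip (\<rho> x u) w = ip u (\<rho> (\<theta> x) w)" if "x \<in> hpart p" for x p
  proof -
    have "x \<in> cvs.span (g \<inter> hpart p)" using that hpart_span_real by blast
    then show ?thesis
    proof (induction rule: cvs.span_induct_alt)
      case base
      show ?case using \<theta>_scale[of 0 0] by (simp add: \<rho>_left ip_zero)
    next
      case (step c x y)
      then show ?case using real[OF step(1)]
        by (simp add: \<rho>_left \<theta>_add \<theta>_scale ip_left ip_right)
    qed
  qed
  have "ip (\<rho> (hproj 0 x + hproj 1 x) u) w = ip u (\<rho> (\<theta> (hproj 0 x + hproj 1 x)) w)"
    by (simp add: \<rho>_left \<theta>_add ip_left ip_right hom[OF hproj_in])
  then show ?thesis by (simp flip: hproj_sum)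
qed

text \<open>The element b is general in the induction because \<open>D\<close> reverses products:
  the image of a new first factor of a ends up next to b.\<close>

lemma ip_\<Phi>: "ip (\<Phi> (a * c)) (\<Phi> b) = ip (\<Phi> c) (\<Phi> (D a * b))"
proof -
  have "a \<in> {a. \<forall>b. ip (\<Phi> (a * c)) (\<Phi> b) = ip (\<Phi> c) (\<Phi> (D a * b))}"
  proof (rule uea_gen_induct)
    show "cvs.subspace {a. \<forall>b. ip (\<Phi> (a * c)) (\<Phi> b) = ip (\<Phi> c) (\<Phi> (D a * b))}"
      using dag.ext_scale[of 0 0]
      by (auto simp: cvs.subspace_def distrib_right uea_scale_mult_left \<Phi>_simps ip_left ip_right
          dag.ext_add dag.ext_scale ip_zero)
    fix x a assume a: "a \<in> {a. \<forall>b. ip (\<Phi> (a * c)) (\<Phi> b) = ip (\<Phi> c) (\<Phi> (D a * b))}"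
    have "ip (\<Phi> (uea_gen x * a * c)) (\<Phi> b) = ip (\<Phi> c) (\<Phi> (D (uea_gen x * a) * b))" for b
    proof -
      have "ip (\<Phi> (uea_gen x * a * c)) (\<Phi> b) = ip (\<Phi> (a * c)) (\<Phi> (uea_gen (\<theta> x) * b))"
        by (simp add: mult.assoc \<Phi>_gen ip_adjoint)
      then show ?thesis using a by (simp add: dag.ext_mult dag.ext_gen mult.assoc)
    qed
    then show "uea_gen x * a \<in> {a. \<forall>b. ip (\<Phi> (a * c)) (\<Phi> b) = ip (\<Phi> c) (\<Phi> (D a * b))}" by simp
  qed (simp add: dag.ext_one)
  then show ?thesis by simp
qed

text \<open>Elements of the real torus act by skew-hermitian operators, and \<open>hv\<close> is an
  eigenvector of nonzero length.\<close>

lemma lam_imaginary: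
  assumes "H \<in> h"
  shows "cnj (lam H) = - lam H" "ip (\<rho> H u) w = - ip u (\<rho> H w)"
proof -
  have H: "H \<in> g" "H \<in> hpart 0" using h_real assms by auto
  have "\<theta> H = - H" using \<theta>_hom[OF H(2)] cj_real[OF H(1)] by (simp add: sg_def scaleC_one)
  then show *: "ip (\<rho> H u) w = - ip u (\<rho> H w)" for u w
    using ip_right(2)[of u "- 1" "\<rho> H w"] by (simp add: ip_adjoint \<rho>_left scaleC_one)
  have "\<rho> H hv = lam H *\<^sub>C hv" using hv_weight assms by (simp add: wspace_def cvs.span_base)
  then have "lam H * ip hv hv = - cnj (lam H) * ip hv hv"
    using *[of hv hv] by (simp add: ip_left ip_right)
  moreover have "ip hv hv \<noteq> 0" using ip_pos[OF hv_nonzero] by auto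
  ultimately have "lam H = - cnj (lam H)" by (simp only: mult_cancel_right) simp
  then show "cnj (lam H) = - lam H" by (metis minus_minus)
qed

lemma ip_lower_part:
  assumes "w \<in> lower_part"
  shows "ip hv w = 0"
  using assms unfolding lower_part_def
proof (induction rule: cvs.span_induct_alt)
  case base
  show ?case by (simp add: ip_zero)
next
  case (step c x y)
  then obtain \<mu> where \<mu>: "\<mu> \<in> dual_of hC" "\<mu> \<noteq> (\<lambda>_. 0)" "x \<in> wspace (\<lambda>H. lam H + \<mu> H)" by blast
  \<comment> \<open>Skewness holds on h itself, so the two weights must be separated by an element
    of h; one exists because h spans \<open>hC\<close>.\<close>
  have "\<exists>H\<in>h. \<mu> H \<noteq> 0"
  proof (rule ccontr)
    assume "\<not> ?thesis"
    then have 0: "\<mu> H = 0" if "H \<in> h" for H using that by blast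
    have lin: "\<mu> (H + K) = \<mu> H + \<mu> K" "\<mu> (c *\<^sub>C H) = c * \<mu> H" if "H \<in> hC" "K \<in> hC" for H K c
      using \<mu>(1) that by (auto simp: dual_of_def)
    have "H \<in> hC \<and> \<mu> H = 0" if "H \<in> hC" for H
      using that
    proof (induction rule: cvs.span_induct_alt)
      case base
      show ?case using lin(2)[of 0 0 0] by (simp add: cvs.span_zero)
    next
      case (step c x y)
      have "x \<in> hC" using step by (simp add: cvs.span_base)
      then show ?case using step 0
        by (simp add: lin cvs.span_scale cvs.span_add)
    qed
    then show False using dual_nonzero[OF \<mu>(1,2)] by blast
  qed
  then obtain H where H: "H \<in> h" "\<mu> H \<noteq> 0" by blast
  have "\<rho> H hv = lam H *\<^sub>C hv" "\<rho> H x = (lam H + \<mu> H) *\<^sub>C x"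
    using hv_weight \<mu>(3) H by (simp_all add: wspace_def cvs.span_base)
  then have "lam H * ip hv x = - (cnj (lam H + \<mu> H) * ip hv x)"
    using lam_imaginary(2)[OF H(1), of hv x] by (simp add: ip_left ip_right)
  then have "cnj (\<mu> H) * ip hv x = 0"
    using lam_imaginary(1)[OF H(1)] by (simp add: algebra_simps)
  then have "ip hv x = 0" using H by simp
  with step show ?case by (simp add: ip_right)
qed

lemma ip_hv_\<Phi>: "ip hv (\<Phi> a) = cnj (N a) * ip hv hv"
proof -
  have "ip hv ((\<Phi> a - N a *\<^sub>C hv) + N a *\<^sub>C hv) = cnj (N a) * ip hv hv"
    by (simp only: ip_right ip_lower_part[OF \<Phi>_N]) simp
  then show ?thesis by simp
qed

lemma N_nonneg: "N (D a * a) \<in> \<real>\<^sub>\<ge>\<^sub>0"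
proof -
  have "ip (\<Phi> a) (\<Phi> a) = ip hv (\<Phi> (D a * a))"
    using ip_\<Phi>[of a 1 a] by (simp add: hv_def)
  then have eq: "ip (\<Phi> a) (\<Phi> a) = cnj (N (D a * a)) * ip hv hv" by (simp add: ip_hv_\<Phi>)
  have 0: "ip hv hv \<noteq> 0" using ip_pos[OF hv_nonzero] by auto
  then have "cnj (N (D a * a)) = ip (\<Phi> a) (\<Phi> a) / ip hv hv" using eq by simp
  also have "\<dots> \<in> \<real>\<^sub>\<ge>\<^sub>0" by (intro nonneg_Reals_divide_I ip_nonneg)
  finally show ?thesis by (simp add: complex_nonneg_Reals_iff)
qed

end

section \<open>From positivity of N to an invariant inner product\<close>

context highest_weight_module
begin

text \<open>Of the two homogeneous components of any preimage, the one of the wrong parity maps into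
  the intersection of the even and odd parts, hence to zero.\<close>

lemma V_lift:
  assumes "w \<in> V p"
  obtains a where "a \<in> uea_part (p + d)" "\<Phi> a = w"
proof -
  obtain a' where a': "\<Phi> a' = w" using \<Phi>_surj by (metis surjD)
  obtain b c where bc: "b \<in> uea_part (p + d)" "c \<in> uea_part (p + d + 1)" "a' = b + c"
    using uea_part_decomp[of a'] by (cases "p + d") (metis add.commute add_0 bit_add_self(1))+
  have V: "\<Phi> b \<in> V p" "\<Phi> c \<in> V (p + 1)"
    using \<Phi>_part[OF bc(1)] \<Phi>_part[OF bc(2)] by (simp_all add: ac_simps)
  have "\<Phi> b + \<Phi> c = w" using a' bc by (simp add: \<Phi>_simps)
  then have "\<Phi> c = w - \<Phi> b" by (metis add_diff_cancel_left')
  then have "\<Phi> c \<in> V p" using assms V by (simp add: cvs.subspace_diff[OF V_subspace])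
  with V have "\<Phi> c = 0" using V_disjoint by (cases p) auto
  with a' bc that show ?thesis by (simp add: \<Phi>_simps)
qed

text \<open>The form \<open>\<langle>a v, b v\<rangle> = N(b\<^sup>\<dagger> a)\<close>, where \<open>b\<^sup>\<dagger>\<close> is the image of \<open>b\<close> under the anti-automorphism.\<close>

context
  assumes N_nonneg: "\<And>p a. a \<in> uea_part p \<Longrightarrow> N (D a * a) \<in> \<real>\<^sub>\<ge>\<^sub>0"
begin

definition form :: "'g uea \<Rightarrow> 'g uea \<Rightarrow> complex" where "form a b = N (D b * a)"

lemma form_left: "form (a + b) c = form a c + form b c" "form (s *\<^sub>C a) c = s * form a c"
  by (simp_all add: form_def distrib_left uea_scale_mult_right N_linear)

lemma form_right: "form a (b + c) = form a b + form a c" "form a (s *\<^sub>C b) = cnj s * form a b"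
  by (simp_all add: form_def distrib_right uea_scale_mult_left N_linear dag.ext_add dag.ext_scale)

lemma form_parity:
  assumes "a \<in> uea_part p" "b \<in> uea_part (p + 1)"
  shows "form a b = 0" "form b a = 0"
proof -
  have "D b * a \<in> uea_part (p + 1 + p)" "D a * b \<in> uea_part (p + (p + 1))"
    using assms by (blast intro: uea_part_mult D_part)+
  then have "D b * a \<in> uea_part 1" "D a * b \<in> uea_part 1" by (simp_all add: ac_simps)
  then show "form a b = 0" "form b a = 0" by (simp_all add: form_def N_odd)
qed

text \<open>Positivity is assumed for homogeneous elements; it extends to all because the mixed
  terms are values of N on odd elements and vanish.\<close>

lemma form_nonneg: "form a a \<in> \<real>\<^sub>\<ge>\<^sub>0"
proof -
  obtain b c where bc: "b \<in> uea_part 0" "c \<in> uea_part 1" "a = b + c"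
    using uea_part_decomp by blast
  have "form b c = 0" "form c b = 0" using form_parity[of b 0 c] bc by simp_all
  then have "form a a = form b b + form c c" by (simp add: bc form_left form_right)
  also have "\<dots> \<in> \<real>\<^sub>\<ge>\<^sub>0"
    unfolding form_def using bc N_nonneg by (blast intro: nonneg_Reals_add_I)
  finally show ?thesis .
qed

lemma form_herm: "form a b = cnj (form b a)"
proof -
  have Im: "Im (form c c) = 0" for c using form_nonneg[of c] by (simp add: complex_nonneg_Reals_iff)
  show ?thesis
    \<comment> \<open>The element \<open>a + b\<close> compares the imaginary parts of
      \<open>form a b\<close> and \<open>form b a\<close>, and \<open>a + \<i> *\<^sub>C b\<close>
      their real parts.\<close>
    using Im[of "a + b"] Im[of "a + \<i> *\<^sub>C b"] Im[of a] Im[of b]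
    by (simp add: form_left form_right complex_eq_iff)
qed

lemma form_kernel: "\<Phi> a = 0 \<Longrightarrow> form a b = 0" "\<Phi> a = 0 \<Longrightarrow> form b a = 0"
  using form_herm[of b a] by (simp_all add: form_def N_kernel \<Phi>_left_zero)

lemma form_null:
  assumes "form a a = 0"
  shows "form a b = 0"
proof (rule ccontr)
  assume "form a b \<noteq> 0"
  \<comment> \<open>With this choice the squared length of \<open>b + s *\<^sub>C a\<close> has real
    part -Re (form b b) - 2, which is negative.\<close>
  define r where "r = (Re (form b b) + 1) / (cmod (form a b))\<^sup>2"
  define s where "s = - of_real r * cnj (form a b)"
  have "form b a = cnj (form a b)" by (rule form_herm)
  then have "form (b + s *\<^sub>C a) (b + s *\<^sub>C a) = form b b - 2 * of_real r * (form a b * cnj (form a b))"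
  proof -
    assume ba: "form b a = cnj (form a b)"
    have "form (b + s *\<^sub>C a) (b + s *\<^sub>C a) = form b b + cnj s * form b a + s * form a b"
      by (simp add: form_left form_right assms)
    then show ?thesis by (simp add: ba s_def)
  qed
  also have "form a b * cnj (form a b) = of_real ((cmod (form a b))\<^sup>2)"
    by (rule complex_norm_square[symmetric])
  finally have "Re (form (b + s *\<^sub>C a) (b + s *\<^sub>C a)) = Re (form b b) - 2 * (r * (cmod (form a b))\<^sup>2)"
    by simp
  also have "r * (cmod (form a b))\<^sup>2 = Re (form b b) + 1"
    using \<open>form a b \<noteq> 0\<close> by (simp add: r_def)
  finally show False
    using form_nonneg[of "b + s *\<^sub>C a"] form_nonneg[of b] by (simp add: complex_nonneg_Reals_iff)
qed

definition vform :: "'v \<Rightarrow> 'v \<Rightarrow> complex" where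
  "vform u w = form (inv \<Phi> u) (inv \<Phi> w)"

lemma vform_\<Phi>: "vform (\<Phi> a) (\<Phi> b) = form a b"
proof -
  have k: "\<Phi> (inv \<Phi> (\<Phi> c) - c) = 0" for c by (simp add: \<Phi>_simps surj_f_inv_f[OF \<Phi>_surj])
  have "form (inv \<Phi> (\<Phi> a) - a + a) c = form a c" for c
    by (simp only: form_left form_kernel[OF k]) simp
  moreover have "form c (inv \<Phi> (\<Phi> b) - b + b) = form c b" for c
    by (simp only: form_right form_kernel[OF k]) simp
  ultimately show ?thesis by (simp add: vform_def)
qed

lemma vform_left: "vform (u + v) w = vform u w + vform v w" "vform (s *\<^sub>C u) w = s * vform u w"
proof -
  obtain a b c where "u = \<Phi> a" "v = \<Phi> b" "w = \<Phi> c" using \<Phi>_surj by (metis surjD)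
  then show "vform (u + v) w = vform u w + vform v w" "vform (s *\<^sub>C u) w = s * vform u w"
    by (simp_all add: vform_\<Phi> form_left flip: \<Phi>_simps)
qed

lemma vform_herm: "vform u w = cnj (vform w u)"
  unfolding vform_def by (rule form_herm)

lemma vform_right: "vform u (v + w) = vform u v + vform u w" "vform u (s *\<^sub>C w) = cnj s * vform u w"
  unfolding vform_herm[of u "v + w"] vform_herm[of u "s *\<^sub>C w"] vform_herm[of u v] vform_herm[of u w]
    vform_left by simp_all

text \<open>Since \<open>\<theta>\<close> is an involution, D maps \<theta>(x) b to D(b) x, so x can
  be read as part of either argument of the form.\<close>

lemma vform_adjoint: "vform (\<rho> x u) w = vform u (\<rho> (\<theta> x) w)"
proof -
  obtain a b where ab: "u = \<Phi> a" "w = \<Phi> b" using \<Phi>_surj by (metis surjD)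
  show ?thesis
    unfolding ab \<Phi>_gen[symmetric] vform_\<Phi>
    by (simp add: form_def dag.ext_mult dag.ext_gen \<theta>_\<theta> mult.assoc)
qed

lemma vform_parity: "u \<in> V p \<Longrightarrow> w \<in> V (p + 1) \<Longrightarrow> vform u w = 0"
proof -
  assume u: "u \<in> V p" and w: "w \<in> V (p + 1)"
  obtain a where a: "a \<in> uea_part (p + d)" "\<Phi> a = u" using V_lift[OF u] .
  obtain b where b: "b \<in> uea_part (p + 1 + d)" "\<Phi> b = w" using V_lift[OF w] .
  have "form a b = 0" using form_parity(1)[of a "p + d" b] a b by (simp add: ac_simps)
  then show "vform u w = 0" using vform_\<Phi>[of a b] a b by simp
qed

definition radical :: "'v set" where "radical = {w. \<forall>u. vform w u = 0}"

lemma radical_zero: "radical = {0}"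
proof -
  have z: "vform 0 u = 0" for u using vform_left(2)[of 0 0 u] by simp
  have "cvs.subspace radical"
    by (auto simp: radical_def cvs.subspace_def vform_left z)
  \<comment> \<open>Irreducibility speaks about graded submodules. Pairing a null vector with
    homogeneous vectors shows that each of its two components is null.\<close>
  moreover have "is_graded V radical"
    unfolding is_graded_def
  proof
    fix w assume w: "w \<in> radical"
    have ss: "\<exists>y\<in>V 0. \<exists>z\<in>V 1. x = y + z" for x
      using rep by (auto simp: representation_def superspace_def)
    obtain y z where yz: "y \<in> V 0" "z \<in> V 1" "w = y + z" using ss by blast
    have "vform y u = 0 \<and> vform z u = 0" for u
    proof -
      obtain u0 u1 where u: "u0 \<in> V 0" "u1 \<in> V 1" "u = u0 + u1" using ss by blast
      have "vform y u1 = 0" "vform z u0 = 0"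
        using vform_parity[of y 0 u1] vform_parity[of z 1 u0] yz u by simp_all
      moreover have "vform (y + z) u0 = 0" "vform (y + z) u1 = 0"
        using w yz by (auto simp: radical_def)
      ultimately show ?thesis by (simp add: u vform_left vform_right)
    qed
    then show "\<exists>y\<in>radical \<inter> V 0. \<exists>z\<in>radical \<inter> V 1. w = y + z"
      using yz by (auto simp: radical_def)
  qed
  moreover have "\<rho> x w \<in> radical" if "w \<in> radical" for x w
    using that by (simp add: radical_def vform_adjoint)
  ultimately have "radical = {0} \<or> radical = UNIV"
    using irred unfolding irreducible_rep_def by blast
  moreover have "vform hv hv = 1"
    by (simp add: hv_def vform_\<Phi> form_def dag.ext_one N_one)
  then have "hv \<notin> radical" by (auto simp: radical_def intro: exI[of _ hv])
  ultimately show ?thesis by blast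
qed

lemma unitary_if_nonneg: "unitary_rep g V \<rho>"
  unfolding unitary_rep_def
proof (intro exI[of _ vform] conjI ballI)
  show "hermitian_product vform"
    unfolding hermitian_product_def
  proof (intro conjI allI impI)
    fix w :: 'v assume "w \<noteq> 0"
    obtain a where a: "w = \<Phi> a" using \<Phi>_surj by (metis surjD)
    show "Re (vform w w) > 0"
    proof (rule ccontr)
      assume "\<not> Re (vform w w) > 0"
      then have "form a a = 0"
        using form_nonneg[of a] by (auto simp: a vform_\<Phi> complex_nonneg_Reals_iff complex_eq_iff)
      then have "vform w (\<Phi> b) = 0" for b by (simp add: a vform_\<Phi> form_null)
      then have "vform w u = 0" for u using surjD[OF \<Phi>_surj, of u] by blast
      then have "w \<in> radical" by (simp add: radical_def)
      with \<open>w \<noteq> 0\<close> show False by (simp add: radical_zero)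
    qed
  qed (rule vform_left vform_herm)+
  show "vform u w = 0" if "u \<in> V 0" "w \<in> V 1" for u w
    using vform_parity[of u 0 w] that by simp
  show "symmetric_op vform (\<lambda>v. \<i> *\<^sub>C \<rho> z v)" if "z \<in> g \<inter> hpart 0" for z
  proof -
    have \<theta>z: "\<theta> z = (- 1) *\<^sub>C z" using that by (auto simp: \<theta>_hom[of z 0] sg_def cj_real)
    show ?thesis
      unfolding symmetric_op_def vform_left(2) vform_right(2) vform_adjoint \<theta>z \<rho>_left(2)
      by simp
  qed
  show "symmetric_op vform (\<lambda>v. exp (- (\<i> * complex_of_real pi / 4)) *\<^sub>C \<rho> x v)" (is "symmetric_op _ (\<lambda>v. ?w *\<^sub>C _)")
    if "x \<in> g \<inter> hpart 1" for x
  proof -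
    have "?w = cis (- (pi / 4))" by (simp add: cis_conv_exp)
    moreover have "cis (- (pi / 4)) * \<i> = cis (pi / 4)"
      by (simp add: cis_mult flip: cis_pi_half)
    ultimately have w: "cnj ?w = ?w * \<i>" by (simp add: cis_cnj)
    have \<theta>x: "\<theta> x = (- \<i>) *\<^sub>C x" using that by (auto simp: \<theta>_hom[of x 1] sg_def cj_real)
    show ?thesis
      unfolding symmetric_op_def vform_left(2) vform_right(2) vform_adjoint \<theta>x \<rho>_left(2) w
      by simp
  qed
qed

end

end

section \<open>Coroots\<close>

context real_form_algebra
begin

lemma ri_span:
  assumes S: "rvs.subspace S" "S \<subseteq> g" and x: "x \<in> cvs.span S"
  shows "rpart x \<in> S" "ipart x \<in> S"
proof -
  have real: "rpart y = y" "ipart y = 0" if "y \<in> S" for y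
    using ri_eqI[of y 0 y] that S(2) rvs.subspace_0[OF g_subspace] by auto
  have "rpart x \<in> S \<and> ipart x \<in> S"
    using x
  proof (induction rule: cvs.span_induct_alt)
    case base
    show ?case using real[OF rvs.subspace_0[OF S(1)]] by (simp add: rvs.subspace_0[OF S(1)])
  next
    case (step c x y)
    then show ?case
      by (simp add: ri_add ri_scale real rvs.subspace_add[OF S(1)] rvs.subspace_diff[OF S(1)]
          rvs.subspace_scale[OF S(1)])
  qed
  then show "rpart x \<in> S" "ipart x \<in> S" by simp_all
qed

end

text \<open>The even projection fixes p0 and kills the odd generators.\<close>

lemma p_complex_even:
  assumes "x \<in> p_complex g p0" "x \<in> hpart 0" "p0 \<subseteq> hpart 0"
  shows "x \<in> cvs.span p0"
proof -
  have "hproj 0 x \<in> cvs.span p0"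
    using assms(1) unfolding p_complex_def
  proof (induction rule: cvs.span_induct_alt)
    case base
    show ?case by (simp add: hproj_id hpart_zero cvs.span_zero)
  next
    case (step c x y)
    then have "hproj 0 x \<in> cvs.span p0"
      using assms(3) by (auto simp: hproj_id hproj_other subset_iff cvs.span_zero intro: cvs.span_base)
    with step show ?case by (simp add: hproj_add hproj_scale cvs.span_add cvs.span_scale)
  qed
  then show ?thesis by (simp add: hproj_id assms(2))
qed

lemma brk_even_self: "x \<in> hpart 0 \<Longrightarrow> brk x x = 0"
proof -
  assume "x \<in> hpart 0"
  then have "brk x x = - brk x x" by (rule brk_even_skew)
  then have "brk x x + brk x x = 0" by (metis add.right_inverse)
  then have "2 *\<^sub>C brk x x = 0" using scaleC_add_left[of 1 1 "brk x x"] by (simp add: scaleC_one)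
  then show ?thesis by simp
qed

context torus
begin

text \<open>On the real torus the values of a root are eigenvalues of skew operators.\<close>

lemma root_imaginary:
  assumes "\<alpha> \<in> roots hC" "H \<in> h"
  shows "\<alpha> H = \<i> * of_real (Im (\<alpha> H))"
proof -
  have "0 \<in> root_space hC \<alpha>" by (simp add: root_space_def brk_right)
  then obtain x where x: "x \<in> root_space hC \<alpha>" "x \<noteq> 0" using assms by (auto simp: roots_def)
  obtain R where "skew_operator (brk H) R" using brk_skew_operator assms(2) by metis
  then have "Re (\<alpha> H) = 0"
    using x assms(2) by (intro skew_operator.eigenvalue_imaginary[of "brk H" R x])
      (auto simp: root_space_def cvs.span_base)
  then show ?thesis by (simp add: complex_eq_iff)
qed

lemma dual_linear:
  assumes "\<alpha> \<in> dual_of hC" "H \<in> hC"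
  shows "K \<in> hC \<Longrightarrow> \<alpha> (H + K) = \<alpha> H + \<alpha> K" "\<alpha> (c *\<^sub>C H) = c * \<alpha> H"
  using assms by (auto simp: dual_of_def)

text \<open>Conjugating the eigenvalue equation for real H turns \<alpha>(H) into its conjugate,
  which is -\<alpha>(H). The form is only assumed imaginary on h, rather than a root, so that the
  lemma also applies to -\<alpha>.\<close>

lemma cj_root_space:
  assumes "\<alpha> \<in> dual_of hC" "\<And>H. H \<in> h \<Longrightarrow> \<alpha> H = \<i> * of_real (Im (\<alpha> H))" "x \<in> root_space hC \<alpha>"
  shows "cj x \<in> root_space hC (\<lambda>H. - \<alpha> H)"
proof -
  have real: "brk H (cj x) = - \<alpha> H *\<^sub>C cj x" if "H \<in> h" for H
  proof -
    have "brk H (cj x) = cj (brk H x)" using cj_real[of H] that h_real by (auto simp: cj_brk)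
    also have "\<dots> = cnj (\<alpha> H) *\<^sub>C cj x"
      using assms(3) that by (simp add: root_space_def cvs.span_base cj_scale)
    also have "cnj (\<alpha> H) = - \<alpha> H" using assms(2)[OF that] by (simp add: complex_eq_iff)
    finally show ?thesis .
  qed
  have "H \<in> hC \<and> brk H (cj x) = - \<alpha> H *\<^sub>C cj x" if "H \<in> hC" for H
    using that
  proof (induction rule: cvs.span_induct_alt)
    case base
    show ?case using dual_linear(2)[OF assms(1) cvs.span_zero, of 0] by (simp add: brk_left cvs.span_zero)
  next
    case (step c H K)
    then have H: "H \<in> hC" by (simp add: cvs.span_base)
    have "brk (c *\<^sub>C H + K) (cj x) = (- (c * \<alpha> H) - \<alpha> K) *\<^sub>C cj x"
      using step by (simp add: brk_left real scaleC_scaleC cvs.scale_left_diff_distrib)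
    then show ?case
      using step H by (simp add: dual_linear[OF assms(1)] cvs.span_scale cvs.span_add)
  qed
  then show ?thesis by (simp add: root_space_def)
qed

text \<open>An imaginary eigenvalue makes ad H an infinitesimal rotation of the real and imaginary
  parts of x.\<close>

lemma ri_eigen:
  assumes "brk H x = (\<i> * of_real a) *\<^sub>C x" "H \<in> g"
  shows "brk H (rpart x) = scaleRC (- a) (ipart x)" "brk H (ipart x) = scaleRC a (rpart x)"
proof -
  have H: "rpart H = H" "ipart H = 0"
    using ri_eqI[of H 0 H] assms(2) rvs.subspace_0[OF g_subspace] by auto
  have "rpart (brk H x) = scaleRC (- a) (ipart x)" "ipart (brk H x) = scaleRC a (rpart x)"
    unfolding assms(1) ri_scale by (simp_all add: scaleRC_def)
  then show "brk H (rpart x) = scaleRC (- a) (ipart x)" "brk H (ipart x) = scaleRC a (rpart x)"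
    by (simp_all add: ri_brk H brk_left)
qed

text \<open>The coroot is computed from the real invariant form alone: for \<open>x = p + i q\<close> in the root space,
  \<open>[x, x\<^sup>\<sigma>] = -2i [p, q]\<close>, and \<open>B([p, q], H) = i \<alpha>(H) B(p, p)\<close> on the real Cartan subalgebra determines
  the sign of \<open>\<alpha>([x, x\<^sup>\<sigma>])\<close>.\<close>

lemma coroot_of_even_root:
  assumes \<alpha>: "\<alpha> \<in> roots hC"
    and S: "rvs.subspace S" "S \<subseteq> g \<inter> hpart 0" "root_space hC \<alpha> \<subseteq> cvs.span S"
    and B: "symm_bilinear_on (g \<inter> hpart 0) B"
    and inv: "\<And>x y z. x \<in> g \<inter> hpart 0 \<Longrightarrow> y \<in> g \<inter> hpart 0 \<Longrightarrow> z \<in> g \<inter> hpart 0 \<Longrightarrow>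
        B (brk x y) z = B x (brk y z)"
    and neg: "\<And>H. H \<in> h \<Longrightarrow> H \<noteq> 0 \<Longrightarrow> B H H < 0"
    and sgn: "\<And>x. x \<in> S \<Longrightarrow> x \<noteq> 0 \<Longrightarrow> e * B x x > 0"
  shows "\<exists>x r. x \<in> root_space hC \<alpha> \<and> x \<in> hpart 0 \<and> e * r > 0 \<and> brk x (cj x) \<in> hC \<and>
    coroot hC \<alpha> = of_real r *\<^sub>C brk x (cj x)"
proof -
  let ?g0 = "g \<inter> hpart 0"
  have g0: "rvs.subspace ?g0"
    using rvs.subspace_inter[OF g_subspace, of "hpart 0"]
    by (auto simp: rvs.subspace_def hpart_zero hpart_add hpart_scale scaleRC_def)
  have Bs: "B x y = B y x" "B (x + y) z = B x z + B y z" "B (scaleRC r x) y = r * B x y"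
    "B (x - y) z = B x z - B y z" "B x (scaleRC r y) = r * B x y" "B 0 x = 0" "B x (- y) = - B x y"
    if "x \<in> ?g0" "y \<in> ?g0" "z \<in> ?g0" for x y z r
  proof -
    have sym: "B x y = B y x" if "x \<in> ?g0" "y \<in> ?g0" for x y
      using B that by (auto simp: symm_bilinear_on_def)
    have add: "B (x + y) z = B x z + B y z" if "x \<in> ?g0" "y \<in> ?g0" "z \<in> ?g0" for x y z
      using B that by (auto simp: symm_bilinear_on_def)
    have scale: "B (scaleRC r x) y = r * B x y" if "x \<in> ?g0" "y \<in> ?g0" for x y r
      using B that by (auto simp: symm_bilinear_on_def)
    show "B x y = B y x" "B (x + y) z = B x z + B y z" "B (scaleRC r x) y = r * B x y"
      using sym add scale that by blast+
    show "B (x - y) z = B x z - B y z"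
      using add[OF rvs.subspace_diff[OF g0 that(1,2)] that(2,3)] by simp
    show r: "B x (scaleRC r y) = r * B x y" for r
      using sym[OF that(1) rvs.subspace_scale[OF g0 that(2)]] scale[OF that(2,1)] sym[OF that(1,2)] by simp
    show "B 0 x = 0" using scale[OF that(1,1), of 0] by (simp add: scaleRC_def)
    show "B x (- y) = - B x y" using r[of "- 1"] by (simp add: scaleRC_def scaleC_one)
  qed
  have dual: "\<alpha> \<in> dual_of hC" "\<alpha> \<noteq> (\<lambda>_. 0)" using \<alpha> by (auto simp: roots_def)
  define a where "a H = Im (\<alpha> H)" for H
  have a: "\<alpha> H = \<i> * of_real (a H)" if "H \<in> h" for H
    using root_imaginary[OF \<alpha> that] by (simp add: a_def)
  have hg: "H \<in> ?g0" if "H \<in> h" for H using that h_real by blast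
  have hC_ri: "rpart H \<in> h" "ipart H \<in> h" if "H \<in> hC" for H
    using ri_span[OF h_subspace _ that] h_real by auto
  have \<alpha>_hC: "\<alpha> H = \<i> * of_real (a (rpart H)) - of_real (a (ipart H))" if "H \<in> hC" for H
  proof -
    have "rpart H \<in> hC" "ipart H \<in> hC" using hC_ri[OF that] by (auto intro: cvs.span_base)
    then have "\<alpha> (rpart H + \<i> *\<^sub>C ipart H) = \<alpha> (rpart H) + \<i> * \<alpha> (ipart H)"
      by (simp add: dual_linear[OF dual(1)] cvs.span_scale)
    then show ?thesis using a[OF hC_ri(1)[OF that]] a[OF hC_ri(2)[OF that]] by (simp flip: ri_sum)
  qed
  have even: "root_space hC \<alpha> \<subseteq> hpart 0"
    using S cvs.span_minimal[OF _ hpart_subspace, of S 0] by blast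
  have ri_g0: "rpart x \<in> ?g0" "ipart x \<in> ?g0" if "x \<in> hpart 0" for x
    using ri_in ri_hpart[OF that] by auto
  have bracket: "brk x y \<in> hC" if x: "x \<in> root_space hC \<alpha>" and y: "y \<in> root_space hC (\<lambda>H. - \<alpha> H)" for x y
  proof (rule zero_weight)
    fix H assume H: "H \<in> hC"
    have "brk H (brk x y) = brk (brk H x) y + brk x (brk H y)"
      using H hC_even x even by (intro brk_even_jacobi) auto
    then show "brk H (brk x y) = 0" using x y H by (simp add: root_space_def brk_left brk_right)
  qed
  let ?L = "cvs.span {brk x y | x y. x \<in> root_space hC \<alpha> \<and> y \<in> root_space hC (\<lambda>H. - \<alpha> H)}"
  \<comment> \<open>The coroot is defined by THE, so uniqueness is at stake. Real and imaginary
    parts of every combination of brackets pair with h as multiples of the single functional a,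
    which together with definiteness of B on h forces uniqueness.\<close>
  have L: "H \<in> hC \<and> (\<exists>s t. \<forall>H'\<in>h. B (rpart H) H' = s * a H' \<and> B (ipart H) H' = t * a H')"
    if "H \<in> ?L" for H
    using that
  proof (induction rule: cvs.span_induct_alt)
    case base
    have "rpart 0 = 0" "ipart 0 = 0" using ri_eqI[of 0 0 0] rvs.subspace_0[OF g_subspace] by auto
    then show ?case using Bs(6)[OF hg hg hg] by (auto simp: cvs.span_zero intro!: exI[of _ 0])
  next
    case (step c Z K)
    then obtain x y where xy: "Z = brk x y" "x \<in> root_space hC \<alpha>" "y \<in> root_space hC (\<lambda>H. - \<alpha> H)"
      by blast
    from step obtain s t where K: "K \<in> hC" "\<And>H'. H' \<in> h \<Longrightarrow> B (rpart K) H' = s * a H'"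
      "\<And>H'. H' \<in> h \<Longrightarrow> B (ipart K) H' = t * a H'" by blast
    have Z: "Z \<in> hC" unfolding xy(1) by (rule bracket[OF xy(2,3)])
    \<comment> \<open>Evenness is known for the root space of \<alpha>; conjugation carries it over
      to that of -\<alpha>.\<close>
    have "cj y \<in> root_space hC (\<lambda>H. - (- \<alpha> H))"
      using xy(3) dual a by (intro cj_root_space) (auto simp: dual_of_def)
    then have "cj y \<in> hpart 0" using even by auto
    then have "y \<in> hpart 0" using cj_hpart cj_cj by metis
    note gy = ri_g0[OF this]
    have x0: "x \<in> hpart 0" using xy even by blast
    note gx = ri_g0[OF x0]
    have br: "brk u w \<in> ?g0" if "u \<in> ?g0" "w \<in> ?g0" for u w
      using that g_brk brk_hpart[of u 0 w 0] by auto
    \<comment> \<open>Invariance moves H onto the parts of y, where ad H is a rotation with speed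
      -a(H); these are the coefficients of a(H) that remain.\<close>
    define s' where "s' = - (B (rpart x) (ipart y) + B (ipart x) (rpart y))"
    define t' where "t' = B (rpart x) (rpart y) - B (ipart x) (ipart y)"
    have st': "B (rpart Z) H = s' * a H \<and> B (ipart Z) H = t' * a H" if H: "H \<in> h" for H
    proof -
      have "brk H y = (\<i> * of_real (- a H)) *\<^sub>C y"
        using xy(3) H a[OF H] by (simp add: root_space_def cvs.span_base)
      from ri_eigen[OF this] have "brk H (rpart y) = scaleRC (a H) (ipart y)"
        "brk H (ipart y) = scaleRC (- a H) (rpart y)" using hg[OF H] by auto
      then have yH: "brk (rpart y) H = scaleRC (- a H) (ipart y)" "brk (ipart y) H = scaleRC (a H) (rpart y)"
        using brk_even_skew[of H "rpart y"] brk_even_skew[of H "ipart y"] hg[OF H]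
        by (simp_all add: brk_even_skew[of H] scaleRC_def)
      have "B (rpart Z) H = B (rpart x) (brk (rpart y) H) - B (ipart x) (brk (ipart y) H)"
        unfolding xy(1) ri_brk using hg[OF H] gx gy by (simp only: Bs(4) br inv)
      moreover have "B (ipart Z) H = B (rpart x) (brk (ipart y) H) + B (ipart x) (brk (rpart y) H)"
        unfolding xy(1) ri_brk using hg[OF H] gx gy by (simp only: Bs(2) br inv)
      ultimately show ?thesis
        unfolding yH using gx gy by (simp only: Bs(5) s'_def t'_def) (simp add: algebra_simps)
    qed
    have ZK: "rpart Z \<in> ?g0" "ipart Z \<in> ?g0" "rpart K \<in> ?g0" "ipart K \<in> ?g0"
      using hC_ri[OF Z] hC_ri[OF K(1)] hg by auto
    have "B (rpart (c *\<^sub>C Z + K)) H = (Re c * s' - Im c * t' + s) * a H \<and>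
        B (ipart (c *\<^sub>C Z + K)) H = (Im c * s' + Re c * t' + t) * a H" if H: "H \<in> h" for H
    proof -
      note sc = rvs.subspace_scale[OF g0] rvs.subspace_diff[OF g0] rvs.subspace_add[OF g0]
      have "B (rpart (c *\<^sub>C Z + K)) H = Re c * B (rpart Z) H - Im c * B (ipart Z) H + B (rpart K) H"
        "B (ipart (c *\<^sub>C Z + K)) H = Im c * B (rpart Z) H + Re c * B (ipart Z) H + B (ipart K) H"
        unfolding ri_add ri_scale using ZK hg[OF H] by (simp_all only: Bs(2-4) sc)
      then show ?thesis using st'[OF H] K(2,3)[OF H] by (simp add: algebra_simps)
    qed
    then show ?case using Z K(1) by (blast intro: cvs.span_add cvs.span_scale)
  qed
  have unique: "H = K" if HK: "H \<in> ?L" "K \<in> ?L" "\<alpha> H = 2" "\<alpha> K = 2" for H K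
  proof -
    have mem: "H - K \<in> ?L" using HK by (blast intro: cvs.span_diff)
    obtain s t where st: "H - K \<in> hC" "\<And>H'. H' \<in> h \<Longrightarrow> B (rpart (H - K)) H' = s * a H'"
      "\<And>H'. H' \<in> h \<Longrightarrow> B (ipart (H - K)) H' = t * a H'" using L[OF mem] by blast
    have "\<alpha> (K + (H - K)) = \<alpha> K + \<alpha> (H - K)" using L[OF HK(2)] st by (simp only: dual_linear[OF dual(1)])
    then have "\<alpha> (H - K) = 0" using HK by simp
    \<comment> \<open>Now the difference pairs to zero with itself: pairing its parts with h gives
      multiples of a, and a vanishes on these parts.\<close>
    then have "a (rpart (H - K)) = 0" "a (ipart (H - K)) = 0"
      unfolding \<alpha>_hC[OF st(1)] by (simp_all add: complex_eq_iff)
    then have "B (rpart (H - K)) (rpart (H - K)) = 0" "B (ipart (H - K)) (ipart (H - K)) = 0"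
      using st(2,3) hC_ri[OF st(1)] by simp_all
    then have "rpart (H - K) = 0" "ipart (H - K) = 0" using neg hC_ri[OF st(1)] by fastforce+
    then have "H - K = 0" using ri_sum[of "H - K"] by simp
    then show ?thesis by simp
  qed
  have "0 \<in> root_space hC \<alpha>" by (simp add: root_space_def brk_right)
  then obtain x where x: "x \<in> root_space hC \<alpha>" "x \<noteq> 0" using \<alpha> by (auto simp: roots_def)
  define p q where "p = rpart x" and "q = ipart x"
  have pqS: "p \<in> S" "q \<in> S" using ri_span[OF S(1)] S x by (auto simp: p_def q_def)
  then have pq: "p \<in> ?g0" "q \<in> ?g0" using S(2) by auto
  have pq0: "p \<noteq> 0 \<or> q \<noteq> 0" using x(2) ri_sum[of x] by (auto simp: p_def q_def)
  have x0: "x \<in> hpart 0" using x even by blast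
  have cjx: "cj x \<in> root_space hC (\<lambda>H. - \<alpha> H)"
    using cj_root_space[OF dual(1) _ x(1)] root_imaginary[OF \<alpha>] by blast
  define w where "w = brk p q"
  have z: "brk x (cj x) = (- 2 * \<i>) *\<^sub>C w"
  proof -
    have "brk x (cj x) = brk (p + \<i> *\<^sub>C q) (p - \<i> *\<^sub>C q)"
      using ri_sum[of x] by (simp add: cj_def p_def q_def)
    also have "\<dots> = - (\<i> *\<^sub>C brk p q) + \<i> *\<^sub>C brk q p"
      using pq by (simp add: brk_left brk_right brk_even_self)
    also have "brk q p = - w" using brk_even_skew[of p q] pq by (simp add: w_def)
    also have "- (\<i> *\<^sub>C brk p q) + \<i> *\<^sub>C - w = (- 2 * \<i>) *\<^sub>C w"
      using scaleC_add_left[of "- \<i>" "- \<i>" w] by (simp add: w_def)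
    finally show ?thesis .
  qed
  have zC: "brk x (cj x) \<in> hC" by (rule bracket[OF x(1) cjx])
  have wC: "w \<in> hC"
    using cvs.span_scale[OF zC, of "\<i> / 2"] by (simp add: z scaleC_scaleC scaleC_one)
  have wg: "w \<in> g" using pq g_brk by (simp add: w_def)
  have wh: "w \<in> h"
    using hC_ri(1)[OF wC] ri_eqI(1)[of w 0 w] wg rvs.subspace_0[OF g_subspace] by simp
  \<comment> \<open>Both formulas are derived, from the brackets of p, q in either order, because
    only one of p and q is known to be nonzero when w is shown not to vanish.\<close>
  have Bw: "B w H = - a H * B p p \<and> B w H = - a H * B q q" if H: "H \<in> h" for H
  proof -
    have "brk H x = (\<i> * of_real (a H)) *\<^sub>C x"
      using x(1) H a[OF H] by (simp add: root_space_def cvs.span_base)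
    from ri_eigen[OF this] have Hpq: "brk H p = scaleRC (- a H) q" "brk H q = scaleRC (a H) p"
      using hg[OF H] by (auto simp: p_def q_def)
    have neg_brk: "brk u H = - brk H u" for u using brk_even_skew hg[OF H] by blast
    have n: "brk q H = scaleRC (- a H) p" "brk p H = scaleRC (a H) q"
      by (simp_all add: neg_brk Hpq scaleRC_def)
    have "B w H = B p (brk q H)" unfolding w_def using pq hg[OF H] by (rule inv)
    then have 1: "B w H = - a H * B p p" using pq by (simp only: n Bs(5))
    have "w = scaleRC (- 1) (brk q p)"
      using brk_even_skew[of q p] pq by (simp add: w_def scaleRC_def scaleC_one)
    moreover have "brk q p \<in> ?g0" using pq g_brk brk_hpart[of q 0 p 0] by auto
    ultimately have "B w H = - 1 * B q (brk p H)"
      using Bs(3)[of "brk q p" H H "- 1"] inv[of q p H] pq hg[OF H] by (simp del: mult_minus_left)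
    then have "B w H = - a H * B q q" using pq by (simp only: n Bs(5))
    with 1 show ?thesis by blast
  qed
  have w0: "w \<noteq> 0"
  proof
    assume "w = 0"
    then have "B w H = 0" if "H \<in> h" for H using Bs(6)[OF hg[OF that] hg[OF that] hg[OF that]] by simp
    moreover have "B p p \<noteq> 0 \<or> B q q \<noteq> 0" using pq0 pqS sgn by fastforce
    ultimately have a0: "a H = 0" if "H \<in> h" for H using Bw[OF that] that by auto
    have "\<alpha> H = 0" if "H \<in> hC" for H
      using \<alpha>_hC[OF that] a0 hC_ri[OF that] by simp
    then show False using dual_nonzero[OF dual] by blast
  qed
  \<comment> \<open>Putting H = w gives a(w) B(p, p) = -B(w, w) > 0, so a(w) has the sign of B on
    S.\<close>
  have aw: "e * a w > 0"
  proof -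
    have "B w w < 0" using neg wh w0 by blast
    then have "a w * B p p > 0" using Bw[OF wh] by simp
    moreover from this have "p \<noteq> 0" using Bs(6)[OF pq(1) pq(1) pq(1)] by auto
    then have "e * B p p > 0" using sgn pqS by blast
    ultimately show ?thesis by (auto simp: zero_less_mult_iff)
  qed
  have \<alpha>z: "\<alpha> (brk x (cj x)) = of_real (2 * a w)"
    unfolding z dual_linear(2)[OF dual(1) wC] a[OF wh] by simp
  \<comment> \<open>The bracket has \<alpha>-value 2 a(w), and the coroot has \<alpha>-value
    2.\<close>
  define r where "r = 1 / a w"
  have er: "e * r > 0" using aw by (auto simp: r_def zero_less_mult_iff zero_less_divide_iff)
  have "coroot hC \<alpha> = of_real r *\<^sub>C brk x (cj x)"
    unfolding coroot_def
  proof (rule the_equality)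
    have "of_real r *\<^sub>C brk x (cj x) \<in> ?L" using x cjx by (blast intro: cvs.span_scale cvs.span_base)
    moreover have "\<alpha> (of_real r *\<^sub>C brk x (cj x)) = 2"
    proof -
      have "a w \<noteq> 0" using aw by (metis less_irrefl mult_zero_right)
      then show ?thesis by (simp add: dual_linear(2)[OF dual(1) zC] \<alpha>z r_def)
    qed
    ultimately show c: "of_real r *\<^sub>C brk x (cj x) \<in> ?L \<and> \<alpha> (of_real r *\<^sub>C brk x (cj x)) = 2" by blast
    show "H = of_real r *\<^sub>C brk x (cj x)" if "H \<in> ?L \<and> \<alpha> H = 2" for H
      using unique that c by blast
  qed
  with x x0 er zC show ?thesis by blast
qed

end

section \<open>Inequalities for the coroots and conclusion\<close>

context unitary_highest_weight
begin

lemma lam_bracket_nonpos: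
  assumes "\<alpha> \<in> P" "x \<in> root_space hC \<alpha>" "x \<in> hpart 0" "brk x (cj x) \<in> hC"
  shows "lam (brk x (cj x)) \<in> \<real>\<^sub>\<le>\<^sub>0"
proof -
  let ?z = "brk x (cj x)"
  have "1 * uea_gen x \<in> uea_nplus hC P"
    unfolding uea_nplus_def using assms by (blast intro: cvs.span_base)
  then have "\<Phi> (uea_gen x * 1) = 0" using \<Phi>_nplus by simp
  then have x0: "\<rho> x hv = 0" by (simp only: \<Phi>_gen hv_def)
  have "\<rho> ?z hv = \<rho> x (\<rho> (cj x) hv) - koszul 0 0 *\<^sub>C \<rho> (cj x) (\<rho> x hv)"
    using rep assms(3) cj_hpart[OF assms(3)] unfolding representation_def by blast
  then have z: "\<rho> ?z hv = \<rho> x (\<rho> (cj x) hv)" by (simp add: x0 \<rho>_simps)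
  have "\<theta> (cj x) = (- 1) *\<^sub>C x" by (simp add: \<theta>_hom[OF cj_hpart[OF assms(3)]] sg_def cj_cj)
  then have "ip (\<rho> (cj x) hv) (\<rho> (cj x) hv) = - ip hv (\<rho> ?z hv)"
    by (simp only: ip_adjoint \<rho>_left(2) ip_right(2) z) simp
  also have "\<rho> ?z hv = lam ?z *\<^sub>C hv" using hv_weight assms(4) by (simp add: wspace_def)
  finally have eq: "ip (\<rho> (cj x) hv) (\<rho> (cj x) hv) = - cnj (lam ?z) * ip hv hv" by (simp add: ip_right)
  have "ip hv hv \<noteq> 0" using ip_pos[OF hv_nonzero] by auto
  then have "- cnj (lam ?z) = ip (\<rho> (cj x) hv) (\<rho> (cj x) hv) / ip hv hv" using eq by simp
  also have "\<dots> \<in> \<real>\<^sub>\<ge>\<^sub>0" by (intro nonneg_Reals_divide_I ip_nonneg)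
  finally show ?thesis by (simp add: complex_nonneg_Reals_iff complex_nonpos_Reals_iff)
qed

end

theorem theorem1p3:
  fixes g k p0 h :: "'g::lie_superalgebra set"
    and P :: "('g \<Rightarrow> complex) set"
    and lam :: "'g \<Rightarrow> complex"
    and V :: "bit \<Rightarrow> 'v::complex_vector set"
    and \<rho> :: "'g \<Rightarrow> 'v \<Rightarrow> 'v"
  assumes "finite_dim TYPE('g)"
    and "contragredient TYPE('g)"
    and "real_form g"
    and "maximal_compact_subalgebra g k"
    and "cartan_decomposition g k p0"
    and "rvs.subspace h" and "h \<subseteq> k" and "cartan_subalgebra (cvs.span h)"
    and "center_of (cvs.span k) \<noteq> {0}"
    and "positive_system (cvs.span h) P"
    and "admissible (cvs.span h) g k p0 P"
    and "lam \<in> dual_of (cvs.span h)"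
    and "is_pi_lambda (cvs.span h) P lam V \<rho>"
  shows "(unitary_rep g V \<rho> \<longleftrightarrow>
            (\<forall>p. \<forall>a\<in>uea_part p.
               (- \<i>) ^ of_bool (p = 1) *
               eval_at (cvs.span h) lam (beta (cvs.span h) P (uea_adjoint g a * a)) \<in> \<real>\<^sub>\<ge>\<^sub>0))
       \<and> (unitary_rep g V \<rho> \<longrightarrow>
            (\<forall>\<alpha>\<in>P. compact_root (cvs.span h) k \<alpha> \<longrightarrow> lam (coroot (cvs.span h) \<alpha>) \<in> \<real>\<^sub>\<ge>\<^sub>0) \<and>
            (\<forall>\<alpha>\<in>P. even_root (cvs.span h) \<alpha> \<and> noncompact_root (cvs.span h) g p0 \<alpha> \<longrightarrow>
               lam (coroot (cvs.span h) \<alpha>) \<in> \<real>\<^sub>\<le>\<^sub>0))"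
proof -
  let ?h = "cvs.span h"
  have mc: "compact_subalgebra g k" using assms(4) by (simp add: maximal_compact_subalgebra_def)
  then obtain Q where Q: "symm_bilinear_on g Q" "\<forall>x\<in>g. x \<noteq> 0 \<longrightarrow> Q x x > 0"
    "\<forall>z\<in>k. \<forall>x\<in>g. \<forall>y\<in>g. Q (brk z x) y = - Q x (brk z y)" and k: "k \<subseteq> g \<inter> hpart 0"
    unfolding compact_subalgebra_def by blast
  from assms(5) obtain B where B: "symm_bilinear_on (g \<inter> hpart 0) B"
    "\<forall>x\<in>g \<inter> hpart 0. \<forall>y\<in>g \<inter> hpart 0. \<forall>z\<in>g \<inter> hpart 0. B (brk x y) z = B x (brk y z)"
    "\<forall>x\<in>k. x \<noteq> 0 \<longrightarrow> B x x < 0" "\<forall>x\<in>p0. x \<noteq> 0 \<longrightarrow> B x x > 0"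
    and cd: "rvs.subspace k" "rvs.subspace p0" "p0 \<subseteq> g \<inter> hpart 0"
    unfolding cartan_decomposition_def by (elim conjE exE) blast
  from assms(13) obtain \<Phi> d where \<Phi>: "clinear \<Phi>" "surj \<Phi>" "\<And>x a. \<Phi> (uea_gen x * a) = \<rho> x (\<Phi> a)"
    "\<And>a. a \<in> verma_ideal ?h P lam \<Longrightarrow> \<Phi> a = 0" "\<And>p a. a \<in> uea_part p \<Longrightarrow> \<Phi> a \<in> V (p + d)"
    and rep: "representation V \<rho>" "irreducible_rep V \<rho>"
    unfolding is_pi_lambda_def quotient_of_verma_def by blast
  interpret highest_weight_module g h P V \<rho> lam \<Phi> d
  proof (intro highest_weight_module.intro highest_weight_module_axioms.intro pos_torus.intro
      pos_torus_axioms.intro torus.intro torus_axioms.intro real_form_algebra.intro)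
    show "\<exists>Q. symm_bilinear_on g Q \<and> (\<forall>x\<in>g. x \<noteq> 0 \<longrightarrow> Q x x > 0) \<and>
      (\<forall>z\<in>h. \<forall>x\<in>g. \<forall>y\<in>g. Q (brk z x) y = - Q x (brk z y))"
      using Q assms(7) by (intro exI[of _ Q]) blast
    show "h \<subseteq> g \<inter> hpart 0" using k assms(7) by blast
  qed (fact assms \<Phi> rep)+
  have if_nonneg: "unitary_rep g V \<rho>"
    if "\<forall>p. \<forall>a\<in>uea_part p.
      (- \<i>) ^ of_bool (p = 1) * eval_at ?h lam (beta ?h P (uea_adjoint g a * a)) \<in> \<real>\<^sub>\<ge>\<^sub>0"
  proof (rule unitary_if_nonneg)
    show "N (D a * a) \<in> \<real>\<^sub>\<ge>\<^sub>0" if a: "a \<in> uea_part p" for p a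
      using \<open>\<forall>p. \<forall>a\<in>uea_part p. _\<close> a star_N[OF a] by metis
  qed
  have only_if: "(\<forall>p. \<forall>a\<in>uea_part p.
      (- \<i>) ^ of_bool (p = 1) * eval_at ?h lam (beta ?h P (uea_adjoint g a * a)) \<in> \<real>\<^sub>\<ge>\<^sub>0) \<and>
    (\<forall>\<alpha>\<in>P. compact_root ?h k \<alpha> \<longrightarrow> lam (coroot ?h \<alpha>) \<in> \<real>\<^sub>\<ge>\<^sub>0) \<and>
    (\<forall>\<alpha>\<in>P. even_root ?h \<alpha> \<and> noncompact_root ?h g p0 \<alpha> \<longrightarrow> lam (coroot ?h \<alpha>) \<in> \<real>\<^sub>\<le>\<^sub>0)"
    if "unitary_rep g V \<rho>"
  proof -
    from that obtain ip where ip: "hermitian_product ip"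
      "\<And>z. z \<in> g \<inter> hpart 0 \<Longrightarrow> symmetric_op ip (\<lambda>v. \<i> *\<^sub>C \<rho> z v)"
      "\<And>x. x \<in> g \<inter> hpart 1 \<Longrightarrow> symmetric_op ip (\<lambda>v. exp (- (\<i> * pi / 4)) *\<^sub>C \<rho> x v)"
      unfolding unitary_rep_def by blast
    interpret unitary_highest_weight g h P V \<rho> lam \<Phi> d ip
      by unfold_locales (fact ip)+
    have neg: "B H H < 0" if "H \<in> h" "H \<noteq> 0" for H using that assms(7) B(3) by blast
    \<comment> \<open>The number e records the sign of B on S, so k and p0 are treated together; r
      is the reciprocal of the factor between coroot and bracket and has the same sign as e.\<close>
    have lam_coroot: "\<exists>r. e * r > 0 \<and> of_real r * lam (coroot ?h \<alpha>) \<in> \<real>\<^sub>\<le>\<^sub>0"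
      if \<alpha>: "\<alpha> \<in> P" and S: "rvs.subspace S" "S \<subseteq> g \<inter> hpart 0" "root_space ?h \<alpha> \<subseteq> cvs.span S"
        and sgn: "\<And>x. x \<in> S \<Longrightarrow> x \<noteq> 0 \<Longrightarrow> e * B x x > 0" for \<alpha> S e
    proof -
      have "\<alpha> \<in> roots ?h" using \<alpha> H0(3) by blast
      from coroot_of_even_root[OF this S B(1) _ neg sgn] B(2) obtain x r where
        x: "x \<in> root_space ?h \<alpha>" "x \<in> hpart 0" "e * r > 0" "brk x (cj x) \<in> ?h"
        "coroot ?h \<alpha> = of_real r *\<^sub>C brk x (cj x)" by blast
      have "r \<noteq> 0" using x(3) by auto
      then have "of_real (1 / r) * lam (coroot ?h \<alpha>) = lam (brk x (cj x))"
        by (simp add: x(5) dual_linear(2)[OF lam x(4)])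
      moreover have "e * (1 / r) > 0" using x(3) by (auto simp: zero_less_mult_iff zero_less_divide_iff)
      ultimately show ?thesis using lam_bracket_nonpos[OF \<alpha> x(1,2,4)] by metis
    qed
    show ?thesis
    proof (intro conjI allI ballI impI)
      show "(- \<i>) ^ of_bool (p = 1) * eval_at ?h lam (beta ?h P (uea_adjoint g a * a)) \<in> \<real>\<^sub>\<ge>\<^sub>0"
        if "a \<in> uea_part p" for p a
        unfolding star_N[OF that] by (rule N_nonneg)
    next
      fix \<alpha> assume "\<alpha> \<in> P" "compact_root ?h k \<alpha>"
      \<comment> \<open>B is negative on k, so the factor is negative and the inequality for the
        bracket is reversed.\<close>
      then have "\<exists>r. - 1 * r > 0 \<and> of_real r * lam (coroot ?h \<alpha>) \<in> \<real>\<^sub>\<le>\<^sub>0"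
        using cd k B(3) by (intro lam_coroot[of \<alpha> k]) (auto simp: compact_root_def)
      then show "lam (coroot ?h \<alpha>) \<in> \<real>\<^sub>\<ge>\<^sub>0"
        by (auto simp: complex_nonneg_Reals_iff complex_nonpos_Reals_iff mult_le_0_iff)
    next
      fix \<alpha> assume \<alpha>: "\<alpha> \<in> P" "even_root ?h \<alpha> \<and> noncompact_root ?h g p0 \<alpha>"
      then have "root_space ?h \<alpha> \<subseteq> cvs.span p0"
        using p_complex_even[of _ g p0] cd(3) unfolding even_root_def noncompact_root_def by blast
      \<comment> \<open>B is positive on p0, so the coroot is a positive multiple of the bracket and
        the inequality keeps its direction.\<close>
      then have "\<exists>r. 1 * r > 0 \<and> of_real r * lam (coroot ?h \<alpha>) \<in> \<real>\<^sub>\<le>\<^sub>0"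
        using cd B(4) \<alpha>(1) by (intro lam_coroot[of \<alpha> p0]) auto
      then show "lam (coroot ?h \<alpha>) \<in> \<real>\<^sub>\<le>\<^sub>0"
        by (auto simp: complex_nonpos_Reals_iff mult_le_0_iff)
    qed
  qed
  show ?thesis using if_nonneg only_if by blast
qed

end
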